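(* Every $\tilde f\in\mathcal GC_\mu(\Gamma)$ admits a holomorphic $\Sigma$-factorization, i.e. a representation $\tilde f=\tilde f_-\,r\,\tilde f_+$ on $\Gamma$ with $\tilde f_\pm\in\mathcal GC_\mu^\pm(\Gamma)$ and $r\in\mathcal R(\Sigma)$.
   Context: Fix $k_0>1$, $\mu\in(0,1)$. $\Sigma$ is the compact Riemann surface of genus $1$ obtained from the curve $\tau^2=(1+\xi^2)(k_0^2+\xi^2)$ in $\mathbb C^2$ by adding two points at infinity; $\Pi(\xi,\tau)=\xi$. $\dot{\mathbb R}=\mathbb R\cup\{\infty\}$, $\Sigma^\pm=\Pi^{-1}(\mathbb C^\pm)$ ($\mathbb C^\pm$ the open upper/lower half-planes), and $\Gamma=\Pi^{-1}(\dot{\mathbb R})$, which is the disjoint union of two closed curves $\Gamma_1,\Gamma_2$, each mapped homeomorphically onto $\dot{\mathbb R}$ by $\Pi$. $C_\mu(\dot{\mathbb R})$: continuous functions on $\dot{\mathbb R}$ satisfying a Hölder condition of exponent $\mu$ (Hölder after transplanting to the unit circle by $\xi\mapsto(\xi-i)/(\xi+i)$). $C_\mu(\Gamma)$: functions on $\Gamma$ whose restrictions to $\Gamma_1,\Gamma_2$, viewed via $\Pi$ on $\dot{\mathbb R}$, are in $C_\mu(\dot{\mathbb R})$. $C_\mu^\pm(\Gamma)$: elements of $C_\mu(\Gamma)$ extending continuously to $\Sigma^\pm\cup\Gamma$ and analytically to $\Sigma^\pm$. $\mathcal G\mathcal A$: invertible elements of the algebra $\mathcal A$. $\mathcal R(\Sigma)$: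 rational (globally meromorphic) functions on $\Sigma$ without poles on $\Gamma$. *)

theory Defs
  imports "HOL-Complex_Analysis.Complex_Analysis"
begin

section \<open>The compact Riemann surface of the curve\<close>

text \<open>
  The affine curve \<open>\<tau>\<^sup>2 = (1 + \<xi>\<^sup>2)(k\<^sup>2 + \<xi>\<^sup>2)\<close>, and the affine curve that it becomes in the
  coordinates \<open>\<zeta> = 1/\<xi>\<close>, \<open>\<sigma> = \<tau>/\<xi>\<^sup>2\<close>.  The surface is obtained by gluing the two along
  \<open>\<xi> \<noteq> 0\<close>, \<open>\<zeta> \<noteq> 0\<close>; the two points at infinity are \<open>(\<zeta>, \<sigma>) = (0, 1)\<close> and \<open>(0, -1)\<close>.
\<close>

definition aff_curve :: "real \<Rightarrow> (complex \<times> complex) set" where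
  "aff_curve k = {(\<xi>, \<tau>). \<tau>\<^sup>2 = (1 + \<xi>\<^sup>2) * ((complex_of_real k)\<^sup>2 + \<xi>\<^sup>2)}"

definition inf_curve :: "real \<Rightarrow> (complex \<times> complex) set" where
  "inf_curve k = {(\<zeta>, \<sigma>). \<sigma>\<^sup>2 = (1 + \<zeta>\<^sup>2) * (1 + (complex_of_real k)\<^sup>2 * \<zeta>\<^sup>2)}"

datatype point = Aff complex complex | Infty complex

fun glue_aff :: "complex \<times> complex \<Rightarrow> point" where
  "glue_aff (\<xi>, \<tau>) = Aff \<xi> \<tau>"

fun glue_inf :: "complex \<times> complex \<Rightarrow> point" where
  "glue_inf (\<zeta>, \<sigma>) = (if \<zeta> = 0 then Infty \<sigma> else Aff (1 / \<zeta>) (\<sigma> / \<zeta>\<^sup>2))"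

definition surf :: "real \<Rightarrow> point set" where
  "surf k = glue_aff ` aff_curve k \<union> glue_inf ` inf_curve k"

lemma surf_eq:
  "surf k = {Aff \<xi> \<tau> | \<xi> \<tau>. (\<xi>, \<tau>) \<in> aff_curve k} \<union> {Infty 1, Infty (-1)}"
proof -
  have "glue_inf (\<zeta>, \<sigma>) \<in> {Aff \<xi> \<tau> | \<xi> \<tau>. (\<xi>, \<tau>) \<in> aff_curve k} \<union> {Infty 1, Infty (-1)}"
    if "(\<zeta>, \<sigma>) \<in> inf_curve k" for \<zeta> \<sigma>
  proof (cases "\<zeta> = 0")
    case True
    then show ?thesis
      using that by (auto simp: inf_curve_def power2_eq_1_iff)
  next
    case False
    have "(\<sigma> / \<zeta>\<^sup>2)\<^sup>2 = (1 + (1 / \<zeta>)\<^sup>2) * ((complex_of_real k)\<^sup>2 + (1 / \<zeta>)\<^sup>2)"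
      using that False unfolding inf_curve_def
      by (simp add: divide_simps) (simp add: algebra_simps power2_eq_square)
    with False show ?thesis
      by (simp add: aff_curve_def)
  qed
  then have "glue_inf x \<in> {Aff \<xi> \<tau> | \<xi> \<tau>. (\<xi>, \<tau>) \<in> aff_curve k} \<union> {Infty 1, Infty (-1)}"
    if "x \<in> inf_curve k" for x
    using that by (cases x) blast
  then have "glue_inf ` inf_curve k \<subseteq> {Aff \<xi> \<tau> | \<xi> \<tau>. (\<xi>, \<tau>) \<in> aff_curve k} \<union> {Infty 1, Infty (-1)}"
    by (rule image_subsetI)
  moreover have "Infty \<sigma> \<in> glue_inf ` inf_curve k" if "\<sigma>\<^sup>2 = 1" for \<sigma>
    using that by (intro image_eqI[where x = "(0, \<sigma>)"]) (simp_all add: inf_curve_def)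
  then have "{Infty 1, Infty (-1)} \<subseteq> glue_inf ` inf_curve k"
    by simp
  moreover have "glue_aff ` aff_curve k = {Aff \<xi> \<tau> | \<xi> \<tau>. (\<xi>, \<tau>) \<in> aff_curve k}"
  proof -
    have "glue_aff ` aff_curve k = (\<lambda>(\<xi>, \<tau>). Aff \<xi> \<tau>) ` aff_curve k"
      by (rule image_cong) auto
    then show ?thesis
      by auto
  qed
  ultimately show ?thesis
    unfolding surf_def by blast
qed

definition surf_open :: "real \<Rightarrow> point set \<Rightarrow> bool" where
  "surf_open k V \<longleftrightarrow> V \<subseteq> surf k \<and>
     openin (top_of_set (aff_curve k)) {x \<in> aff_curve k. glue_aff x \<in> V} \<and>
     openin (top_of_set (inf_curve k)) {x \<in> inf_curve k. glue_inf x \<in> V}"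

definition surf_topology :: "real \<Rightarrow> point topology" where
  "surf_topology k = topology (surf_open k)"

lemma istopology_surf_open: "istopology (surf_open k)"
proof -
  have "surf_open k (S \<inter> T)" if "surf_open k S" "surf_open k T" for S T
  proof -
    have "{x \<in> A. g x \<in> S \<inter> T} = {x \<in> A. g x \<in> S} \<inter> {x \<in> A. g x \<in> T}"
      for A and g :: "complex \<times> complex \<Rightarrow> point"
      by auto
    then show ?thesis
      using that by (auto simp: surf_open_def simp del: Int_iff)
  qed
  moreover have "surf_open k (\<Union>\<K>)" if "\<forall>K\<in>\<K>. surf_open k K" for \<K>
  proof -
    have "{x \<in> A. g x \<in> \<Union>\<K>} = (\<Union>K\<in>\<K>. {x \<in> A. g x \<in> K})"
      for A and g :: "complex \<times> complex \<Rightarrow> point"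
      by auto
    then show ?thesis
      using that by (auto simp: surf_open_def simp del: Union_iff)
  qed
  ultimately show ?thesis
    by (simp add: istopology_def)
qed

lemma openin_surf_topology: "openin (surf_topology k) = surf_open k"
  unfolding surf_topology_def by (simp add: istopology_surf_open)

lemma topspace_surf_topology: "topspace (surf_topology k) = surf k"
proof -
  have "surf_open k (surf k)"
  proof -
    have "{x \<in> aff_curve k. glue_aff x \<in> surf k} = aff_curve k"
      "{x \<in> inf_curve k. glue_inf x \<in> surf k} = inf_curve k"
      by (auto simp: surf_def)
    then show ?thesis
      by (simp add: surf_open_def)
  qed
  then show ?thesis
    by (auto simp: topspace_def openin_surf_topology surf_open_def)
qed

text \<open>
  The charts are all restrictions of \<open>\<xi>\<close>, \<open>\<tau>\<close> or \<open>\<zeta> = 1/\<xi>\<close> to open sets that these coordinates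
  map homeomorphically onto open subsets of the plane: \<open>\<xi>\<close> serves near finite points with
  \<open>\<tau> \<noteq> 0\<close>, \<open>\<tau>\<close> near the four branch points, \<open>\<zeta>\<close> near the points at infinity.  As an injective
  holomorphic function is biholomorphic, the transition maps are holomorphic.
  The value of a coordinate at a point outside its domain is irrelevant.
\<close>

fun coord_xi :: "point \<Rightarrow> complex" where
  "coord_xi (Aff \<xi> \<tau>) = \<xi>"
| "coord_xi (Infty \<sigma>) = 0"

fun coord_tau :: "point \<Rightarrow> complex" where
  "coord_tau (Aff \<xi> \<tau>) = \<tau>"
| "coord_tau (Infty \<sigma>) = 0"

fun coord_zeta :: "point \<Rightarrow> complex" where
  "coord_zeta (Aff \<xi> \<tau>) = 1 / \<xi>"
| "coord_zeta (Infty \<sigma>) = 0"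

definition surf_chart :: "real \<Rightarrow> point set \<Rightarrow> (point \<Rightarrow> complex) \<Rightarrow> bool" where
  "surf_chart k U \<phi> \<longleftrightarrow>
     openin (surf_topology k) U \<and>
     (\<phi> \<in> {coord_xi, coord_tau} \<and> U \<subseteq> glue_aff ` aff_curve k \<or>
      \<phi> = coord_zeta \<and> U \<subseteq> glue_inf ` inf_curve k) \<and>
     open (\<phi> ` U) \<and>
     homeomorphic_map (subtopology (surf_topology k) U) (top_of_set (\<phi> ` U)) \<phi>"

definition surf_holomorphic_on :: "real \<Rightarrow> (point \<Rightarrow> complex) \<Rightarrow> point set \<Rightarrow> bool" where
  "surf_holomorphic_on k F W \<longleftrightarrow>
     (\<forall>p\<in>W. \<exists>U \<phi>. surf_chart k U \<phi> \<and> p \<in> U \<and> (F \<circ> inv_into U \<phi>) holomorphic_on \<phi> ` U)"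

text \<open>
  As for the library predicate on which it rests, the values of a meromorphic function at its
  poles, and more generally on a discrete set, do not matter.
\<close>

definition surf_meromorphic_on :: "real \<Rightarrow> (point \<Rightarrow> complex) \<Rightarrow> point set \<Rightarrow> bool" where
  "surf_meromorphic_on k F W \<longleftrightarrow>
     (\<forall>p\<in>W. \<exists>U \<phi>. surf_chart k U \<phi> \<and> p \<in> U \<and> (F \<circ> inv_into U \<phi>) meromorphic_on \<phi> ` U)"


section \<open>The projection and the contour\<close>

text \<open>The element \<open>None\<close> of \<open>complex option\<close> plays the role of \<open>\<infinity>\<close>.\<close>

fun proj :: "point \<Rightarrow> complex option" where
  "proj (Aff \<xi> \<tau>) = Some \<xi>"
| "proj (Infty \<sigma>) = None"

definition dot_real :: "complex option set" where
  "dot_real = insert None (Some ` range complex_of_real)"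

definition surf_plus :: "real \<Rightarrow> point set" where
  "surf_plus k = {p \<in> surf k. proj p \<in> Some ` {z. Im z > 0}}"

definition surf_minus :: "real \<Rightarrow> point set" where
  "surf_minus k = {p \<in> surf k. proj p \<in> Some ` {z. Im z < 0}}"

definition contour :: "real \<Rightarrow> point set" where
  "contour k = {p \<in> surf k. proj p \<in> dot_real}"

definition tau_real :: "real \<Rightarrow> real \<Rightarrow> real" where
  "tau_real k x = sqrt ((1 + x\<^sup>2) * (k\<^sup>2 + x\<^sup>2))"

text \<open>
  Over the real line \<open>\<tau>\<close> is real and nonzero, and \<open>\<sigma> = \<tau>/\<xi>\<^sup>2\<close> has the sign of \<open>\<tau>\<close>; so the two
  closed curves are \<open>\<tau> > 0\<close> and \<open>\<tau> < 0\<close>, completed by \<open>\<sigma> = 1\<close> and \<open>\<sigma> = -1\<close> respectively.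
\<close>

definition contour1 :: "real \<Rightarrow> point set" where
  "contour1 k = insert (Infty 1)
     (range (\<lambda>x. Aff (complex_of_real x) (complex_of_real (tau_real k x))))"

definition contour2 :: "real \<Rightarrow> point set" where
  "contour2 k = insert (Infty (-1))
     (range (\<lambda>x. Aff (complex_of_real x) (complex_of_real (- tau_real k x))))"

lemma contour_eq: "contour k = contour1 k \<union> contour2 k"
proof -
  have sq: "(complex_of_real (tau_real k x))\<^sup>2 =
      (1 + (complex_of_real x)\<^sup>2) * ((complex_of_real k)\<^sup>2 + (complex_of_real x)\<^sup>2)" for x
  proof -
    have "(tau_real k x)\<^sup>2 = (1 + x\<^sup>2) * (k\<^sup>2 + x\<^sup>2)"
      by (simp add: tau_real_def)
    then have "complex_of_real ((tau_real k x)\<^sup>2) = complex_of_real ((1 + x\<^sup>2) * (k\<^sup>2 + x\<^sup>2))"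
      by (rule arg_cong)
    then show ?thesis
      by simp
  qed
  have "(complex_of_real x, \<tau>) \<in> aff_curve k \<longleftrightarrow>
      \<tau> = complex_of_real (tau_real k x) \<or> \<tau> = - complex_of_real (tau_real k x)" for x \<tau>
    by (simp add: aff_curve_def sq[symmetric] power2_eq_iff)
  then show ?thesis
    by (auto simp: contour_def contour1_def contour2_def surf_eq dot_real_def)
qed

lemma contour_disjoint:
  assumes "k \<noteq> 0"
  shows "contour1 k \<inter> contour2 k = {}"
proof -
  have "tau_real k x > 0" for x
  proof -
    have "0 < (1 + x\<^sup>2) * (k\<^sup>2 + x\<^sup>2)"
      using assms by (intro mult_pos_pos add_pos_nonneg) auto
    then show ?thesis
      by (simp add: tau_real_def)
  qed
  then have "tau_real k x \<noteq> - tau_real k x" for x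
    by (metis less_imp_neq neg_equal_zero)
  then show ?thesis
    unfolding contour1_def contour2_def
    by (auto simp: complex_eq_iff)
qed

lemma bij_betw_proj_contour1: "bij_betw proj (contour1 k) dot_real"
  unfolding bij_betw_def
proof
  show "inj_on proj (contour1 k)"
    by (auto simp: inj_on_def contour1_def)
  show "proj ` contour1 k = dot_real"
    unfolding contour1_def dot_real_def by (simp add: image_image)
qed

lemma bij_betw_proj_contour2: "bij_betw proj (contour2 k) dot_real"
  unfolding bij_betw_def
proof
  show "inj_on proj (contour2 k)"
    by (auto simp: inj_on_def contour2_def)
  show "proj ` contour2 k = dot_real"
    unfolding contour2_def dot_real_def by (simp add: image_image)
qed


section \<open>Function algebras\<close>

text \<open>
  All functions are total in the logic.  A function on a set \<open>X\<close> is represented by any of its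
  extensions, and the algebras below restrict only the values on \<open>X\<close>, that is on
  \<open>dot_real\<close> or \<open>contour k\<close>.
\<close>

definition units_on :: "'a set \<Rightarrow> ('a \<Rightarrow> complex) set \<Rightarrow> ('a \<Rightarrow> complex) set" where
  "units_on X A = {f \<in> A. \<exists>g\<in>A. \<forall>x\<in>X. f x * g x = 1}"

fun cayley :: "complex option \<Rightarrow> complex" where
  "cayley None = 1"
| "cayley (Some \<xi>) = (\<xi> - \<i>) / (\<xi> + \<i>)"

text \<open>The Hoelder condition for a positive exponent includes continuity on the circle.\<close>

definition holder_dot_real :: "real \<Rightarrow> (complex option \<Rightarrow> complex) set" where
  "holder_dot_real \<mu> =
     {f. \<exists>C. \<forall>x\<in>dot_real. \<forall>y\<in>dot_real.
           norm (f x - f y) \<le> C * norm (cayley x - cayley y) powr \<mu>}"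

definition holder_contour :: "real \<Rightarrow> real \<Rightarrow> (point \<Rightarrow> complex) set" where
  "holder_contour k \<mu> =
     {f. f \<circ> inv_into (contour1 k) proj \<in> holder_dot_real \<mu> \<and>
         f \<circ> inv_into (contour2 k) proj \<in> holder_dot_real \<mu>}"

definition extends_analytically :: "real \<Rightarrow> point set \<Rightarrow> (point \<Rightarrow> complex) \<Rightarrow> bool" where
  "extends_analytically k W f \<longleftrightarrow>
     (\<exists>F. (\<forall>p\<in>contour k. F p = f p) \<and>
          continuous_map (subtopology (surf_topology k) (W \<union> contour k)) euclidean F \<and>
          surf_holomorphic_on k F W)"

definition holder_contour_plus :: "real \<Rightarrow> real \<Rightarrow> (point \<Rightarrow> complex) set" where
  "holder_contour_plus k \<mu> =
     {f \<in> holder_contour k \<mu>. extends_analytically k (surf_plus k) f}"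

definition holder_contour_minus :: "real \<Rightarrow> real \<Rightarrow> (point \<Rightarrow> complex) set" where
  "holder_contour_minus k \<mu> =
     {f \<in> holder_contour k \<mu>. extends_analytically k (surf_minus k) f}"

text \<open>
  Having no pole at a point of the contour includes having the correct value there, which is why
  the second condition asks for holomorphy at the points of the contour.
\<close>

definition rational_no_poles :: "real \<Rightarrow> (point \<Rightarrow> complex) set" where
  "rational_no_poles k =
     {r. surf_meromorphic_on k r (surf k) \<and> surf_holomorphic_on k r (contour k)}"

definition has_surf_factorization :: "real \<Rightarrow> real \<Rightarrow> (point \<Rightarrow> complex) \<Rightarrow> bool" where
  "has_surf_factorization k \<mu> f \<longleftrightarrow>
     (\<exists>f_minus \<in> units_on (contour k) (holder_contour_minus k \<mu>).
      \<exists>f_plus \<in> units_on (contour k) (holder_contour_plus k \<mu>).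
      \<exists>r \<in> rational_no_poles k.
        \<forall>p\<in>contour k. f p = f_minus p * r p * f_plus p)"

end

theory Submission
  imports Defs
begin

text \<open>
  Let \<open>w = (\<xi> - \<i>) / (\<xi> + \<i>)\<close> and \<open>\<eta> = \<tau> / (1 + \<xi>\<^sup>2)\<close>.  The function \<open>w\<close> identifies each of the two closed
  curves with the unit circle, and \<open>\<eta>\<close> takes opposite nonzero real values at points with the same \<open>w\<close>.
  So a function on the contour is the same as a pair of functions on the circle, or a sum \<open>a + \<eta> b\<close>
  with functions \<open>a\<close>, \<open>b\<close> of \<open>w\<close>.

  Winding numbers.  A non-vanishing Hoelder function on the circle has the form \<open>w\<^sup>n exp v\<close> with Hoelder
  continuous \<open>v\<close> (\<open>holder_logarithm\<close>).  Explicit rational functions (\<open>loop_function\<close>) wind once along one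
  of the curves and not along the other; together with \<open>1 / w\<close> they account for all pairs of winding
  numbers, and there remains a function \<open>exp (a + \<eta> b)\<close>.

  Additive decomposition.  By Privalov's theorem on Cauchy integrals, a Hoelder function on the circle
  is \<open>c + w A(w) + (1 / w) B(1 / w)\<close>, where \<open>A\<close> and \<open>B\<close> belong to the disc algebra and have Hoelder
  continuous boundary values, and \<open>c\<close> is the mean value (\<open>additive_decomposition_circle\<close>).  The function
  \<open>\<eta>\<close> has simple poles at the branch points over \<open>\<plusminus> \<i>\<close>.  The factors \<open>w\<close> and \<open>1 / w\<close> cancel the poles in the
  upper and in the lower half-plane respectively; hence \<open>a + \<eta> b\<close> is the sum of a function that extends
  to the upper side, one that extends to the lower side, and \<open>c \<eta>\<close>, where \<open>c\<close> is the mean value of \<open>b\<close>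
  (\<open>additive_decomposition_contour\<close>).  That one number is left over reflects the genus: the
  first cohomology group of the structure sheaf has dimension one.

  The obstruction.  It remains to factorize \<open>exp (c \<eta>)\<close> for every complex \<open>c\<close>, which amounts to the
  inversion theorem of Abel and Jacobi.  Since products of factorizations are factorizations, the set
  of admissible \<open>c\<close> is closed under addition, and it suffices that it contains a neighbourhood of \<open>0\<close>.
  For small \<open>t\<close>, the function \<open>1 + t \<eta>\<close> is rational, hence trivially factorized.  Decomposing its logarithm
  shows that the obstruction \<open>C(t)\<close> of that logarithm is admissible.  As \<open>C\<close> is holomorphic with \<open>C(0) = 0\<close>
  and \<open>C'(0) = 1\<close>, the open mapping theorem provides the neighbourhood (\<open>exp_small_eta_factorable\<close>).
\<close>

section \<open>Hoelder functions on the unit circle\<close>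

abbreviation unit_circle :: "complex set" where
  "unit_circle \<equiv> sphere 0 1"

definition holder_circle :: "real \<Rightarrow> (complex \<Rightarrow> complex) set" where
  "holder_circle \<mu> =
     {u. \<exists>C. \<forall>z\<in>unit_circle. \<forall>w\<in>unit_circle. norm (u z - u w) \<le> C * norm (z - w) powr \<mu>}"

lemma holder_circleE:
  assumes "u \<in> holder_circle \<mu>"
  obtains C where "C \<ge> 0"
    "\<forall>z\<in>unit_circle. \<forall>w\<in>unit_circle. norm (u z - u w) \<le> C * norm (z - w) powr \<mu>"
proof -
  obtain C where C: "\<forall>z\<in>unit_circle. \<forall>w\<in>unit_circle. norm (u z - u w) \<le> C * norm (z - w) powr \<mu>"
    using assms unfolding holder_circle_def by blast
  have "norm (u z - u w) \<le> max C 0 * norm (z - w) powr \<mu>"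
    if "z \<in> unit_circle" "w \<in> unit_circle" for z w
    using C that by (meson max.cobounded1 mult_right_mono order_trans powr_ge_zero)
  then show thesis
    using that[of "max C 0"] by auto
qed

lemma holder_circleI:
  assumes "\<And>z w. z \<in> unit_circle \<Longrightarrow> w \<in> unit_circle \<Longrightarrow> norm (u z - u w) \<le> C * norm (z - w) powr \<mu>"
  shows "u \<in> holder_circle \<mu>"
  using assms unfolding holder_circle_def by blast

lemma holder_circle_continuous:
  assumes "u \<in> holder_circle \<mu>" and "0 < \<mu>"
  shows "continuous_on unit_circle u"
proof -
  obtain C where C: "C \<ge> 0"
    "\<forall>z\<in>unit_circle. \<forall>w\<in>unit_circle. norm (u z - u w) \<le> C * norm (z - w) powr \<mu>"
    by (rule holder_circleE[OF assms(1)])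
  have "(u \<longlongrightarrow> u x) (at x within unit_circle)" if x: "x \<in> unit_circle" for x
  proof -
    have "((\<lambda>z. z - x) \<longlongrightarrow> x - x) (at x within unit_circle)"
      by (intro tendsto_intros)
    then have "((\<lambda>z. norm (z - x)) \<longlongrightarrow> 0) (at x within unit_circle)"
      by (simp add: tendsto_norm_zero)
    then have "((\<lambda>z. norm (z - x) powr \<mu>) \<longlongrightarrow> 0) (at x within unit_circle)"
      using \<open>0 < \<mu>\<close> by (intro tendsto_zero_powrI[OF _ tendsto_const]) simp_all
    from tendsto_mult_left[OF this, of C]
    have "((\<lambda>z. C * norm (z - x) powr \<mu>) \<longlongrightarrow> 0) (at x within unit_circle)"
      by simp
    moreover have "\<forall>\<^sub>F z in at x within unit_circle. norm (u z - u x) \<le> C * norm (z - x) powr \<mu>"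
      unfolding eventually_at_filter using C(2) x by (intro always_eventually) blast
    ultimately have "((\<lambda>z. u z - u x) \<longlongrightarrow> 0) (at x within unit_circle)"
      by (rule Lim_null_comparison[rotated])
    then show ?thesis
      by (simp add: LIM_zero_iff)
  qed
  then show ?thesis
    by (simp add: continuous_on)
qed

lemma holder_circle_bounded:
  assumes "u \<in> holder_circle \<mu>" and "0 < \<mu>"
  obtains R where "R > 0" "\<forall>z\<in>unit_circle. norm (u z) \<le> R"
proof -
  have "compact (u ` unit_circle)"
    using holder_circle_continuous[OF assms] by (intro compact_continuous_image) auto
  then show thesis
    using that by (auto simp: bounded_pos dest!: compact_imp_bounded)
qed

text \<open>
  Post-composition with a function that is Lipschitz on the range; the exponential, the reciprocal
  and the logarithm below are instances.
\<close>

lemma holder_circle_dominated: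
  assumes "u \<in> holder_circle \<mu>" and "L \<ge> 0"
    and "\<And>z w. z \<in> unit_circle \<Longrightarrow> w \<in> unit_circle \<Longrightarrow> norm (v z - v w) \<le> L * norm (u z - u w)"
  shows "v \<in> holder_circle \<mu>"
proof -
  obtain C where C: "C \<ge> 0"
    "\<forall>z\<in>unit_circle. \<forall>w\<in>unit_circle. norm (u z - u w) \<le> C * norm (z - w) powr \<mu>"
    by (rule holder_circleE[OF assms(1)])
  show ?thesis
  proof (rule holder_circleI[where C = "L * C"])
    fix z w :: complex
    assume "z \<in> unit_circle" "w \<in> unit_circle"
    then have "norm (v z - v w) \<le> L * (C * norm (z - w) powr \<mu>)"
      using assms(2,3) C(2) by (meson mult_left_mono order_trans)
    then show "norm (v z - v w) \<le> L * C * norm (z - w) powr \<mu>"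
      by (simp only: mult.assoc)
  qed
qed

lemma holder_circle_const: "(\<lambda>_. c) \<in> holder_circle \<mu>"
  by (rule holder_circleI[where C = 0]) simp

lemma holder_circle_add:
  assumes "u \<in> holder_circle \<mu>" "v \<in> holder_circle \<mu>"
  shows "(\<lambda>z. u z + v z) \<in> holder_circle \<mu>"
proof -
  obtain C where C: "C \<ge> 0"
    "\<forall>z\<in>unit_circle. \<forall>w\<in>unit_circle. norm (u z - u w) \<le> C * norm (z - w) powr \<mu>"
    by (rule holder_circleE[OF assms(1)])
  obtain D where D: "D \<ge> 0"
    "\<forall>z\<in>unit_circle. \<forall>w\<in>unit_circle. norm (v z - v w) \<le> D * norm (z - w) powr \<mu>"
    by (rule holder_circleE[OF assms(2)])
  show ?thesis
  proof (rule holder_circleI[where C = "C + D"])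
    fix z w :: complex
    assume zw: "z \<in> unit_circle" "w \<in> unit_circle"
    have "norm ((u z + v z) - (u w + v w)) \<le> norm (u z - u w) + norm (v z - v w)"
      by (metis add_diff_add norm_triangle_ineq)
    also have "\<dots> \<le> C * norm (z - w) powr \<mu> + D * norm (z - w) powr \<mu>"
      using zw by (intro add_mono C(2)[rule_format] D(2)[rule_format])
    finally show "norm ((u z + v z) - (u w + v w)) \<le> (C + D) * norm (z - w) powr \<mu>"
      by (simp only: distrib_right)
  qed
qed

lemma holder_circle_mult:
  assumes "u \<in> holder_circle \<mu>" "v \<in> holder_circle \<mu>" and "0 < \<mu>"
  shows "(\<lambda>z. u z * v z) \<in> holder_circle \<mu>"
proof -
  obtain C where C: "C \<ge> 0"
    "\<forall>z\<in>unit_circle. \<forall>w\<in>unit_circle. norm (u z - u w) \<le> C * norm (z - w) powr \<mu>"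
    by (rule holder_circleE[OF assms(1)])
  obtain D where D: "D \<ge> 0"
    "\<forall>z\<in>unit_circle. \<forall>w\<in>unit_circle. norm (v z - v w) \<le> D * norm (z - w) powr \<mu>"
    by (rule holder_circleE[OF assms(2)])
  obtain R where R: "R > 0" "\<forall>z\<in>unit_circle. norm (u z) \<le> R"
    by (rule holder_circle_bounded[OF assms(1,3)])
  obtain Q where Q: "Q > 0" "\<forall>z\<in>unit_circle. norm (v z) \<le> Q"
    by (rule holder_circle_bounded[OF assms(2,3)])
  show ?thesis
  proof (rule holder_circleI[where C = "R * D + C * Q"])
    fix z w :: complex
    assume zw: "z \<in> unit_circle" "w \<in> unit_circle"
    have "u z * v z - u w * v w = u z * (v z - v w) + (u z - u w) * v w"
      by (simp add: algebra_simps)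
    then have "norm (u z * v z - u w * v w) \<le> norm (u z) * norm (v z - v w) + norm (u z - u w) * norm (v w)"
      by (metis norm_mult norm_triangle_ineq)
    also have "\<dots> \<le> R * (D * norm (z - w) powr \<mu>) + (C * norm (z - w) powr \<mu>) * Q"
      using zw C D R Q by (intro add_mono mult_mono) (auto intro: less_imp_le)
    also have "\<dots> = (R * D + C * Q) * norm (z - w) powr \<mu>"
      by (simp add: algebra_simps)
    finally show "norm (u z * v z - u w * v w) \<le> (R * D + C * Q) * norm (z - w) powr \<mu>" .
  qed
qed

lemma holder_circle_diff:
  assumes "u \<in> holder_circle \<mu>" "v \<in> holder_circle \<mu>"
  shows "(\<lambda>z. u z - v z) \<in> holder_circle \<mu>"
proof -
  have "(\<lambda>z. - v z) \<in> holder_circle \<mu>"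
    using assms(2) by (rule holder_circle_dominated[where L = 1]) (auto simp: norm_minus_commute)
  from holder_circle_add[OF assms(1) this] show ?thesis
    by simp
qed

lemma holder_circle_power:
  assumes "u \<in> holder_circle \<mu>" and "0 < \<mu>"
  shows "(\<lambda>z. u z ^ n) \<in> holder_circle \<mu>"
  by (induction n) (use assms in \<open>auto intro: holder_circle_const holder_circle_mult\<close>)

text \<open>
  The circle has diameter \<open>2\<close>, so that \<open>\<bar>z - w\<bar> \<le> 2 \<bar>z - w\<bar> powr \<mu>\<close>.
\<close>

lemma holder_circle_lipschitz:
  assumes "0 < \<mu>" "\<mu> < 1" and "L \<ge> 0"
    and "\<And>z w. z \<in> unit_circle \<Longrightarrow> w \<in> unit_circle \<Longrightarrow> norm (u z - u w) \<le> L * norm (z - w)"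
  shows "u \<in> holder_circle \<mu>"
proof (rule holder_circleI[where C = "L * 2"])
  fix z w :: complex
  assume zw: "z \<in> unit_circle" "w \<in> unit_circle"
  have "norm (z - w) \<le> 2"
    using zw norm_triangle_ineq4[of z w] by auto
  then have "norm (z - w) powr (1 - \<mu>) \<le> 2 powr (1 - \<mu>)"
    using assms(1,2) by (intro powr_mono2) auto
  also have "\<dots> \<le> 2 powr 1"
    using assms(1,2) by (intro powr_mono) auto
  finally have "norm (z - w) powr (1 - \<mu>) \<le> 2"
    by simp
  then have "norm (z - w) powr \<mu> * norm (z - w) powr (1 - \<mu>) \<le> norm (z - w) powr \<mu> * 2"
    by (intro mult_left_mono) auto
  then have "norm (z - w) \<le> norm (z - w) powr \<mu> * 2"
    by (simp flip: powr_add)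
  then have "L * norm (z - w) \<le> L * (norm (z - w) powr \<mu> * 2)"
    using \<open>L \<ge> 0\<close> by (intro mult_left_mono)
  then show "norm (u z - u w) \<le> L * 2 * norm (z - w) powr \<mu>"
    using assms(4)[OF zw] by (simp add: mult_ac)
qed

lemma holder_circle_id:
  assumes "0 < \<mu>" "\<mu> < 1"
  shows "(\<lambda>z. z) \<in> holder_circle \<mu>"
  by (rule holder_circle_lipschitz[OF assms, where L = 1]) auto

lemma inverse_unit_circle: "z \<in> unit_circle \<Longrightarrow> inverse z = cnj z"
  by (intro inverse_unique) (simp add: complex_norm_square[symmetric])

lemma holder_circle_reflect:
  assumes "u \<in> holder_circle \<mu>"
  shows "(\<lambda>z. u (inverse z)) \<in> holder_circle \<mu>"
proof -
  obtain C where C: "C \<ge> 0"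
    "\<forall>z\<in>unit_circle. \<forall>w\<in>unit_circle. norm (u z - u w) \<le> C * norm (z - w) powr \<mu>"
    by (rule holder_circleE[OF assms])
  show ?thesis
  proof (rule holder_circleI[where C = C])
    fix z w :: complex
    assume zw: "z \<in> unit_circle" "w \<in> unit_circle"
    have "norm (u (cnj z) - u (cnj w)) \<le> C * norm (cnj z - cnj w) powr \<mu>"
      using zw by (intro C(2)[rule_format]) auto
    then show "norm (u (inverse z) - u (inverse w)) \<le> C * norm (z - w) powr \<mu>"
      using zw by (simp add: inverse_unit_circle flip: complex_cnj_diff)
  qed
qed

lemma holder_circle_exp:
  assumes "u \<in> holder_circle \<mu>" and "0 < \<mu>"
  shows "(\<lambda>z. exp (u z)) \<in> holder_circle \<mu>"
proof -
  obtain R where R: "R > 0" "\<forall>z\<in>unit_circle. norm (u z) \<le> R"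
    by (rule holder_circle_bounded[OF assms])
  show ?thesis
  proof (rule holder_circle_dominated[OF assms(1), where L = "exp R"])
    fix z w :: complex
    assume "z \<in> unit_circle" "w \<in> unit_circle"
    then show "norm (exp (u z) - exp (u w)) \<le> exp R * norm (u z - u w)"
      using R by (intro field_differentiable_bound[where S = "cball 0 R" and f' = exp])
        (auto intro: DERIV_exp[THEN has_field_derivative_at_within] order_trans[OF complex_Re_le_cmod])
  qed simp
qed

lemma holder_circle_inverse:
  assumes "u \<in> holder_circle \<mu>" and "m > 0" and "\<And>z. z \<in> unit_circle \<Longrightarrow> norm (u z) \<ge> m"
  shows "(\<lambda>z. inverse (u z)) \<in> holder_circle \<mu>"
proof (rule holder_circle_dominated[OF assms(1), where L = "1 / m\<^sup>2"])
  fix z w :: complex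
  assume zw: "z \<in> unit_circle" "w \<in> unit_circle"
  then have nz: "u z \<noteq> 0" "u w \<noteq> 0"
    using assms(2,3) by force+
  have "m * m \<le> norm (u z) * norm (u w)"
    using assms(2) assms(3)[OF zw(1)] assms(3)[OF zw(2)] by (intro mult_mono) auto
  then have m: "m\<^sup>2 \<le> norm (u z * u w)"
    by (simp add: norm_mult power2_eq_square)
  have "inverse (u z) - inverse (u w) = (u w - u z) / (u z * u w)"
    using nz by (simp add: field_simps)
  then have "norm (inverse (u z) - inverse (u w)) = norm (u z - u w) / norm (u z * u w)"
    by (simp add: norm_divide norm_minus_commute)
  also have "\<dots> \<le> norm (u z - u w) / m\<^sup>2"
    using m \<open>m > 0\<close> by (intro divide_left_mono mult_pos_pos) (auto simp: nz)
  finally show "norm (inverse (u z) - inverse (u w)) \<le> 1 / m\<^sup>2 * norm (u z - u w)"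
    by simp
qed simp

text \<open>
  The disc of radius \<open>\<rho> < 1\<close> about \<open>1\<close> is convex and avoids the cut of the principal logarithm,
  whose derivative is at most \<open>1 / (1 - \<rho>)\<close> there.
\<close>

lemma holder_circle_Ln:
  assumes "u \<in> holder_circle \<mu>" and "\<rho> < 1" and "\<And>z. z \<in> unit_circle \<Longrightarrow> norm (u z - 1) \<le> \<rho>"
  shows "(\<lambda>z. Ln (u z)) \<in> holder_circle \<mu>"
proof (rule holder_circle_dominated[OF assms(1), where L = "1 / (1 - \<rho>)"])
  fix z w :: complex
  assume zw: "z \<in> unit_circle" "w \<in> unit_circle"
  have *: "x \<notin> \<real>\<^sub>\<le>\<^sub>0 \<and> 1 - \<rho> \<le> norm x" if "x \<in> cball 1 \<rho>" for x :: complex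
  proof -
    have "norm (1 - x) \<le> \<rho>"
      using that by (simp add: dist_norm)
    moreover have "1 - Re x \<le> norm (1 - x)"
      using complex_Re_le_cmod[of "1 - x"] by simp
    moreover have "1 - norm x \<le> norm (1 - x)"
      using norm_triangle_ineq2[of 1 x] by simp
    ultimately show ?thesis
      using \<open>\<rho> < 1\<close> by (auto simp: complex_nonpos_Reals_iff)
  qed
  show "norm (Ln (u z) - Ln (u w)) \<le> 1 / (1 - \<rho>) * norm (u z - u w)"
  proof (rule field_differentiable_bound[where S = "cball 1 \<rho>" and f' = inverse])
    fix x :: complex
    assume "x \<in> cball 1 \<rho>"
    note x = *[OF this]
    show "(Ln has_field_derivative inverse x) (at x within cball 1 \<rho>)"
      using x by (intro has_field_derivative_at_within[OF has_field_derivative_Ln]) auto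
    have "inverse (norm x) \<le> inverse (1 - \<rho>)"
      using x \<open>\<rho> < 1\<close> by (intro le_imp_inverse_le) auto
    then show "norm (inverse x) \<le> 1 / (1 - \<rho>)"
      by (simp add: norm_inverse divide_inverse)
  qed (use assms(3) zw in \<open>auto simp: dist_norm norm_minus_commute\<close>)
qed (use \<open>\<rho> < 1\<close> in simp)

section \<open>Cauchy integrals over the unit circle\<close>

lemma continuous_on_circle_param:
  assumes "continuous_on unit_circle F" "norm a = 1"
  shows "continuous_on X (\<lambda>\<theta>. F (a * cis \<theta>))"
  using assms(2) by (intro continuous_on_compose2[OF assms(1)]) (auto intro!: continuous_intros simp: norm_mult)

text \<open>
  The integrands below are large near one point \<open>a\<close> of the circle.  On the right-hand side that point
  is the midpoint of the interval of integration.
\<close>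

lemma circle_integral_rotate:
  fixes F :: "complex \<Rightarrow> complex"
  assumes F: "continuous_on unit_circle F" and a: "a \<in> unit_circle"
  shows "integral {0..2*pi} (\<lambda>\<theta>. F (cis \<theta>)) = integral {-pi..pi} (\<lambda>\<theta>. F (a * cis \<theta>))"
proof -
  define f where "f \<theta> = F (cis \<theta>)" for \<theta>
  have f_cont: "continuous_on X f" for X
    using continuous_on_circle_param[OF F, of 1] by (simp add: f_def)
  then have f_int: "f integrable_on {x..y}" for x y
    by (intro integrable_continuous_real)
  have periodic: "f (\<theta> + 2 * pi) = f \<theta>" for \<theta>
    by (simp add: f_def cis_mult[symmetric])
  have shift: "integral {x+c..y+c} g = integral {x..y} (\<lambda>\<theta>. g (\<theta> + c))"
    if "continuous_on {x+c..y+c} g" "x \<le> y" for x y c :: real and g :: "real \<Rightarrow> complex"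
  proof -
    have "(g has_integral integral {x+c..y+c} g) (cbox (x+c) (y+c))"
      using that by (simp add: integrable_continuous_real integrable_integral)
    from has_integral_affinity[OF this, of 1 c]
    have "((\<lambda>\<theta>. g (\<theta> + c)) has_integral integral {x+c..y+c} g) {x..y}"
      using that by (simp add: image_affinity_atLeastAtMost_diff)
    then show ?thesis
      by (rule integral_unique[symmetric])
  qed
  \<comment> \<open>The interval from \<open>\<alpha>\<close> to \<open>\<alpha> + 2 * pi\<close> has the
    argument of \<open>a\<close> at its midpoint.\<close>
  obtain \<alpha> where \<alpha>: "0 \<le> \<alpha>" "\<alpha> < 2 * pi" "- a = cis \<alpha>"
    using Arg2pi_ge_0[of "-a"] Arg2pi_lt_2pi[of "-a"] Arg2pi_eq[of "-a"] a
    by (auto simp: cis_conv_exp)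
  have "integral {0..2*pi} f = integral {0..\<alpha>} f + integral {\<alpha>..2*pi} f"
    using \<alpha> f_int by (intro Henstock_Kurzweil_Integration.integral_combine[symmetric]) auto
  also have "integral {0..\<alpha>} f = integral {0 + 2*pi..\<alpha> + 2*pi} f"
    using shift[OF f_cont, of 0 \<alpha> "2*pi"] \<alpha> periodic by simp
  also have "\<dots> + integral {\<alpha>..2*pi} f = integral {\<alpha>..\<alpha> + 2*pi} f"
    using \<alpha> f_int Henstock_Kurzweil_Integration.integral_combine[of \<alpha> "2*pi" "\<alpha> + 2*pi" f] by (simp add: add.commute)
  also have "\<dots> = integral {-pi..pi} (\<lambda>\<theta>. f (\<theta> + (\<alpha> + pi)))"
    using shift[OF f_cont, of "-pi" pi "\<alpha> + pi"] by (simp add: algebra_simps)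
  also have "(\<lambda>\<theta>. f (\<theta> + (\<alpha> + pi))) = (\<lambda>\<theta>. F (a * cis \<theta>))"
  proof
    fix \<theta>
    have "cis (\<theta> + (\<alpha> + pi)) = cis \<theta> * (cis \<alpha> * cis pi)"
      by (simp only: cis_mult)
    also have "\<dots> = a * cis \<theta>"
      by (simp add: \<alpha>(3)[symmetric])
    finally show "f (\<theta> + (\<alpha> + pi)) = F (a * cis \<theta>)"
      by (simp add: f_def)
  qed
  finally show ?thesis
    by (simp add: f_def)
qed

lemma circle_integral_cnj:
  fixes F :: "complex \<Rightarrow> complex"
  assumes F: "continuous_on unit_circle F"
  shows "integral {0..2*pi} (\<lambda>\<theta>. F (cnj (cis \<theta>))) = integral {0..2*pi} (\<lambda>\<theta>. F (cis \<theta>))"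
proof -
  have "continuous_on unit_circle (\<lambda>z. F (cnj z))"
    by (intro continuous_on_compose2[OF F]) (auto intro!: continuous_intros)
  then have "integral {0..2*pi} (\<lambda>\<theta>. F (cnj (cis \<theta>))) = integral {-pi..pi} (\<lambda>\<theta>. F (cnj (1 * cis \<theta>)))"
    by (rule circle_integral_rotate) simp
  also have "\<dots> = integral {-pi..pi} (\<lambda>\<theta>. F (cis (- \<theta>)))"
    by (simp add: cis_cnj)
  also have "\<dots> = integral {-pi..pi} (\<lambda>\<theta>. F (1 * cis \<theta>))"
    using Henstock_Kurzweil_Integration.integral_reflect_real[of pi "-pi" "\<lambda>\<theta>. F (cis \<theta>)"] by simp
  also have "\<dots> = integral {0..2*pi} (\<lambda>\<theta>. F (cis \<theta>))"
    by (rule circle_integral_rotate[OF F, symmetric]) simp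
  finally show ?thesis .
qed

text \<open>
  The chord has length \<open>2 \<bar>sin (\<theta> / 2)\<bar>\<close>, and the sine is concave on \<open>[0, pi]\<close>.
\<close>

lemma chord_lower_bound:
  assumes "\<bar>\<theta>\<bar> \<le> pi"
  shows "\<bar>\<theta>\<bar> \<le> 2 * norm (cis \<theta> - 1)"
proof -
  have sin_ge: "x \<le> 2 * sin x" if "0 \<le> x" "x \<le> pi / 2" for x :: real
  proof -
    have "convex_on {0..pi} (\<lambda>x. - sin x)"
      by (rule f''_ge0_imp_convex[where f' = "\<lambda>x. - cos x" and f'' = sin])
        (auto intro!: derivative_eq_intros sin_ge_zero)
    from convex_onD[OF this, of "x / (pi/2)" 0 "pi/2"] that
    have "- sin x \<le> - (x * 2 / pi)"
      by simp
    moreover have "x * pi \<le> x * 4"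
      using that pi_less_4 by (intro mult_left_mono) auto
    then have "x / 2 \<le> x * 2 / pi"
      by (simp add: field_simps)
    ultimately show ?thesis
      by simp
  qed
  have "\<bar>\<theta> / 2\<bar> \<le> 2 * sin \<bar>\<theta> / 2\<bar>"
    using assms by (intro sin_ge) auto
  also have "\<dots> \<le> 2 * \<bar>sin (\<theta> / 2)\<bar>"
    by (cases "\<theta> \<ge> 0") auto
  also have "\<dots> = norm (cis \<theta> - 1)"
    by (simp add: cis_conv_exp dist_exp_i_1)
  finally show ?thesis
    by simp
qed

lemma has_integral_shifted_powr:
  fixes \<delta> \<mu> a :: real
  assumes "\<delta> > 0" "0 < \<mu>" "\<mu> < 1" "a \<ge> 0"
  shows "((\<lambda>\<theta>. (\<delta> + \<bar>\<theta>\<bar>) powr (\<mu> - 2)) has_integral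
           2 * ((\<delta> powr (\<mu> - 1) - (\<delta> + a) powr (\<mu> - 1)) / (1 - \<mu>))) {-a..a}"
proof -
  let ?I = "(\<delta> powr (\<mu> - 1) - (\<delta> + a) powr (\<mu> - 1)) / (1 - \<mu>)"
  have "((\<lambda>\<theta>. (\<delta> + \<theta>) powr (\<mu> - 2)) has_integral
     ((\<delta> + a) powr (\<mu> - 1) / (\<mu> - 1) - (\<delta> + 0) powr (\<mu> - 1) / (\<mu> - 1))) {0..a}"
  proof (rule fundamental_theorem_of_calculus)
    fix x assume "x \<in> {0..a}"
    then have "((\<lambda>\<theta>. (\<delta> + \<theta>) powr (\<mu> - 1) / (\<mu> - 1)) has_real_derivative
        (\<mu> - 1) * (\<delta> + x) powr (\<mu> - 1 - 1) * 1 / (\<mu> - 1)) (at x within {0..a})"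
      using assms by (intro DERIV_cdivide DERIV_chain2[OF has_real_derivative_powr])
        (auto intro!: derivative_eq_intros)
    moreover have "(\<mu> - 1) * (\<delta> + x) powr (\<mu> - 1 - 1) * 1 / (\<mu> - 1) = (\<delta> + x) powr (\<mu> - 2)"
      using assms by simp
    ultimately show "((\<lambda>\<theta>. (\<delta> + \<theta>) powr (\<mu> - 1) / (\<mu> - 1)) has_vector_derivative
        (\<delta> + x) powr (\<mu> - 2)) (at x within {0..a})"
      by (simp add: has_real_derivative_iff_has_vector_derivative)
  qed (use assms in auto)
  also have "(\<delta> + a) powr (\<mu> - 1) / (\<mu> - 1) - (\<delta> + 0) powr (\<mu> - 1) / (\<mu> - 1) = ?I"
    by (metis add.right_neutral diff_divide_distrib minus_diff_eq minus_divide_divide)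
  finally have "((\<lambda>\<theta>. (\<delta> + \<theta>) powr (\<mu> - 2)) has_integral ?I) {0..a}" .
  then have pos: "((\<lambda>\<theta>. (\<delta> + \<bar>\<theta>\<bar>) powr (\<mu> - 2)) has_integral ?I) {0..a}"
    by (rule has_integral_eq[rotated]) auto
  then have "((\<lambda>\<theta>. (\<delta> + \<bar>-\<theta>\<bar>) powr (\<mu> - 2)) has_integral ?I) {-a..-0}"
    by (subst has_integral_reflect_real) simp
  then have "((\<lambda>\<theta>. (\<delta> + \<bar>\<theta>\<bar>) powr (\<mu> - 2)) has_integral ?I) {-a..0}"
    by simp
  from has_integral_combine[OF _ _ this pos] assms show ?thesis
    by simp
qed

text \<open>
  Put \<open>s = \<zeta> cis \<theta>\<close> and \<open>d = \<bar>s - r \<zeta>\<bar>\<close>.  Both \<open>1 - r\<close> and \<open>\<bar>\<theta>\<bar>\<close> are at most a constant times \<open>d\<close>,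
  and \<open>\<bar>s - \<zeta>\<bar> \<le> 2 d\<close>; so the bound for \<open>G\<close> is at most a constant times
  \<open>((1 - r) + \<bar>\<theta>\<bar>) powr (\<mu> - 2)\<close>, whose integral is of order \<open>(1 - r) powr (\<mu> - 1)\<close>.
  The estimate serves twice: for the derivative of a Cauchy integral, and for the approach of a
  Poisson integral to its boundary values.
\<close>

lemma singular_kernel_bound:
  fixes G :: "complex \<Rightarrow> complex" and \<mu> r M :: real
  assumes \<mu>: "0 < \<mu>" "\<mu> < 1" and G: "continuous_on unit_circle G"
    and \<zeta>: "\<zeta> \<in> unit_circle" and r: "0 \<le> r" "r < 1" and "0 \<le> M"
    and bound: "\<And>s. s \<in> unit_circle \<Longrightarrow>
      norm (G s) \<le> M * (norm (s - \<zeta>) powr \<mu> / (norm (s - of_real r * \<zeta>))\<^sup>2)"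
  shows "norm (integral {0..2*pi} (\<lambda>\<theta>. G (cis \<theta>))) \<le>
    M * (100 / (1 - \<mu>)) * (1 - r) powr (\<mu> - 1)"
proof -
  define B where "B \<theta> = M * 50 * ((1 - r) + \<bar>\<theta>\<bar>) powr (\<mu> - 2)" for \<theta>
  have int_B: "(B has_integral M * 50 * (2 * (((1 - r) powr (\<mu> - 1) - ((1 - r) + pi) powr (\<mu> - 1)) / (1 - \<mu>)))) {-pi..pi}"
    unfolding B_def using \<mu> r by (intro has_integral_mult_right has_integral_shifted_powr) auto
  have "norm (G (\<zeta> * cis \<theta>)) \<le> B \<theta>" if \<theta>: "\<theta> \<in> {-pi..pi}" for \<theta>
  proof -
    define d where "d = norm (cis \<theta> - of_real r)"
    have "1 - r \<le> d"
      using norm_triangle_ineq2[of "cis \<theta>" "of_real r"] r by (simp add: d_def)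
    then have "d > 0"
      using r by linarith
    have "norm (cis \<theta> - 1) \<le> norm (cis \<theta> - of_real r) + norm (of_real r - 1 :: complex)"
      using norm_triangle_ineq[of "cis \<theta> - of_real r" "of_real r - 1"] by simp
    also have "norm (of_real r - 1 :: complex) = 1 - r"
      using r by (metis abs_of_pos cmod_eq_Re diff_gt_0_iff_gt norm_minus_commute norm_of_real of_real_1 of_real_diff)
    finally have chord: "norm (cis \<theta> - 1) \<le> 2 * d"
      using \<open>1 - r \<le> d\<close> unfolding d_def by linarith
    have "\<bar>\<theta>\<bar> \<le> 4 * d"
      using chord_lower_bound[of \<theta>] \<theta> chord by (simp add: abs_le_iff)
    then have sum: "((1 - r) + \<bar>\<theta>\<bar>) / 5 \<le> d" and pos: "((1 - r) + \<bar>\<theta>\<bar>) / 5 > 0"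
      using \<open>1 - r \<le> d\<close> r by (simp_all add: add_pos_nonneg)
    have "norm (\<zeta> * cis \<theta> - \<zeta>) = norm (\<zeta> * (cis \<theta> - 1))"
      by (simp add: algebra_simps)
    then have n1: "norm (\<zeta> * cis \<theta> - \<zeta>) = norm (cis \<theta> - 1)"
      using \<zeta> by (simp add: norm_mult)
    have "norm (\<zeta> * cis \<theta> - of_real r * \<zeta>) = norm (\<zeta> * (cis \<theta> - of_real r))"
      by (simp add: algebra_simps)
    then have n2: "norm (\<zeta> * cis \<theta> - of_real r * \<zeta>) = d"
      using \<zeta> by (simp add: norm_mult d_def)
    have "norm (G (\<zeta> * cis \<theta>)) \<le> M * (norm (cis \<theta> - 1) powr \<mu> / d\<^sup>2)"
      using bound[of "\<zeta> * cis \<theta>"] \<zeta> by (simp only: n1 n2) (simp add: norm_mult)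
    also have "\<dots> \<le> M * ((2 * d) powr \<mu> / d\<^sup>2)"
      using chord \<open>d > 0\<close> \<mu> \<open>M \<ge> 0\<close> by (intro mult_left_mono divide_right_mono powr_mono2) auto
    also have "(2 * d) powr \<mu> / d\<^sup>2 = 2 powr \<mu> * d powr (\<mu> - 2)"
      using \<open>d > 0\<close> by (simp add: powr_mult powr_diff powr_numeral)
    also have "\<dots> \<le> 2 powr 1 * (((1 - r) + \<bar>\<theta>\<bar>) / 5) powr (\<mu> - 2)"
      using sum pos \<mu> by (intro mult_mono powr_mono powr_mono2') auto
    also have "(((1 - r) + \<bar>\<theta>\<bar>) / 5) powr (\<mu> - 2) = 5 powr (2 - \<mu>) * ((1 - r) + \<bar>\<theta>\<bar>) powr (\<mu> - 2)"
      using pos by (simp add: powr_divide powr_diff field_simps)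
    also have "2 powr 1 * (5 powr (2 - \<mu>) * ((1 - r) + \<bar>\<theta>\<bar>) powr (\<mu> - 2)) \<le>
        2 powr 1 * (5 powr 2 * ((1 - r) + \<bar>\<theta>\<bar>) powr (\<mu> - 2))"
      using \<mu> by (intro mult_left_mono mult_right_mono powr_mono) auto
    finally show ?thesis
      using \<open>M \<ge> 0\<close> by (simp add: B_def mult_left_mono)
  qed
  moreover have "(\<lambda>\<theta>. G (\<zeta> * cis \<theta>)) integrable_on {-pi..pi}"
    using \<zeta> by (intro integrable_continuous_real continuous_on_circle_param[OF G]) auto
  ultimately have "norm (integral {-pi..pi} (\<lambda>\<theta>. G (\<zeta> * cis \<theta>))) \<le> integral {-pi..pi} B"
    using int_B by (intro integral_norm_bound_integral) auto
  also have "\<dots> = M * 50 * (2 * (((1 - r) powr (\<mu> - 1) - ((1 - r) + pi) powr (\<mu> - 1)) / (1 - \<mu>)))"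
    using int_B by (rule integral_unique)
  also have "\<dots> \<le> M * 50 * (2 * ((1 - r) powr (\<mu> - 1) / (1 - \<mu>)))"
    using \<open>M \<ge> 0\<close> \<mu> by (intro mult_left_mono divide_right_mono) auto
  also have "\<dots> = M * (100 / (1 - \<mu>)) * (1 - r) powr (\<mu> - 1)"
    by simp
  finally show ?thesis
    by (simp only: circle_integral_rotate[OF G \<zeta>])
qed

definition circle_mean :: "(complex \<Rightarrow> complex) \<Rightarrow> complex" where
  "circle_mean u = integral {0..2*pi} (\<lambda>\<theta>. u (cis \<theta>)) / (2 * pi)"

text \<open>
  Since \<open>ds = \<i> s d\<theta>\<close> on the circle, this is the Cauchy integral of \<open>u s / s\<close>.  The additional factor
  \<open>1 / s\<close> makes constants have transform zero, which separates the mean value of \<open>u\<close> from the rest.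
\<close>

definition cauchy_transform :: "(complex \<Rightarrow> complex) \<Rightarrow> complex \<Rightarrow> complex" where
  "cauchy_transform u z = circle_mean (\<lambda>s. u s / (s - z))"

lemma cis_minus_nonzero: "norm z < 1 \<Longrightarrow> cis \<theta> - z \<noteq> 0"
  using norm_cis[of \<theta>] by auto

lemma cauchy_transform_deriv:
  assumes u: "continuous_on unit_circle u" and z: "norm z < 1"
  shows "(cauchy_transform u has_field_derivative circle_mean (\<lambda>s. u s / (s - z)\<^sup>2)) (at z)"
proof -
  have cont: "continuous_on X (\<lambda>\<theta>. u (cis \<theta>))" for X
    using continuous_on_circle_param[OF u, of 1] by simp
  have cont2: "continuous_on (X :: (complex \<times> real) set) (\<lambda>x. u (cis (snd x)))" for X
    by (intro continuous_on_compose2[OF cont[of UNIV]]) (auto intro!: continuous_intros)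
  have "((\<lambda>z. integral (cbox 0 (2*pi)) (\<lambda>\<theta>. u (cis \<theta>) / (cis \<theta> - z))) has_field_derivative
      integral (cbox 0 (2*pi)) (\<lambda>\<theta>. u (cis \<theta>) / (cis \<theta> - z)\<^sup>2)) (at z within ball 0 1)"
  proof (rule leibniz_rule_field_derivative)
    show "((\<lambda>x. u (cis t) / (cis t - x)) has_field_derivative u (cis t) / (cis t - x)\<^sup>2) (at x within ball 0 1)"
      if "x \<in> ball 0 1" for x t
      using that cis_minus_nonzero[of x t]
      by (auto intro!: derivative_eq_intros simp: power2_eq_square)
    show "(\<lambda>\<theta>. u (cis \<theta>) / (cis \<theta> - x)) integrable_on cbox 0 (2*pi)" if "x \<in> ball 0 1" for x
      using that cis_minus_nonzero[of x]
      by (intro integrable_continuous continuous_intros cont) auto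
    show "continuous_on (ball 0 1 \<times> cbox 0 (2*pi)) (\<lambda>(x, t). u (cis t) / (cis t - x)\<^sup>2)"
      using cis_minus_nonzero
      by (auto simp: split_beta intro!: continuous_intros cont2)
  qed (use z in auto)
  moreover have "at z within ball 0 1 = at z"
    using z by (intro at_within_open) auto
  ultimately have "((\<lambda>z. integral (cbox 0 (2*pi)) (\<lambda>\<theta>. u (cis \<theta>) / (cis \<theta> - z))) has_field_derivative
      integral (cbox 0 (2*pi)) (\<lambda>\<theta>. u (cis \<theta>) / (cis \<theta> - z)\<^sup>2)) (at z)"
    by (simp only:)
  from DERIV_cdivide[OF this, of "2*pi"] show ?thesis
    by (simp add: cauchy_transform_def[abs_def] circle_mean_def)
qed

text \<open>
  On the circle, \<open>1 / (s - z)\<close> is the complex conjugate of \<open>s / (1 - cnj z * s)\<close>.  The latter is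
  holomorphic on the closed disc and vanishes at \<open>0\<close>, so that its mean value is zero.
\<close>

lemma cauchy_transform_one:
  assumes "norm z < 1"
  shows "cauchy_transform (\<lambda>_. 1) z = 0"
proof -
  define F where "F v = v / (1 - cnj z * v)" for v
  have nz: "1 - cnj z * v \<noteq> 0" if "norm v \<le> 1" for v
  proof
    assume "1 - cnj z * v = 0"
    then have "norm (cnj z * v) = 1"
      by (metis eq_iff_diff_eq_0 norm_one)
    moreover have "norm z * norm v \<le> norm z * 1"
      using that by (intro mult_left_mono) auto
    ultimately show False
      using assms by (simp add: norm_mult)
  qed
  have "F holomorphic_on cball 0 1"
    unfolding F_def using nz by (intro holomorphic_intros) auto
  from Cauchy_integral_circlepath_simple[OF this, of 0]
  have "((\<lambda>u. F u / u) has_contour_integral 0) (circlepath 0 1)"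
    by (simp add: F_def)
  then have "((\<lambda>\<theta>. \<i> * F (cis \<theta>)) has_integral 0) {0..2*pi}"
    by (simp add: circlepath_def has_contour_integral_part_circlepath_iff mult_ac)
  from has_integral_mult_right[OF this, of "-\<i>"]
  have "((\<lambda>\<theta>. F (cis \<theta>)) has_integral 0) {0..2*pi}"
    by simp
  from has_integral_cnj[THEN iffD2, OF this]
  have *: "((\<lambda>\<theta>. cnj (F (cis \<theta>))) has_integral 0) {0..2*pi}"
    by (simp add: o_def)
  have "cnj (F (cis \<theta>)) = 1 / (cis \<theta> - z)" for \<theta>
  proof -
    have "(cis \<theta> - z) * cnj (cis \<theta>) = 1 - z * cnj (cis \<theta>)"
      by (simp add: algebra_simps cis_cnj cis_mult)
    moreover have "1 - z * cnj (cis \<theta>) \<noteq> 0"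
      using nz[of "cis \<theta>"] by (metis complex_cnj_cnj complex_cnj_diff complex_cnj_mult complex_cnj_one complex_cnj_zero norm_cis order_refl)
    ultimately show ?thesis
      using cis_minus_nonzero[OF assms, of \<theta>] by (simp add: F_def field_simps)
  qed
  then show ?thesis
    using integral_unique[OF *] by (simp add: cauchy_transform_def circle_mean_def)
qed

text \<open>
  As constants have transform zero, \<open>u\<close> may be replaced by \<open>u - u \<zeta>\<close> for the boundary point \<open>\<zeta>\<close>
  nearest to \<open>z\<close>.  This difference is small where the kernel is large.
\<close>

lemma cauchy_transform_deriv_bound:
  assumes "u \<in> holder_circle \<mu>" and \<mu>: "0 < \<mu>" "\<mu> < 1"
  obtains M where "M \<ge> 0"
    "\<forall>z. norm z < 1 \<longrightarrow> norm (circle_mean (\<lambda>s. u s / (s - z)\<^sup>2)) \<le> M * (1 - norm z) powr (\<mu> - 1)"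
proof -
  have u: "continuous_on unit_circle u"
    by (rule holder_circle_continuous) fact+
  obtain C where C: "C \<ge> 0"
    "\<forall>z\<in>unit_circle. \<forall>w\<in>unit_circle. norm (u z - u w) \<le> C * norm (z - w) powr \<mu>"
    by (rule holder_circleE[OF assms(1)])
  define K where "K = 100 / (1 - \<mu>)"
  have "K > 0"
    using \<mu> by (simp add: K_def)
  have "norm (circle_mean (\<lambda>s. u s / (s - z)\<^sup>2)) \<le> C * K / (2 * pi) * (1 - norm z) powr (\<mu> - 1)"
    if z: "norm z < 1" for z
  proof -
    obtain \<zeta> where \<zeta>: "\<zeta> \<in> unit_circle" "z = of_real (norm z) * \<zeta>"
    proof (cases "z = 0")
      case True
      then show ?thesis
        by (intro that[of 1]) auto
    next
      case False
      then show ?thesis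
        by (intro that[of "sgn z"]) (simp_all add: sgn_eq norm_divide)
    qed
    define G where "G s = (u s - u \<zeta>) / (s - z)\<^sup>2" for s
    have nz: "s - z \<noteq> 0" if "s \<in> unit_circle" for s
      using that z by auto
    have G: "continuous_on unit_circle G"
      unfolding G_def using nz by (intro continuous_intros u) auto
    have cont: "continuous_on {0..2*pi} (\<lambda>\<theta>. g (cis \<theta>))" if "continuous_on unit_circle g"
      for g :: "complex \<Rightarrow> complex"
      using continuous_on_circle_param[OF that, of 1] by simp
    have "(cauchy_transform (\<lambda>_. 1) has_field_derivative circle_mean (\<lambda>s. 1 / (s - z)\<^sup>2)) (at z)"
      by (rule cauchy_transform_deriv[OF _ z]) simp
    moreover have "(cauchy_transform (\<lambda>_. 1) has_field_derivative 0) (at z)"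
    proof (rule has_field_derivative_transform_within_open[where S = "ball 0 1"])
      show "((\<lambda>_. 0) has_field_derivative 0) (at z)"
        by simp
    qed (use z in \<open>auto simp: cauchy_transform_one\<close>)
    ultimately have "circle_mean (\<lambda>s. 1 / (s - z)\<^sup>2) = 0"
      by (rule DERIV_unique)
    then have zero: "integral {0..2*pi} (\<lambda>\<theta>. 1 / (cis \<theta> - z)\<^sup>2) = 0"
      by (simp add: circle_mean_def)
    have cont1: "continuous_on unit_circle (\<lambda>s. u s / (s - z)\<^sup>2)"
      using nz by (intro continuous_intros u) auto
    have cont2: "continuous_on unit_circle (\<lambda>s. 1 / (s - z)\<^sup>2)"
      using nz by (intro continuous_intros) auto
    have "integral {0..2*pi} (\<lambda>\<theta>. G (cis \<theta>)) =
        integral {0..2*pi} (\<lambda>\<theta>. u (cis \<theta>) / (cis \<theta> - z)\<^sup>2 - u \<zeta> * (1 / (cis \<theta> - z)\<^sup>2))"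
      by (simp add: G_def diff_divide_distrib)
    also have "\<dots> = integral {0..2*pi} (\<lambda>\<theta>. u (cis \<theta>) / (cis \<theta> - z)\<^sup>2) -
        integral {0..2*pi} (\<lambda>\<theta>. u \<zeta> * (1 / (cis \<theta> - z)\<^sup>2))"
      using cont[OF cont1] cont[OF cont2]
      by (intro Henstock_Kurzweil_Integration.integral_diff integrable_continuous_real continuous_on_mult_left)
    also have "integral {0..2*pi} (\<lambda>\<theta>. u \<zeta> * (1 / (cis \<theta> - z)\<^sup>2)) = 0"
      by (simp only: Henstock_Kurzweil_Integration.integral_mult_right zero mult_zero_right)
    finally have "circle_mean (\<lambda>s. u s / (s - z)\<^sup>2) = integral {0..2*pi} (\<lambda>\<theta>. G (cis \<theta>)) / (2 * pi)"
      by (simp add: circle_mean_def)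
    then have "norm (circle_mean (\<lambda>s. u s / (s - z)\<^sup>2)) = norm (integral {0..2*pi} (\<lambda>\<theta>. G (cis \<theta>))) / (2 * pi)"
      by (simp add: norm_divide norm_mult)
    also have "norm (G s) \<le> C * (norm (s - \<zeta>) powr \<mu> / (norm (s - of_real (norm z) * \<zeta>))\<^sup>2)" if "s \<in> unit_circle" for s
    proof -
      have "norm (G s) = norm (u s - u \<zeta>) / (norm (s - z))\<^sup>2"
        by (simp add: G_def norm_divide norm_power)
      also have "\<dots> \<le> C * norm (s - \<zeta>) powr \<mu> / (norm (s - z))\<^sup>2"
        using C(2) that \<zeta>(1) by (intro divide_right_mono) auto
      finally show ?thesis
        by (simp flip: \<zeta>(2))
    qed
    then have "norm (integral {0..2*pi} (\<lambda>\<theta>. G (cis \<theta>))) / (2 * pi) \<le> C * K * (1 - norm z) powr (\<mu> - 1) / (2 * pi)"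
      unfolding K_def using \<mu> G \<zeta>(1) z C(1)
      by (intro divide_right_mono singular_kernel_bound[where \<zeta> = \<zeta>]) auto
    finally show ?thesis
      by simp
  qed
  then show thesis
    using C(1) \<open>K > 0\<close> by (intro that[of "C * K / (2 * pi)"]) auto
qed

section \<open>Additive decomposition on the circle\<close>

text \<open>
  To compare the values at two points of distance \<open>d\<close>, contract both points by the factor \<open>1 - d\<close>.
  Along the radii the bound for the derivative has an integral of order \<open>d powr \<mu>\<close>, and on the
  segment between the contracted points the derivative is at most \<open>M * d powr (\<mu> - 1)\<close>.
\<close>

lemma hardy_littlewood:
  fixes F F' :: "complex \<Rightarrow> complex"
  assumes \<mu>: "0 < \<mu>" "\<mu> < 1" and "M \<ge> 0"
    and deriv: "\<And>z. norm z < 1 \<Longrightarrow> (F has_field_derivative F' z) (at z)"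
    and bound: "\<And>z. norm z < 1 \<Longrightarrow> norm (F' z) \<le> M * (1 - norm z) powr (\<mu> - 1)"
    and z: "norm z < 1" and w: "norm w < 1"
  shows "norm (F z - F w) \<le> M * (1 + 2 / \<mu>) * norm (z - w) powr \<mu>"
proof (cases "z = w")
  case False
  define d where "d = norm (z - w)"
  \<comment> \<open>For \<open>d \<ge> 1\<close> both points are contracted to the centre.\<close>
  define e where "e = min 1 d"
  have d: "d > 0" and e: "0 < e" "e \<le> 1" "e \<le> d"
    using False by (auto simp: d_def e_def)
  have radial: "norm (F x - F (of_real (1 - e) * x)) \<le> M * (e powr \<mu> / \<mu>)" if x: "norm x < 1" for x
  proof -
    define f where "f t = F (of_real t * x)" for t
    define \<phi> where "\<phi> t = - M * ((1 - t) powr \<mu> / \<mu>)" for t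
    have small: "norm (of_real t * x) < 1" if "0 \<le> t" "t \<le> 1" for t
    proof -
      have "t * norm x \<le> 1 * norm x"
        using that by (intro mult_right_mono) auto
      then show ?thesis
        using that x by (simp add: norm_mult)
    qed
    have f_deriv: "(f has_vector_derivative x * F' (of_real t * x)) (at t)" if "0 \<le> t" "t \<le> 1" for t
    proof -
      have "((\<lambda>t. of_real t * x) has_vector_derivative x) (at t)"
        by (auto intro!: derivative_eq_intros)
      from field_vector_diff_chain_at[OF this, of F "F' (of_real t * x)"] deriv[OF small[OF that]]
      show ?thesis
        by (simp add: f_def[abs_def] o_def)
    qed
    have "norm (f 1 - f (1 - e)) \<le> \<phi> 1 - \<phi> (1 - e)"
    proof (rule differentiable_bound_general)
      show "continuous_on {1 - e..1} f"
        using e by (auto intro!: continuous_at_imp_continuous_on has_vector_derivative_continuous[OF f_deriv])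
      show "continuous_on {1 - e..1} \<phi>"
        unfolding \<phi>_def using \<mu> by (intro continuous_intros continuous_on_powr') auto
      fix t assume t: "1 - e < t" "t < 1"
      show "(f has_vector_derivative x * F' (of_real t * x)) (at t)"
        using t e by (intro f_deriv) auto
      have "((\<lambda>t. (1 - t) powr \<mu>) has_real_derivative \<mu> * (1 - t) powr (\<mu> - 1) * (-1)) (at t)"
        using t by (intro DERIV_chain2[OF has_real_derivative_powr]) (auto intro!: derivative_eq_intros)
      from DERIV_cmult[OF DERIV_cdivide[OF this, of \<mu>], of "- M"]
      have "(\<phi> has_real_derivative M * (1 - t) powr (\<mu> - 1)) (at t)"
        using \<mu> by (simp add: \<phi>_def[abs_def])
      then show "(\<phi> has_vector_derivative M * (1 - t) powr (\<mu> - 1)) (at t)"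
        by (simp add: has_real_derivative_iff_has_vector_derivative)
      have "norm (F' (of_real t * x)) \<le> M * (1 - norm (of_real t * x)) powr (\<mu> - 1)"
        using t e by (intro bound small) auto
      also have "\<dots> \<le> M * (1 - t) powr (\<mu> - 1)"
      proof -
        have "t * norm x \<le> t * 1"
          using t e x by (intro mult_left_mono) auto
        then have "1 - t \<le> 1 - norm (of_real t * x)"
          using t e by (simp add: norm_mult)
        then show ?thesis
          using t \<mu> \<open>M \<ge> 0\<close> by (intro mult_left_mono powr_mono2') auto
      qed
      finally have "norm (F' (of_real t * x)) \<le> M * (1 - t) powr (\<mu> - 1)" .
      moreover have "norm x * norm (F' (of_real t * x)) \<le> 1 * norm (F' (of_real t * x))"
        using x by (intro mult_right_mono) auto
      ultimately show "norm (x * F' (of_real t * x)) \<le> M * (1 - t) powr (\<mu> - 1)"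
        by (simp add: norm_mult)
    qed (use e in auto)
    then show ?thesis
      using \<mu> by (simp add: f_def \<phi>_def)
  qed
  have inner: "norm (F (of_real (1 - e) * z) - F (of_real (1 - e) * w)) \<le> M * d powr \<mu>"
  proof (cases "e = 1")
    case True
    then show ?thesis
      using \<open>M \<ge> 0\<close> by simp
  next
    case False
    then have ed: "e = d" "d < 1"
      by (auto simp: e_def min_def split: if_splits)
    have in_ball: "of_real (1 - d) * x \<in> cball 0 (1 - d)" if "norm x < 1" for x :: complex
    proof -
      have "norm (of_real (1 - d) * x) = (1 - d) * norm x"
        using ed by (simp add: norm_mult del: of_real_diff)
      also have "\<dots> \<le> (1 - d) * 1"
        using ed that by (intro mult_left_mono) auto
      finally show ?thesis
        by simp
    qed
    have "norm (F (of_real (1 - d) * z) - F (of_real (1 - d) * w)) \<le>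
        M * d powr (\<mu> - 1) * norm (of_real (1 - d) * z - of_real (1 - d) * w)"
    proof (rule field_differentiable_bound[where S = "cball 0 (1 - d)" and f' = F'])
      fix x :: complex
      assume "x \<in> cball 0 (1 - d)"
      then have x: "norm x \<le> 1 - d"
        by simp
      then show "(F has_field_derivative F' x) (at x within cball 0 (1 - d))"
        using d by (intro has_field_derivative_at_within[OF deriv]) auto
      have "norm (F' x) \<le> M * (1 - norm x) powr (\<mu> - 1)"
        using x d by (intro bound) auto
      also have "\<dots> \<le> M * d powr (\<mu> - 1)"
        using x d \<mu> \<open>M \<ge> 0\<close> by (intro mult_left_mono powr_mono2') auto
      finally show "norm (F' x) \<le> M * d powr (\<mu> - 1)" .
    qed (use in_ball z w in auto)
    also have "norm (of_real (1 - d) * z - of_real (1 - d) * w) = (1 - d) * d"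
      using ed by (simp add: norm_mult d_def flip: right_diff_distrib del: of_real_diff)
    also have "M * d powr (\<mu> - 1) * ((1 - d) * d) \<le> M * d powr (\<mu> - 1) * (1 * d)"
      using d \<open>M \<ge> 0\<close> by (intro mult_left_mono mult_right_mono) auto
    also have "\<dots> = M * d powr \<mu>"
      using d by (simp add: powr_diff)
    finally show ?thesis
      by (simp add: ed)
  qed
  have "F z - F w = (F z - F (of_real (1 - e) * z)) +
      (F (of_real (1 - e) * z) - F (of_real (1 - e) * w)) + - (F w - F (of_real (1 - e) * w))"
    by simp
  then have "norm (F z - F w) \<le> norm (F z - F (of_real (1 - e) * z)) +
      norm (F (of_real (1 - e) * z) - F (of_real (1 - e) * w)) + norm (F w - F (of_real (1 - e) * w))"
    by (metis (no_types, lifting) norm_minus_cancel norm_triangle_le norm_triangle_ineq add_right_mono)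
  also have "\<dots> \<le> M * (e powr \<mu> / \<mu>) + M * d powr \<mu> + M * (e powr \<mu> / \<mu>)"
    by (intro add_mono radial inner z w)
  also have "\<dots> \<le> M * (d powr \<mu> / \<mu>) + M * d powr \<mu> + M * (d powr \<mu> / \<mu>)"
    using e \<mu> \<open>M \<ge> 0\<close> by (intro add_mono order.refl mult_left_mono divide_right_mono powr_mono2) auto
  also have "\<dots> = M * (1 + 2 / \<mu>) * d powr \<mu>"
    using \<mu> by (simp add: field_simps)
  finally show ?thesis
    by (simp add: d_def)
qed simp

text \<open>
  The Hoelder condition concerns the boundary values alone, as it does in the algebras on the contour.
\<close>

definition disc_algebra :: "real \<Rightarrow> (complex \<Rightarrow> complex) set" where
  "disc_algebra \<mu> =
     {A. A holomorphic_on ball 0 1 \<and> continuous_on (cball 0 1) A \<and> A \<in> holder_circle \<mu>}"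

lemma disc_algebra_add:
  assumes "A \<in> disc_algebra \<mu>" "B \<in> disc_algebra \<mu>"
  shows "(\<lambda>z. A z + B z) \<in> disc_algebra \<mu>"
  using assms unfolding disc_algebra_def
  by (auto intro!: holomorphic_intros continuous_intros holder_circle_add)

lemma disc_algebra_const: "(\<lambda>_. c) \<in> disc_algebra \<mu>"
  unfolding disc_algebra_def by (auto intro: holder_circle_const)

lemma disc_algebra_mult_z:
  assumes "A \<in> disc_algebra \<mu>" "0 < \<mu>" "\<mu> < 1"
  shows "(\<lambda>z. z * A z) \<in> disc_algebra \<mu>"
  using assms unfolding disc_algebra_def
  by (auto intro!: holomorphic_intros continuous_intros holder_circle_mult holder_circle_id)

lemma disc_algebra_uminus:
  assumes "A \<in> disc_algebra \<mu>"
  shows "(\<lambda>z. - A z) \<in> disc_algebra \<mu>"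
  using assms unfolding disc_algebra_def
  using holder_circle_diff[OF holder_circle_const[of 0], of A \<mu>]
  by (auto intro!: holomorphic_intros continuous_intros)

text \<open>
  The bound for the derivative of the transform makes it Hoelder continuous in the open disc.  Hence
  it extends continuously to the closed disc, and the Hoelder bound passes to the limit.
\<close>

lemma privalov:
  assumes "u \<in> holder_circle \<mu>" and \<mu>: "0 < \<mu>" "\<mu> < 1"
  obtains A where "A \<in> disc_algebra \<mu>" "\<forall>z. norm z < 1 \<longrightarrow> A z = cauchy_transform u z"
proof -
  let ?F = "cauchy_transform u"
  have u: "continuous_on unit_circle u"
    by (rule holder_circle_continuous) fact+
  obtain M where M: "M \<ge> 0"
    "\<forall>z. norm z < 1 \<longrightarrow> norm (circle_mean (\<lambda>s. u s / (s - z)\<^sup>2)) \<le> M * (1 - norm z) powr (\<mu> - 1)"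
    by (rule cauchy_transform_deriv_bound[OF assms])
  define C where "C = M * (1 + 2 / \<mu>)"
  have "C \<ge> 0"
    using M \<mu> by (simp add: C_def)
  have F: "norm (?F z - ?F w) \<le> C * norm (z - w) powr \<mu>" if "norm z < 1" "norm w < 1" for z w
    unfolding C_def using cauchy_transform_deriv[OF u] M that by (intro hardy_littlewood[OF \<mu>]) auto
  have "uniformly_continuous_on (ball 0 1) ?F"
    unfolding uniformly_continuous_on_def
  proof (intro allI impI)
    fix \<epsilon> :: real
    assume "\<epsilon> > 0"
    define \<delta> where "\<delta> = (\<epsilon> / (C + 1)) powr (1 / \<mu>)"
    have "\<delta> > 0"
      using \<open>\<epsilon> > 0\<close> \<open>C \<ge> 0\<close> by (simp add: \<delta>_def)
    have "dist (?F z) (?F w) < \<epsilon>" if "z \<in> ball 0 1" "w \<in> ball 0 1" "dist z w < \<delta>" for z w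
    proof -
      have "norm (?F z - ?F w) \<le> C * norm (z - w) powr \<mu>"
        using that by (intro F) auto
      also have "\<dots> \<le> C * \<delta> powr \<mu>"
        using that \<mu> \<open>C \<ge> 0\<close> by (intro mult_left_mono powr_mono2) (auto simp: dist_norm)
      also have "\<delta> powr \<mu> = \<epsilon> / (C + 1)"
        using \<mu> \<open>\<epsilon> > 0\<close> \<open>C \<ge> 0\<close> by (simp add: \<delta>_def powr_powr)
      also have "C * (\<epsilon> / (C + 1)) < \<epsilon>"
        using \<open>\<epsilon> > 0\<close> \<open>C \<ge> 0\<close> by (simp add: field_simps)
      finally show ?thesis
        by (simp add: dist_norm)
    qed
    then show "\<exists>\<delta>>0. \<forall>x\<in>ball 0 1. \<forall>x'\<in>ball 0 1. dist x' x < \<delta> \<longrightarrow> dist (?F x') (?F x) < \<epsilon>"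
      using \<open>\<delta> > 0\<close> by blast
  qed
  then obtain A where A: "uniformly_continuous_on (closure (ball 0 1)) A" "\<And>x. x \<in> ball 0 1 \<Longrightarrow> ?F x = A x"
    by (rule uniformly_continuous_on_extension_on_closure) blast
  have A_cont: "continuous_on (cball 0 1) A"
    using uniformly_continuous_imp_continuous[OF A(1)] by simp
  have "?F holomorphic_on ball 0 1"
    unfolding holomorphic_on_def field_differentiable_def
    by (intro ballI exI, rule has_field_derivative_at_within, rule cauchy_transform_deriv[OF u]) simp
  then have A_holo: "A holomorphic_on ball 0 1"
    by (rule holomorphic_transform) (rule A(2))
  have "norm (A z - A w) \<le> C * norm (z - w) powr \<mu>" if zw: "z \<in> unit_circle" "w \<in> unit_circle" for z w
  proof (rule Lim_norm_ubound[where net = "at_left (1::real)"])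
    have lim: "((\<lambda>r. A (of_real r * x)) \<longlongrightarrow> A x) (at_left 1)" if "x \<in> unit_circle" for x
    proof (rule continuous_on_tendsto_compose[OF A_cont])
      have "((\<lambda>r. of_real r * x) \<longlongrightarrow> of_real 1 * x) (at_left (1::real))"
        by (intro tendsto_intros)
      then show "((\<lambda>r. of_real r * x) \<longlongrightarrow> x) (at_left (1::real))"
        by simp
      show "\<forall>\<^sub>F r in at_left 1. of_real r * x \<in> cball 0 1"
        using eventually_at_left_real[of 0 "1::real"] that
        by (auto elim!: eventually_mono simp: norm_mult)
    qed (use that in auto)
    show "((\<lambda>r. A (of_real r * z) - A (of_real r * w)) \<longlongrightarrow> A z - A w) (at_left 1)"
      by (intro tendsto_diff lim zw)
    show "\<forall>\<^sub>F r in at_left 1. norm (A (of_real r * z) - A (of_real r * w)) \<le> C * norm (z - w) powr \<mu>"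
    proof (rule eventually_mono[OF eventually_at_left_real[of 0 "1::real"]])
      fix r :: real
      assume r: "r \<in> {0<..<1}"
      have "norm (A (of_real r * z) - A (of_real r * w)) \<le> C * norm (of_real r * z - of_real r * w) powr \<mu>"
        using r zw by (subst (1 2) A(2)[symmetric]) (auto intro!: F simp: norm_mult)
      also have "norm (of_real r * z - of_real r * w) = r * norm (z - w)"
        using r by (simp add: norm_mult flip: right_diff_distrib)
      also have "C * (r * norm (z - w)) powr \<mu> \<le> C * (1 * norm (z - w)) powr \<mu>"
        using r \<mu> \<open>C \<ge> 0\<close> by (intro mult_left_mono powr_mono2 mult_right_mono) auto
      finally show "norm (A (of_real r * z) - A (of_real r * w)) \<le> C * norm (z - w) powr \<mu>"
        by simp
    qed simp
  qed simp
  then have "A \<in> holder_circle \<mu>"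
    by (rule holder_circleI)
  then show thesis
    using A_cont A_holo A(2) by (intro that[of A]) (auto simp: disc_algebra_def)
qed

text \<open>
  Here \<open>A\<close> is the transform of \<open>u\<close> and \<open>B\<close> that of \<open>u (1 / z)\<close>.  For \<open>\<bar>z\<bar> < 1\<close> the function
  \<open>circle_mean u + z * A z + cnj z * B (cnj z)\<close> is the Poisson integral of \<open>u\<close>, because the three
  kernels add up to \<open>(1 - \<bar>z\<bar>\<^sup>2) / \<bar>s - z\<bar>\<^sup>2\<close>; its radial limits are the values of \<open>u\<close>.
\<close>

lemma additive_decomposition_circle:
  assumes "u \<in> holder_circle \<mu>" and \<mu>: "0 < \<mu>" "\<mu> < 1"
  obtains A B where "A \<in> disc_algebra \<mu>" "B \<in> disc_algebra \<mu>"
    "\<forall>z\<in>unit_circle. u z = circle_mean u + z * A z + inverse z * B (inverse z)"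
proof -
  have u: "continuous_on unit_circle u"
    by (rule holder_circle_continuous) fact+
  define v where "v z = u (inverse z)" for z
  have v: "v \<in> holder_circle \<mu>"
    unfolding v_def by (rule holder_circle_reflect) fact
  obtain A where A: "A \<in> disc_algebra \<mu>" "\<forall>z. norm z < 1 \<longrightarrow> A z = cauchy_transform u z"
    by (rule privalov[OF assms])
  obtain B where B: "B \<in> disc_algebra \<mu>" "\<forall>z. norm z < 1 \<longrightarrow> B z = cauchy_transform v z"
    by (rule privalov[OF v \<mu>])
  obtain C where C: "C \<ge> 0"
    "\<forall>z\<in>unit_circle. \<forall>w\<in>unit_circle. norm (u z - u w) \<le> C * norm (z - w) powr \<mu>"
    by (rule holder_circleE[OF assms(1)])
  define K where "K = 100 / (1 - \<mu>)"
  have intble: "(\<lambda>\<theta>. g (cis \<theta>)) integrable_on {0..2*pi}" if "continuous_on unit_circle g"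
    for g :: "complex \<Rightarrow> complex"
    using continuous_on_circle_param[OF that, of 1] by (simp add: integrable_continuous_real)
  have mean_add: "circle_mean (\<lambda>s. g s + h s) = circle_mean g + circle_mean h"
    if "continuous_on unit_circle g" "continuous_on unit_circle h" for g h :: "complex \<Rightarrow> complex"
    using that by (simp add: circle_mean_def Henstock_Kurzweil_Integration.integral_add intble add_divide_distrib)
  have mean_mult: "circle_mean (\<lambda>s. c * g s) = c * circle_mean g" for c and g :: "complex \<Rightarrow> complex"
    by (simp add: circle_mean_def)
  have mean_cnj: "circle_mean (\<lambda>s. g (cnj s)) = circle_mean g" if "continuous_on unit_circle g"
    for g :: "complex \<Rightarrow> complex"
    using circle_integral_cnj[OF that] by (simp add: circle_mean_def)
  define S where "S z = circle_mean u + z * A z + cnj z * B (cnj z)" for z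
  have poisson: "S z - c = circle_mean (\<lambda>s. (u s - c) * (1 + z / (s - z) + cnj z / (cnj s - cnj z)))"
    if z: "norm z < 1" for z c
  proof -
    have nz: "s - z \<noteq> 0" "cnj s - cnj z \<noteq> 0" "s - cnj z \<noteq> 0" if "s \<in> unit_circle" for s
      using that z by (auto simp flip: complex_cnj_diff)
    have cnj_transform: "cauchy_transform (\<lambda>s. f (cnj s)) (cnj z) = circle_mean (\<lambda>s. f s / (cnj s - cnj z))"
      if "continuous_on unit_circle f" for f
    proof -
      have "continuous_on unit_circle (\<lambda>s. f s / (cnj s - cnj z))"
        using nz by (intro continuous_intros that) auto
      from mean_cnj[OF this] show ?thesis
        by (simp add: cauchy_transform_def)
    qed
    have expand: "circle_mean (\<lambda>s. f s * (1 + z / (s - z) + cnj z / (cnj s - cnj z))) =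
        circle_mean f + z * cauchy_transform f z + cnj z * cauchy_transform (\<lambda>s. f (cnj s)) (cnj z)"
      if f: "continuous_on unit_circle f" for f
    proof -
      have "(\<lambda>s. f s * (1 + z / (s - z) + cnj z / (cnj s - cnj z))) =
          (\<lambda>s. (f s + z * (f s / (s - z))) + cnj z * (f s / (cnj s - cnj z)))"
        by (simp add: algebra_simps)
      moreover have "continuous_on unit_circle (\<lambda>s. f s + z * (f s / (s - z)))"
        "continuous_on unit_circle (\<lambda>s. z * (f s / (s - z)))"
        "continuous_on unit_circle (\<lambda>s. cnj z * (f s / (cnj s - cnj z)))"
        using nz by (intro continuous_intros f; auto)+
      ultimately show ?thesis
        by (simp add: mean_add mean_mult f cnj_transform[OF f] cauchy_transform_def[of f z]
            del: times_divide_eq_right)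
    qed
    have split: "(x - c) * P = x * P + (-c) * (1 * P)" for x P
      by (simp add: left_diff_distrib)
    have "circle_mean (\<lambda>s. (u s - c) * (1 + z / (s - z) + cnj z / (cnj s - cnj z))) =
        circle_mean (\<lambda>s. u s * (1 + z / (s - z) + cnj z / (cnj s - cnj z)) +
           (-c) * (1 * (1 + z / (s - z) + cnj z / (cnj s - cnj z))))"
      by (simp only: split)
    also have "\<dots> = circle_mean (\<lambda>s. u s * (1 + z / (s - z) + cnj z / (cnj s - cnj z))) +
        (-c) * circle_mean (\<lambda>s. 1 * (1 + z / (s - z) + cnj z / (cnj s - cnj z)))"
    proof -
      have "continuous_on unit_circle (\<lambda>s. u s * (1 + z / (s - z) + cnj z / (cnj s - cnj z)))"
        "continuous_on unit_circle (\<lambda>s. (-c) * (1 * (1 + z / (s - z) + cnj z / (cnj s - cnj z))))"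
        using nz by (intro continuous_intros u; auto)+
      then show ?thesis
        by (simp only: mean_add mean_mult)
    qed
    also have "circle_mean (\<lambda>s. 1 * (1 + z / (s - z) + cnj z / (cnj s - cnj z))) = 1"
      using z by (subst expand) (auto simp: cauchy_transform_one circle_mean_def scaleR_conv_of_real)
    also have "circle_mean (\<lambda>s. u s * (1 + z / (s - z) + cnj z / (cnj s - cnj z))) =
        circle_mean u + z * cauchy_transform u z + cnj z * cauchy_transform (\<lambda>s. u (cnj s)) (cnj z)"
      by (rule expand[OF u])
    also have "cauchy_transform (\<lambda>s. u (cnj s)) (cnj z) = cauchy_transform v (cnj z)"
      by (simp add: cauchy_transform_def circle_mean_def v_def cis_cnj cis_inverse)
    finally show ?thesis
      using A(2) B(2) z by (simp add: S_def)
  qed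
  have "S \<zeta> = u \<zeta>" if \<zeta>: "\<zeta> \<in> unit_circle" for \<zeta>
  proof -
    have est: "norm (S (of_real r * \<zeta>) - u \<zeta>) \<le> 2 * C * K / (2 * pi) * (1 - r) powr \<mu>"
      if r: "0 < r" "r < 1" for r :: real
    proof -
      define z where "z = of_real r * \<zeta>"
      have z: "norm z = r"
        using \<zeta> r by (simp add: z_def norm_mult)
      define G where "G s = (u s - u \<zeta>) * (1 + z / (s - z) + cnj z / (cnj s - cnj z))" for s
      have nz: "s - z \<noteq> 0" "cnj s - cnj z \<noteq> 0" if "s \<in> unit_circle" for s
        using that z r by (auto simp flip: complex_cnj_diff)
      have G: "continuous_on unit_circle G"
        unfolding G_def using nz by (intro continuous_intros u) auto
      have kernel: "norm (1 + z / (s - z) + cnj z / (cnj s - cnj z)) \<le> 2 * (1 - r) / (norm (s - z))\<^sup>2"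
        if s: "s \<in> unit_circle" for s
      proof -
        have "s * cnj s = 1" "z * cnj z = of_real (r\<^sup>2)"
          using s z by (simp_all add: complex_norm_square[symmetric])
        then have "1 + z / (s - z) + cnj z / (cnj s - cnj z) = (1 - of_real (r\<^sup>2)) / ((s - z) * (cnj s - cnj z))"
          using nz[OF s] by (simp add: divide_simps) (simp add: algebra_simps)
        then have "norm (1 + z / (s - z) + cnj z / (cnj s - cnj z)) =
            norm (1 - of_real (r\<^sup>2) :: complex) / (norm (s - z) * norm (cnj (s - z)))"
          by (simp add: norm_divide norm_mult)
        also have "norm (1 - of_real (r\<^sup>2) :: complex) = 1 - r\<^sup>2"
        proof -
          have "r\<^sup>2 \<le> 1"
            using r by (simp add: power_le_one)
          then show ?thesis
            by (metis abs_of_nonneg diff_ge_0_iff_ge norm_of_real of_real_1 of_real_diff)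
        qed
        also have "norm (s - z) * norm (cnj (s - z)) = (norm (s - z))\<^sup>2"
          by (simp only: complex_mod_cnj power2_eq_square)
        also have "1 - r\<^sup>2 = (1 - r) * (1 + r)"
          by (simp add: power2_eq_square algebra_simps)
        also have "\<dots> / (norm (s - z))\<^sup>2 \<le> (1 - r) * 2 / (norm (s - z))\<^sup>2"
          using r by (intro divide_right_mono mult_left_mono) auto
        finally show ?thesis
          by (simp add: mult.commute)
      qed
      have "norm (G s) \<le> 2 * C * (1 - r) * (norm (s - \<zeta>) powr \<mu> / (norm (s - of_real r * \<zeta>))\<^sup>2)"
        if s: "s \<in> unit_circle" for s
      proof -
        have "norm (G s) \<le> (C * norm (s - \<zeta>) powr \<mu>) * (2 * (1 - r) / (norm (s - z))\<^sup>2)"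
          unfolding G_def norm_mult
          using C s \<zeta> by (intro mult_mono kernel[OF s]) auto
        then show ?thesis
          by (simp add: z_def mult_ac)
      qed
      then have "norm (integral {0..2*pi} (\<lambda>\<theta>. G (cis \<theta>))) \<le> 2 * C * (1 - r) * K * (1 - r) powr (\<mu> - 1)"
        unfolding K_def using \<mu> G \<zeta> r C(1) by (intro singular_kernel_bound[where \<zeta> = \<zeta>]) auto
      also have "\<dots> = 2 * C * K * (1 - r) powr \<mu>"
        using r by (simp add: powr_diff)
      finally have "norm (integral {0..2*pi} (\<lambda>\<theta>. G (cis \<theta>))) / (2 * pi) \<le> 2 * C * K * (1 - r) powr \<mu> / (2 * pi)"
        by (intro divide_right_mono) auto
      moreover have "S z - u \<zeta> = circle_mean G"
        unfolding G_def using z r by (intro poisson) simp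
      then have "norm (S z - u \<zeta>) = norm (integral {0..2*pi} (\<lambda>\<theta>. G (cis \<theta>))) / (2 * pi)"
        by (simp add: circle_mean_def norm_divide norm_mult)
      ultimately show ?thesis
        by (simp add: z_def)
    qed
    have "((\<lambda>r. S (of_real r * \<zeta>) - u \<zeta>) \<longlongrightarrow> 0) (at_left (1::real))"
    proof (rule Lim_null_comparison[where g = "\<lambda>r. 2 * C * K / (2 * pi) * (1 - r) powr \<mu>"])
      show "\<forall>\<^sub>F r in at_left 1. norm (S (of_real r * \<zeta>) - u \<zeta>) \<le> 2 * C * K / (2 * pi) * (1 - r) powr \<mu>"
        using eventually_at_left_real[of 0 "1::real", OF zero_less_one]
        by (rule eventually_mono) (rule est, simp_all)
      have "((\<lambda>r. 1 - r) \<longlongrightarrow> 1 - 1) (at_left (1::real))"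
        by (intro tendsto_intros)
      then have "((\<lambda>r. (1 - r) powr \<mu>) \<longlongrightarrow> 0) (at_left (1::real))"
        using \<mu> by (intro tendsto_zero_powrI[OF _ tendsto_const]) (auto simp: eventually_at_filter)
      from tendsto_mult_left[OF this, of "2 * C * K / (2 * pi)"]
      show "((\<lambda>r. 2 * C * K / (2 * pi) * (1 - r) powr \<mu>) \<longlongrightarrow> 0) (at_left (1::real))"
        by simp
    qed
    then have lim1: "((\<lambda>r. S (of_real r * \<zeta>)) \<longlongrightarrow> u \<zeta>) (at_left (1::real))"
      by (simp add: LIM_zero_iff)
    have S_cont: "continuous_on (cball 0 1) S"
      unfolding S_def using A(1) B(1)
      by (auto simp: disc_algebra_def intro!: continuous_intros intro: continuous_on_compose2)
    have "((\<lambda>r. S (of_real r * \<zeta>)) \<longlongrightarrow> S \<zeta>) (at_left 1)"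
    proof (rule continuous_on_tendsto_compose[OF S_cont])
      have "((\<lambda>r. of_real r * \<zeta>) \<longlongrightarrow> of_real 1 * \<zeta>) (at_left (1::real))"
        by (intro tendsto_intros)
      then show "((\<lambda>r. of_real r * \<zeta>) \<longlongrightarrow> \<zeta>) (at_left (1::real))"
        by simp
      show "\<forall>\<^sub>F r in at_left 1. of_real r * \<zeta> \<in> cball 0 1"
        by (rule eventually_mono[OF eventually_at_left_real[of 0 "1::real"]]) (use \<zeta> in \<open>auto simp: norm_mult\<close>)
    qed (use \<zeta> in auto)
    from tendsto_unique[OF _ this lim1] show ?thesis
      by simp
  qed
  then show thesis
    by (intro that[OF A(1) B(1)]) (simp add: S_def inverse_unit_circle)
qed

section \<open>Logarithms of Hoelder functions\<close>

lemma holder_circle_power_int: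
  assumes "0 < \<mu>" "\<mu> < 1"
  shows "(\<lambda>z. z powi n) \<in> holder_circle \<mu>"
proof (cases "n \<ge> 0")
  case True
  then show ?thesis
    using holder_circle_power[OF holder_circle_id[OF assms] assms(1), of "nat n"]
    by (simp add: power_int_def)
next
  case False
  then show ?thesis
    using holder_circle_power[OF holder_circle_reflect[OF holder_circle_id[OF assms]] assms(1), of "nat (-n)"]
    by (simp add: power_int_def)
qed

lemma norm_le_exp_minus_1:
  fixes x :: complex
  assumes "norm x \<le> 1 / 6"
  shows "norm x \<le> 2 * norm (exp x - 1)"
proof -
  have "norm (exp x - (\<Sum>i\<le>1. x ^ i / fact i)) \<le> exp \<bar>Re x\<bar> * norm x ^ Suc 1 / fact 1"
    by (rule Taylor_exp)
  then have "norm (exp x - (1 + x)) \<le> exp \<bar>Re x\<bar> * norm x * norm x"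
    by (simp add: power2_eq_square mult.assoc)
  also have "exp \<bar>Re x\<bar> \<le> exp 1"
    using assms abs_Re_le_cmod[of x] by simp
  also have "exp 1 \<le> (3 :: real)"
    by (rule exp_le)
  also have "3 * norm x * norm x \<le> 3 * (1 / 6) * norm x"
    using assms by (intro mult_right_mono mult_left_mono) auto
  finally have "norm (exp x - (1 + x)) \<le> norm x / 2"
    by (simp add: mult_right_mono)
  moreover have "norm x \<le> norm (exp x - 1) + norm (exp x - (1 + x))"
    using norm_triangle_ineq4[of "exp x - 1" "exp x - (1 + x)"] by simp
  ultimately show ?thesis
    by linarith
qed

text \<open>
  On the universal cover of the circle there is a continuous logarithm \<open>g\<close> of \<open>u (cis t)\<close>.  Its
  increment over a period is a constant \<open>2 * pi * \<i> * n\<close>, and \<open>g t - \<i> * n * t\<close> is periodic.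
  A continuous logarithm of a Hoelder function is Hoelder, because for nearby points the difference of
  the logarithms is bounded by the difference of the exponentials; for distant points the bound is
  trivial, as the logarithm is bounded.
\<close>

lemma holder_logarithm:
  assumes "u \<in> holder_circle \<mu>" and \<mu>: "0 < \<mu>" "\<mu> < 1"
    and nz: "\<And>z. z \<in> unit_circle \<Longrightarrow> u z \<noteq> 0"
  obtains n :: int and v where "v \<in> holder_circle \<mu>" "\<forall>z\<in>unit_circle. u z = z powi n * exp (v z)"
proof -
  have u: "continuous_on unit_circle u"
    by (rule holder_circle_continuous) fact+
  have "continuous_on UNIV (\<lambda>t. u (cis t))"
    using continuous_on_circle_param[OF u, of 1] by simp
  then obtain g :: "real \<Rightarrow> complex" where g: "continuous_on UNIV g" "\<And>t. u (cis t) = exp (g t)"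
    using continuous_logarithm_on_contractible[of UNIV "\<lambda>t. u (cis t)"] nz contractible_UNIV
    by (metis UNIV_I dist_0_norm mem_sphere norm_cis)
  define jump where "jump t = g (t + 2 * pi) - g t" for t
  have jump_values: "\<exists>n::int. jump t = 2 * of_int n * pi * \<i>" for t
  proof -
    have "exp (jump t) = exp (g (t + 2 * pi)) / exp (g t)"
      by (simp add: jump_def exp_diff)
    also have "\<dots> = 1"
      using nz[of "cis t"] by (simp flip: g(2) cis_mult)
    finally have "Re (jump t) = 0 \<and> (\<exists>n::int. Im (jump t) = of_int (2 * n) * pi)"
      by (simp only: exp_eq_1)
    then show ?thesis
      by (auto simp: complex_eq_iff)
  qed
  have "jump constant_on UNIV"
  proof (rule continuous_discrete_range_constant)
    show "continuous_on UNIV jump"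
      unfolding jump_def by (intro continuous_intros continuous_on_compose2[OF g(1)] g(1)) auto
    fix t
    have "1 \<le> norm (jump s - jump t)" if neq: "jump s \<noteq> jump t" for s
    proof -
      obtain m n :: int where mn: "jump s = 2 * of_int m * pi * \<i>" "jump t = 2 * of_int n * pi * \<i>"
        using jump_values by meson
      then have "1 \<le> \<bar>m - n\<bar>"
        using neq by (cases "m = n") auto
      then have "1 \<le> \<bar>real_of_int (m - n)\<bar>"
        by (metis of_int_1_le_iff of_int_abs)
      moreover have "jump s - jump t = of_real (2 * pi * of_int (m - n)) * \<i>"
        by (simp add: mn algebra_simps)
      then have "norm (jump s - jump t) = 2 * pi * \<bar>real_of_int (m - n)\<bar>"
        by (simp only: norm_mult norm_of_real norm_ii abs_mult) simp
      moreover have "1 * \<bar>real_of_int (m - n)\<bar> \<le> 2 * pi * \<bar>real_of_int (m - n)\<bar>"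
        using pi_gt3 by (intro mult_right_mono) auto
      ultimately show ?thesis
        by simp
    qed
    then show "\<exists>e>0. \<forall>s. s \<in> UNIV \<and> jump s \<noteq> jump t \<longrightarrow> e \<le> norm (jump s - jump t)"
      by (intro exI[of _ 1]) auto
  qed simp
  then obtain n :: int where n: "\<And>t. jump t = 2 * of_int n * pi * \<i>"
    unfolding constant_on_def using jump_values by (metis UNIV_I)
  define h where "h t = g t - of_int n * of_real t * \<i>" for t
  have h_cont: "continuous_on UNIV h"
    unfolding h_def by (intro continuous_intros g(1))
  have h_step: "h (t + 2 * pi) = h t" for t
    using n[of t] by (simp add: h_def jump_def algebra_simps)
  have h_nat: "h (t + 2 * pi * real m) = h t" for t m
  proof (induction m)
    case (Suc m)
    have "h (t + 2 * pi * real (Suc m)) = h ((t + 2 * pi * real m) + 2 * pi)"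
      by (simp add: algebra_simps)
    then show ?case
      using Suc by (simp only: h_step)
  qed simp
  have h_periodic: "h (t + 2 * pi * of_int m) = h t" for t and m :: int
  proof (cases "m \<ge> 0")
    case True
    then show ?thesis
      using h_nat[of t "nat m"] by simp
  next
    case False
    then show ?thesis
      using h_nat[of "t + 2 * pi * of_int m" "nat (-m)"] by simp
  qed
  have h_cis: "h t = h s" if "cis t = cis s" for t s
  proof -
    have "cis t = cis s \<longleftrightarrow> (\<exists>m::int. t = s + 2 * pi * of_int m)"
      unfolding cis_conv_exp exp_eq by (auto simp: complex_eq_iff)
    then show ?thesis
      using that h_periodic by auto
  qed
  define v where "v z = h (Arg z)" for z
  have cis_Arg: "cis (Arg z) = z" if "z \<in> unit_circle" for z
    using that by (subst cis_Arg) (auto simp: sgn_eq)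
  have u_eq: "u z = z powi n * exp (v z)" if z: "z \<in> unit_circle" for z
  proof -
    have "z powi n = cis (of_int n * Arg z)"
      using cis_Arg[OF z] by (metis cis_power_int)
    moreover have "exp (g (Arg z)) = u z"
      using g(2)[of "Arg z"] cis_Arg[OF z] by simp
    ultimately show ?thesis
      by (simp add: v_def h_def exp_diff cis_conv_exp mult_ac)
  qed
  have q: "(\<lambda>z. exp (v z)) \<in> holder_circle \<mu>"
  proof -
    have "(\<lambda>z. u z * z powi (- n)) \<in> holder_circle \<mu>"
      by (intro holder_circle_mult holder_circle_power_int assms)
    moreover have "u z * z powi (- n) = exp (v z)" if "z \<in> unit_circle" for z
      using u_eq[OF that] that by (auto simp: power_int_minus field_simps)
    ultimately show ?thesis
      unfolding holder_circle_def by simp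
  qed
  have "compact (h ` {-2*pi..2*pi})"
    using h_cont by (intro compact_continuous_image continuous_on_subset[OF h_cont]) auto
  then obtain R where R: "R > 0" "\<forall>t\<in>{-2*pi..2*pi}. norm (h t) \<le> R"
    by (auto simp: bounded_pos dest!: compact_imp_bounded)
  have Arg_in: "Arg z \<in> {-2*pi..2*pi}" for z
    using Arg_bounded[of z] by auto
  have v_bound: "norm (v z) \<le> R" for z
    using R(2) Arg_in by (auto simp: v_def)
  have "uniformly_continuous_on {-2*pi..2*pi} h"
    by (intro compact_uniformly_continuous continuous_on_subset[OF h_cont]) auto
  then obtain \<delta> where \<delta>: "\<delta> > 0"
    "\<forall>t\<in>{-2*pi..2*pi}. \<forall>s\<in>{-2*pi..2*pi}. dist s t < \<delta> \<longrightarrow> dist (h s) (h t) < 1 / 6"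
    unfolding uniformly_continuous_on_def by (metis divide_pos_pos zero_less_numeral zero_less_one)
  obtain C where C: "C \<ge> 0"
    "\<forall>z\<in>unit_circle. \<forall>w\<in>unit_circle. norm (exp (v z) - exp (v w)) \<le> C * norm (z - w) powr \<mu>"
    by (rule holder_circleE[OF q])
  have near: "norm (v z - v w) < 1 / 6"
    if z: "z \<in> unit_circle" and w: "w \<in> unit_circle" and close: "norm (z - w) < \<delta> / 2" for z w
  proof -
    \<comment> \<open>This argument of \<open>w\<close> is close to that of \<open>z\<close> even if the cut of
      \<open>Arg\<close> lies between the two points.\<close>
    define s where "s = Arg z + Arg (w / z)"
    have wz: "w / z \<in> unit_circle"
      using z w by (simp add: norm_divide)
    have "cis s = w"
      using cis_Arg[OF z] cis_Arg[OF wz] z by (auto simp: s_def simp flip: cis_mult)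
    then have "v w = h s"
      unfolding v_def using cis_Arg[OF w] by (intro h_cis) simp
    have "\<bar>Arg (w / z)\<bar> \<le> 2 * norm (w / z - 1)"
      using chord_lower_bound[of "Arg (w / z)"] Arg_bounded[of "w / z"] cis_Arg[OF wz] by auto
    also have "w / z - 1 = (w - z) / z"
      using z by (cases "z = 0") (simp_all add: diff_divide_distrib)
    also have "norm \<dots> = norm (z - w)"
      using z by (simp add: norm_divide norm_minus_commute)
    finally have "dist s (Arg z) < \<delta>"
      using close by (simp add: s_def dist_real_def)
    moreover have "s \<in> {-2*pi..2*pi}"
      using Arg_bounded[of z] Arg_bounded[of "w / z"] by (auto simp: s_def)
    ultimately have "dist (h s) (h (Arg z)) < 1 / 6"
      using \<delta>(2) Arg_in by blast
    then show ?thesis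
      using \<open>v w = h s\<close> by (simp add: v_def dist_norm norm_minus_commute)
  qed
  have "v \<in> holder_circle \<mu>"
  proof (rule holder_circleI[where C = "2 * exp R * C + 2 * R / (\<delta> / 2) powr \<mu>"])
    fix z w :: complex
    assume z: "z \<in> unit_circle" and w: "w \<in> unit_circle"
    show "norm (v z - v w) \<le> (2 * exp R * C + 2 * R / (\<delta> / 2) powr \<mu>) * norm (z - w) powr \<mu>"
    proof (cases "norm (z - w) < \<delta> / 2")
      case True
      have "norm (v z - v w) \<le> 2 * norm (exp (v z - v w) - 1)"
        using near[OF z w True] by (intro norm_le_exp_minus_1) simp
      also have "exp (v z - v w) - 1 = exp (- v w) * (exp (v z) - exp (v w))"
        by (simp add: exp_diff exp_minus field_simps)
      also have "norm \<dots> \<le> exp R * (C * norm (z - w) powr \<mu>)"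
        unfolding norm_mult
      proof (intro mult_mono)
        show "norm (exp (- v w)) \<le> exp R"
          using v_bound[of w] complex_Re_le_cmod[of "- v w"] by simp
      qed (use C z w in auto)
      finally have "norm (v z - v w) \<le> 2 * exp R * C * norm (z - w) powr \<mu>"
        by simp
      also have "\<dots> \<le> (2 * exp R * C + 2 * R / (\<delta> / 2) powr \<mu>) * norm (z - w) powr \<mu>"
        using R(1) by (intro mult_right_mono) auto
      finally show ?thesis .
    next
      case False
      have "norm (v z - v w) \<le> 2 * R"
        using norm_triangle_ineq4[of "v z" "v w"] v_bound[of z] v_bound[of w] by linarith
      also have "\<dots> = 2 * R / (\<delta> / 2) powr \<mu> * (\<delta> / 2) powr \<mu>"
        using \<delta>(1) by simp
      also have "\<dots> \<le> 2 * R / (\<delta> / 2) powr \<mu> * norm (z - w) powr \<mu>"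
        using False \<delta>(1) R(1) \<mu> by (intro mult_left_mono powr_mono2) auto
      also have "\<dots> \<le> (2 * exp R * C + 2 * R / (\<delta> / 2) powr \<mu>) * norm (z - w) powr \<mu>"
        using C(1) by (intro mult_right_mono) auto
      finally show ?thesis .
    qed
  qed
  then show thesis
    using u_eq by (intro that[of v n]) auto
qed

section \<open>Charts of the surface\<close>

lemma inf_curve_to_aff_curve:
  assumes "(\<zeta>, \<sigma>) \<in> inf_curve k" "\<zeta> \<noteq> 0"
  shows "(1 / \<zeta>, \<sigma> / \<zeta>\<^sup>2) \<in> aff_curve k"
  using assms unfolding inf_curve_def aff_curve_def
  by (simp add: divide_simps) (simp add: algebra_simps power2_eq_square)

lemma aff_curve_to_inf_curve:
  assumes "(\<xi>, \<tau>) \<in> aff_curve k" "\<xi> \<noteq> 0"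
  shows "(1 / \<xi>, \<tau> / \<xi>\<^sup>2) \<in> inf_curve k"
  using assms unfolding inf_curve_def aff_curve_def
  by (simp add: divide_simps) (simp add: algebra_simps power2_eq_square)

lemma glue_aff_eq: "glue_aff x = Aff (fst x) (snd x)"
  by (cases x) simp

lemma glue_inf_eq:
  "glue_inf x = (if fst x = 0 then Infty (snd x) else Aff (1 / fst x) (snd x / (fst x)\<^sup>2))"
  by (cases x) simp

text \<open>
  The change of coordinates \<open>(\<xi>, \<tau>) \<mapsto> (1 / \<xi>, \<tau> / \<xi>\<^sup>2)\<close> is an involution, so that the same set occurs
  as a preimage in both directions.
\<close>

lemma open_transition:
  fixes Q :: "(complex \<times> complex) set"
  assumes "open Q"
  shows "open {x :: complex \<times> complex. fst x \<noteq> 0 \<and> (1 / fst x, snd x / (fst x)\<^sup>2) \<in> Q}"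
proof -
  have "open {x :: complex \<times> complex. fst x \<noteq> 0}"
    by (intro open_Collect_neq continuous_intros)
  moreover have "continuous_on {x :: complex \<times> complex. fst x \<noteq> 0} (\<lambda>x. (1 / fst x, snd x / (fst x)\<^sup>2))"
    by (auto intro!: continuous_intros)
  ultimately have "open ({x :: complex \<times> complex. fst x \<noteq> 0} \<inter> (\<lambda>x. (1 / fst x, snd x / (fst x)\<^sup>2)) -` Q)"
    using assms by (intro continuous_open_preimage)
  then show ?thesis
    by (simp add: Int_def vimage_def)
qed

lemma surf_open_glue_aff:
  assumes "open Q"
  shows "surf_open k (glue_aff ` (Q \<inter> aff_curve k))"
proof -
  have 1: "{x \<in> aff_curve k. glue_aff x \<in> glue_aff ` (Q \<inter> aff_curve k)} = aff_curve k \<inter> Q"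
    by (auto simp: glue_aff_eq prod_eq_iff)
  have 2: "{x \<in> inf_curve k. glue_inf x \<in> glue_aff ` (Q \<inter> aff_curve k)} =
      inf_curve k \<inter> {x. fst x \<noteq> 0 \<and> (1 / fst x, snd x / (fst x)\<^sup>2) \<in> Q}"
  proof (intro equalityI subsetI)
    fix x
    assume "x \<in> {x \<in> inf_curve k. glue_inf x \<in> glue_aff ` (Q \<inter> aff_curve k)}"
    then obtain y where "x \<in> inf_curve k" "glue_inf x = glue_aff y" "y \<in> Q"
      by auto
    then show "x \<in> inf_curve k \<inter> {x. fst x \<noteq> 0 \<and> (1 / fst x, snd x / (fst x)\<^sup>2) \<in> Q}"
      by (simp add: glue_aff_eq glue_inf_eq split: if_splits)
  next
    fix x
    assume x: "x \<in> inf_curve k \<inter> {x. fst x \<noteq> 0 \<and> (1 / fst x, snd x / (fst x)\<^sup>2) \<in> Q}"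
    then have "(1 / fst x, snd x / (fst x)\<^sup>2) \<in> Q \<inter> aff_curve k"
      using inf_curve_to_aff_curve[of "fst x" "snd x" k] by simp
    moreover have "glue_inf x = glue_aff (1 / fst x, snd x / (fst x)\<^sup>2)"
      using x by (simp add: glue_inf_eq)
    ultimately show "x \<in> {x \<in> inf_curve k. glue_inf x \<in> glue_aff ` (Q \<inter> aff_curve k)}"
      using x by blast
  qed
  show ?thesis
    unfolding surf_open_def 1 2
    using open_transition[OF assms] assms by (auto simp: surf_def)
qed

lemma surf_open_glue_inf:
  assumes "open Q"
  shows "surf_open k (glue_inf ` (Q \<inter> inf_curve k))"
proof -
  have 1: "{x \<in> inf_curve k. glue_inf x \<in> glue_inf ` (Q \<inter> inf_curve k)} = inf_curve k \<inter> Q"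
    by (auto simp: glue_inf_eq prod_eq_iff split: if_splits)
  have 2: "{x \<in> aff_curve k. glue_aff x \<in> glue_inf ` (Q \<inter> inf_curve k)} =
      aff_curve k \<inter> {x. fst x \<noteq> 0 \<and> (1 / fst x, snd x / (fst x)\<^sup>2) \<in> Q}"
  proof (intro equalityI subsetI)
    fix x
    assume "x \<in> {x \<in> aff_curve k. glue_aff x \<in> glue_inf ` (Q \<inter> inf_curve k)}"
    then obtain y where y: "x \<in> aff_curve k" "glue_aff x = glue_inf y" "y \<in> Q"
      by auto
    then have *: "fst y \<noteq> 0" "fst x = 1 / fst y" "snd x = snd y / (fst y)\<^sup>2"
      by (auto simp: glue_aff_eq glue_inf_eq split: if_splits)
    then have "(1 / fst x, snd x / (fst x)\<^sup>2) = y"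
      by (simp add: prod_eq_iff power_divide)
    with y * show "x \<in> aff_curve k \<inter> {x. fst x \<noteq> 0 \<and> (1 / fst x, snd x / (fst x)\<^sup>2) \<in> Q}"
      by simp
  next
    fix x
    assume x: "x \<in> aff_curve k \<inter> {x. fst x \<noteq> 0 \<and> (1 / fst x, snd x / (fst x)\<^sup>2) \<in> Q}"
    then have "(1 / fst x, snd x / (fst x)\<^sup>2) \<in> Q \<inter> inf_curve k"
      using aff_curve_to_inf_curve[of "fst x" "snd x" k] by simp
    moreover have "glue_aff x = glue_inf (1 / fst x, snd x / (fst x)\<^sup>2)"
      using x by (simp add: glue_aff_eq glue_inf_eq field_simps)
    ultimately show "x \<in> {x \<in> aff_curve k. glue_aff x \<in> glue_inf ` (Q \<inter> inf_curve k)}"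
      using x by blast
  qed
  show ?thesis
    unfolding surf_open_def 1 2
    using open_transition[OF assms] assms by (auto simp: surf_def)
qed

text \<open>
  On an open set, continuity can be tested on the two affine curves separately.
\<close>

lemma continuous_map_on_surf_open:
  fixes F :: "point \<Rightarrow> complex"
  assumes V: "surf_open k V"
    and aff: "continuous_on {x \<in> aff_curve k. glue_aff x \<in> V} (\<lambda>x. F (glue_aff x))"
    and inf: "continuous_on {x \<in> inf_curve k. glue_inf x \<in> V} (\<lambda>x. F (glue_inf x))"
  shows "continuous_map (subtopology (surf_topology k) V) euclidean F"
proof -
  have V_sub: "V \<subseteq> surf k"
    using V by (simp add: surf_open_def)
  have "openin (subtopology (surf_topology k) V) {p \<in> V. F p \<in> Q}" if "open Q" for Q
  proof -
    have trans: "openin (top_of_set C) {x \<in> C. g x \<in> {p \<in> V. F p \<in> Q}}"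
      if C: "openin (top_of_set C) {x \<in> C. g x \<in> V}"
        and cont: "continuous_on {x \<in> C. g x \<in> V} (\<lambda>x. F (g x))"
      for C and g :: "complex \<times> complex \<Rightarrow> point"
    proof -
      have "openin (top_of_set {x \<in> C. g x \<in> V}) ({x \<in> C. g x \<in> V} \<inter> (\<lambda>x. F (g x)) -` Q)"
        using cont \<open>open Q\<close> by (rule continuous_openin_preimage_gen)
      from openin_trans[OF this C] show ?thesis
        by (rule back_subst[where P = "openin (top_of_set C)"]) auto
    qed
    have "surf_open k {p \<in> V. F p \<in> Q}"
      using V V_sub trans[OF _ aff] trans[OF _ inf] by (auto simp: surf_open_def)
    then show ?thesis
      using V by (subst openin_open_subtopology) (auto simp: openin_surf_topology)
  qed
  moreover have "topspace (subtopology (surf_topology k) V) = V"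
    using V_sub by (auto simp: topspace_surf_topology)
  ultimately show ?thesis
    by (simp add: continuous_map)
qed

lemma continuous_map_glue_aff: "continuous_map (top_of_set (aff_curve k)) (surf_topology k) glue_aff"
  by (auto simp: continuous_map_def topspace_surf_topology openin_surf_topology surf_open_def surf_def)

lemma continuous_map_glue_inf: "continuous_map (top_of_set (inf_curve k)) (surf_topology k) glue_inf"
  by (auto simp: continuous_map_def topspace_surf_topology openin_surf_topology surf_open_def surf_def)

lemma surf_chartI:
  assumes U: "surf_open k U" and D: "open D"
    and \<phi>: "\<phi> \<in> {coord_xi, coord_tau} \<and> U \<subseteq> glue_aff ` aff_curve k \<or>
      \<phi> = coord_zeta \<and> U \<subseteq> glue_inf ` inf_curve k"
    and \<gamma>: "\<gamma> ` D = U" "\<And>z. z \<in> D \<Longrightarrow> \<phi> (\<gamma> z) = z"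
    and \<gamma>_cont: "continuous_map (top_of_set D) (surf_topology k) \<gamma>"
  shows "surf_chart k U \<phi>" "\<phi> ` U = D" "\<And>z. z \<in> D \<Longrightarrow> inv_into U \<phi> z = \<gamma> z"
proof -
  show image: "\<phi> ` U = D"
    unfolding \<gamma>(1)[symmetric] using \<gamma>(2) by (auto simp: image_image)
  have inj: "inj_on \<phi> U"
    unfolding \<gamma>(1)[symmetric] using \<gamma>(2) by (auto simp: inj_on_def)
  show "inv_into U \<phi> z = \<gamma> z" if "z \<in> D" for z
    using inv_into_f_f[OF inj, of "\<gamma> z"] \<gamma>(1) \<gamma>(2)[OF that] that by auto
  have aff_nz: "fst x \<noteq> 0" if "x \<in> inf_curve k" "glue_inf x \<in> glue_aff ` A" for x A
    using that by (auto simp: glue_aff_eq glue_inf_eq split: if_splits)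
  have inf_nz: "fst x \<noteq> 0" if "x \<in> aff_curve k" "glue_aff x \<in> glue_inf ` A" for x A
    using that by (auto simp: glue_aff_eq glue_inf_eq split: if_splits)
  have "continuous_map (subtopology (surf_topology k) U) euclidean \<phi>"
    using \<phi>
  proof (elim disjE conjE)
    assume a: "\<phi> \<in> {coord_xi, coord_tau}" "U \<subseteq> glue_aff ` aff_curve k"
    have nz: "fst x \<noteq> 0" if "x \<in> {x \<in> inf_curve k. glue_inf x \<in> U}" for x
      using that a(2) aff_nz[of x "aff_curve k"] by blast
    show ?thesis
    proof (rule continuous_map_on_surf_open[OF U])
      show "continuous_on {x \<in> aff_curve k. glue_aff x \<in> U} (\<lambda>x. \<phi> (glue_aff x))"
        using a(1) by (auto simp: glue_aff_eq intro!: continuous_intros)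
      have "continuous_on {x \<in> inf_curve k. glue_inf x \<in> U} (\<lambda>x. 1 / fst x)"
        "continuous_on {x \<in> inf_curve k. glue_inf x \<in> U} (\<lambda>x. snd x / (fst x)\<^sup>2)"
        by (intro continuous_intros ballI power_not_zero nz; assumption)+
      moreover have "coord_xi (glue_inf x) = 1 / fst x" "coord_tau (glue_inf x) = snd x / (fst x)\<^sup>2"
        if "x \<in> {x \<in> inf_curve k. glue_inf x \<in> U}" for x
        using nz[OF that] by (simp_all add: glue_inf_eq)
      ultimately have "continuous_on {x \<in> inf_curve k. glue_inf x \<in> U} (\<lambda>x. coord_xi (glue_inf x))"
        "continuous_on {x \<in> inf_curve k. glue_inf x \<in> U} (\<lambda>x. coord_tau (glue_inf x))"
        by (metis (no_types, lifting) continuous_on_cong)+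
      then show "continuous_on {x \<in> inf_curve k. glue_inf x \<in> U} (\<lambda>x. \<phi> (glue_inf x))"
        using a(1) by auto
    qed
  next
    assume a: "\<phi> = coord_zeta" "U \<subseteq> glue_inf ` inf_curve k"
    have nz: "fst x \<noteq> 0" if "x \<in> {x \<in> aff_curve k. glue_aff x \<in> U}" for x
      using that a(2) inf_nz[of x "inf_curve k"] by blast
    show ?thesis
    proof (rule continuous_map_on_surf_open[OF U])
      show "continuous_on {x \<in> aff_curve k. glue_aff x \<in> U} (\<lambda>x. \<phi> (glue_aff x))"
        using nz by (auto simp: glue_aff_eq a(1) intro!: continuous_intros)
      have "\<phi> (glue_inf x) = fst x" for x
        by (simp add: glue_inf_eq a(1))
      then show "continuous_on {x \<in> inf_curve k. glue_inf x \<in> U} (\<lambda>x. \<phi> (glue_inf x))"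
        by (simp only:) (intro continuous_intros)
    qed
  qed
  moreover have "topspace (subtopology (surf_topology k) U) = U"
    using U by (auto simp: topspace_surf_topology surf_open_def)
  moreover have "\<gamma> (\<phi> p) = p" if p: "p \<in> U" for p
  proof -
    obtain z where "z \<in> D" "p = \<gamma> z"
      using p \<gamma>(1) by blast
    then show ?thesis
      using \<gamma>(2) by simp
  qed
  ultimately have "homeomorphic_maps (subtopology (surf_topology k) U) (top_of_set D) \<phi> \<gamma>"
    using image \<gamma>(2) \<gamma>_cont \<gamma>(1)[THEN equalityD1]
    unfolding homeomorphic_maps_def
    by (auto simp: continuous_map_in_subtopology)
  then have "homeomorphic_map (subtopology (surf_topology k) U) (top_of_set (\<phi> ` U)) \<phi>"
    unfolding image homeomorphic_map_maps by blast
  then show "surf_chart k U \<phi>"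
    using U D \<phi> image by (simp add: surf_chart_def openin_surf_topology)
qed

text \<open>
  The open set \<open>Q\<close> cuts out a piece of the curve on which the curve is a graph over the coordinate
  \<open>\<pi>\<close>, that is, on which \<open>\<xi>\<close> and \<open>\<tau>\<close> are the functions \<open>x\<close> and \<open>t\<close> of that coordinate.
\<close>

lemma aff_chartI:
  assumes Q: "open Q" and D: "open D"
    and c: "(\<phi>, \<pi>) \<in> {(coord_xi, fst), (coord_tau, snd)}"
    and x: "x holomorphic_on D" and t: "t holomorphic_on D"
    and to: "\<And>q. q \<in> Q \<inter> aff_curve k \<Longrightarrow> \<pi> q \<in> D \<and> q = (x (\<pi> q), t (\<pi> q))"
    and fro: "\<And>z. z \<in> D \<Longrightarrow> (x z, t z) \<in> Q \<inter> aff_curve k \<and> \<pi> (x z, t z) = z"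
  shows "surf_chart k (glue_aff ` (Q \<inter> aff_curve k)) \<phi>"
    and "\<phi> ` glue_aff ` (Q \<inter> aff_curve k) = D"
    and "\<And>z. z \<in> D \<Longrightarrow> inv_into (glue_aff ` (Q \<inter> aff_curve k)) \<phi> z = Aff (x z) (t z)"
proof -
  let ?U = "glue_aff ` (Q \<inter> aff_curve k)"
  have image: "(\<lambda>z. Aff (x z) (t z)) ` D = ?U"
  proof (intro equalityI subsetI)
    fix p assume "p \<in> (\<lambda>z. Aff (x z) (t z)) ` D"
    then obtain z where "z \<in> D" "p = Aff (x z) (t z)"
      by blast
    then show "p \<in> ?U"
      using fro[of z] by (intro image_eqI[of _ _ "(x z, t z)"]) auto
  next
    fix p assume "p \<in> ?U"
    then obtain q where q: "q \<in> Q \<inter> aff_curve k" "p = glue_aff q"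
      by blast
    have "glue_aff q = glue_aff (x (\<pi> q), t (\<pi> q))"
      using to[OF q(1)] by (intro arg_cong[of _ _ glue_aff]) (rule conjunct2)
    then have "p = Aff (x (\<pi> q)) (t (\<pi> q))"
      using q(2) by (simp only: glue_aff.simps)
    then show "p \<in> (\<lambda>z. Aff (x z) (t z)) ` D"
      using to[OF q(1)] by (rule image_eqI[OF _ conjunct1])
  qed
  have inverse: "\<phi> (Aff (x z) (t z)) = z" if "z \<in> D" for z
    using fro[OF that] c by auto
  have "continuous_map (top_of_set D) (top_of_set (aff_curve k)) (\<lambda>z. (x z, t z))"
    using fro x t by (auto simp: continuous_map_in_subtopology
        intro!: continuous_on_Pair holomorphic_on_imp_continuous_on)
  from continuous_map_compose[OF this continuous_map_glue_aff]
  have "continuous_map (top_of_set D) (surf_topology k) (\<lambda>z. Aff (x z) (t z))"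
    by (simp add: o_def)
  note chart = surf_chartI[OF surf_open_glue_aff[OF Q, of k] D _ image inverse this]
  have "\<phi> \<in> {coord_xi, coord_tau} \<and> ?U \<subseteq> glue_aff ` aff_curve k"
    using c by auto
  then show "surf_chart k ?U \<phi>" "\<phi> ` ?U = D"
    "\<And>z. z \<in> D \<Longrightarrow> inv_into ?U \<phi> z = Aff (x z) (t z)"
    using chart by blast+
qed

lemma Re_csqrt_pos:
  assumes "z \<notin> \<real>\<^sub>\<le>\<^sub>0"
  shows "Re (csqrt z) > 0"
proof (rule ccontr)
  assume "\<not> Re (csqrt z) > 0"
  then have "Re (csqrt z) = 0"
    using csqrt_principal[of z] by auto
  then have "Re (csqrt z * csqrt z) \<le> 0 \<and> Im (csqrt z * csqrt z) = 0"
    unfolding times_complex.sel by (simp only:) simp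
  moreover have "csqrt z * csqrt z = z"
    by (metis power2_csqrt power2_eq_square)
  ultimately show False
    using assms by (simp add: complex_nonpos_Reals_iff)
qed

text \<open>
  Explicit square roots describe the curve as a graph.  Near a point with \<open>\<tau>\<^sub>0 \<noteq> 0\<close> the coordinate is
  \<open>\<xi>\<close>, and \<open>\<tau> / \<tau>\<^sub>0\<close> is the principal root of a quotient that equals \<open>1\<close> at the given point.
  Near a branch point the coordinate is \<open>\<tau>\<close>.  The equation of the curve is quadratic in \<open>\<xi>\<^sup>2\<close>, namely
  \<open>(\<xi>\<^sup>2 + m)\<^sup>2 = d\<^sup>2 + \<tau>\<^sup>2\<close> with \<open>m = (1 + k\<^sup>2) / 2\<close> and \<open>d = (k\<^sup>2 - 1) / 2\<close>.  The sign \<open>e\<close> selects one of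
  its solutions \<open>\<xi>\<^sup>2\<close>, according to whether the branch point is \<open>\<plusminus> \<i>\<close> or \<open>\<plusminus> k * \<i>\<close>, and a second square
  root yields \<open>\<xi>\<close>.  The set \<open>N\<close> allows the chart to be shrunk into a given part of the \<open>\<xi>\<close>-plane.
\<close>

lemma affine_chart_exists:
  assumes k: "k > 1" and p: "(\<xi>\<^sub>0, \<tau>\<^sub>0) \<in> aff_curve k" and N: "open N" "\<xi>\<^sub>0 \<in> N"
  obtains U \<phi> x t where "surf_chart k U \<phi>" "Aff \<xi>\<^sub>0 \<tau>\<^sub>0 \<in> U" "open (\<phi> ` U)"
    "x holomorphic_on \<phi> ` U" "t holomorphic_on \<phi> ` U"
    "\<forall>z\<in>\<phi> ` U. x z \<in> N \<and> inv_into U \<phi> z = Aff (x z) (t z)"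
proof (cases "\<tau>\<^sub>0 = 0")
  case False
  define q where "q \<xi> = (1 + \<xi>\<^sup>2) * ((complex_of_real k)\<^sup>2 + \<xi>\<^sup>2) / \<tau>\<^sub>0\<^sup>2" for \<xi> :: complex
  define t where "t \<xi> = \<tau>\<^sub>0 * csqrt (q \<xi>)" for \<xi>
  define D where "D = N \<inter> q -` (- \<real>\<^sub>\<le>\<^sub>0)"
  have q_cont: "continuous_on UNIV q"
    unfolding q_def using False by (auto intro!: continuous_intros)
  have D: "open D"
    unfolding D_def using N q_cont by (intro open_Int open_vimage) auto
  define Q where "Q = D \<times> {\<tau>. Re (\<tau> / \<tau>\<^sub>0) > 0}"
  have Q: "open Q"
    unfolding Q_def using False by (intro open_Times D open_Collect_less continuous_intros) auto
  have pos: "Re (csqrt (q \<xi>)) > 0" if "\<xi> \<in> D" for \<xi>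
    using that by (intro Re_csqrt_pos) (auto simp: D_def)
  show thesis
  proof (rule that)
    have t: "t holomorphic_on D"
      unfolding t_def q_def using False by (intro holomorphic_intros) (auto simp: D_def q_def)
    have to: "fst r \<in> D \<and> r = (fst r, t (fst r))" if r: "r \<in> Q \<inter> aff_curve k" for r
    proof -
      obtain \<xi> \<tau> where r_eq: "r = (\<xi>, \<tau>)"
        by (cases r)
      have "(\<tau> / \<tau>\<^sub>0)\<^sup>2 = q \<xi>" "Re (\<tau> / \<tau>\<^sub>0) > 0"
        using r by (auto simp: r_eq q_def aff_curve_def power_divide Q_def)
      then have "csqrt (q \<xi>) = \<tau> / \<tau>\<^sub>0"
        by (intro csqrt_unique) auto
      then show ?thesis
        using r False by (simp add: r_eq t_def Q_def)
    qed
    have fro: "(z, t z) \<in> Q \<inter> aff_curve k \<and> fst (z, t z) = z" if "z \<in> D" for z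
      using that pos[OF that] False by (auto simp: Q_def t_def aff_curve_def power_mult_distrib q_def)
    note chart = aff_chartI[OF Q D _ holomorphic_on_ident t to fro, where \<phi> = coord_xi]
    show "surf_chart k (glue_aff ` (Q \<inter> aff_curve k)) coord_xi"
      by (rule chart) auto
    have image: "coord_xi ` glue_aff ` (Q \<inter> aff_curve k) = D"
      by (rule chart) auto
    show "open (coord_xi ` glue_aff ` (Q \<inter> aff_curve k))"
      "(\<lambda>\<xi>. \<xi>) holomorphic_on coord_xi ` glue_aff ` (Q \<inter> aff_curve k)"
      "t holomorphic_on coord_xi ` glue_aff ` (Q \<inter> aff_curve k)"
      unfolding image by (auto intro: D t holomorphic_intros)
    show "\<forall>z\<in>coord_xi ` glue_aff ` (Q \<inter> aff_curve k). z \<in> N \<and>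
        inv_into (glue_aff ` (Q \<inter> aff_curve k)) coord_xi z = Aff z (t z)"
      unfolding image using chart(3) by (auto simp: D_def)
    have "(1 + \<xi>\<^sub>0\<^sup>2) * ((complex_of_real k)\<^sup>2 + \<xi>\<^sub>0\<^sup>2) = \<tau>\<^sub>0\<^sup>2"
      using p by (simp add: aff_curve_def)
    then have "q \<xi>\<^sub>0 = \<tau>\<^sub>0\<^sup>2 / \<tau>\<^sub>0\<^sup>2"
      by (simp only: q_def)
    then have "q \<xi>\<^sub>0 = 1"
      using False by simp
    then have "(\<xi>\<^sub>0, \<tau>\<^sub>0) \<in> Q \<inter> aff_curve k"
      using p N False by (auto simp: Q_def D_def)
    then show "Aff \<xi>\<^sub>0 \<tau>\<^sub>0 \<in> glue_aff ` (Q \<inter> aff_curve k)"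
      by (rule rev_image_eqI) simp
  qed
next
  case True
  define m where "m = (1 + (complex_of_real k)\<^sup>2) / 2"
  define d where "d = (k\<^sup>2 - 1) / 2"
  have "d > 0"
    using k by (simp add: d_def)
  have d_m: "of_real d - m = -1" "- of_real d - m = - (complex_of_real k)\<^sup>2"
    by (simp_all add: d_def m_def field_simps)
  have "(1 + \<xi>\<^sub>0\<^sup>2) * ((complex_of_real k)\<^sup>2 + \<xi>\<^sub>0\<^sup>2) = 0"
    using p True by (simp add: aff_curve_def)
  then have "\<xi>\<^sub>0\<^sup>2 = -1 \<or> \<xi>\<^sub>0\<^sup>2 = - (complex_of_real k)\<^sup>2"
    by (simp add: eq_neg_iff_add_eq_0 add.commute)
  then obtain e :: complex where e: "e = 1 \<or> e = -1" "\<xi>\<^sub>0\<^sup>2 = e * of_real d - m"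
    using d_m by (metis mult_1 mult_minus1)
  have "\<xi>\<^sub>0 \<noteq> 0"
    using \<open>\<xi>\<^sub>0\<^sup>2 = -1 \<or> \<xi>\<^sub>0\<^sup>2 = - (complex_of_real k)\<^sup>2\<close> k by auto
  define s where "s \<tau> = csqrt (of_real (d\<^sup>2) + \<tau>\<^sup>2)" for \<tau> :: complex
  define q where "q \<tau> = (e * s \<tau> - m) / \<xi>\<^sub>0\<^sup>2" for \<tau>
  define x where "x \<tau> = \<xi>\<^sub>0 * csqrt (q \<tau>)" for \<tau>
  define D0 where "D0 = {\<tau> :: complex. of_real (d\<^sup>2) + \<tau>\<^sup>2 \<notin> \<real>\<^sub>\<le>\<^sub>0}"
  define D1 where "D1 = D0 \<inter> q -` (- \<real>\<^sub>\<le>\<^sub>0)"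
  define D where "D = D1 \<inter> x -` N"
  have D0: "open D0"
  proof -
    have "D0 = (\<lambda>\<tau>. of_real (d\<^sup>2) + \<tau>\<^sup>2) -` (- \<real>\<^sub>\<le>\<^sub>0)"
      by (auto simp: D0_def)
    then show ?thesis
      by (simp only:) (intro open_vimage continuous_intros; auto)
  qed
  have s_holo: "s holomorphic_on D0"
    unfolding s_def by (intro holomorphic_intros) (auto simp: D0_def)
  have q_holo: "q holomorphic_on D0"
    unfolding q_def using \<open>\<xi>\<^sub>0 \<noteq> 0\<close> by (intro holomorphic_intros s_holo) auto
  have D1: "open D1"
    unfolding D1_def by (intro continuous_open_preimage holomorphic_on_imp_continuous_on[OF q_holo] D0) auto
  have x_holo: "x holomorphic_on D1"
    unfolding x_def using holomorphic_on_subset[OF q_holo, of D1]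
    by (intro holomorphic_intros) (auto simp: D1_def)
  have D: "open D"
    unfolding D_def by (intro continuous_open_preimage holomorphic_on_imp_continuous_on[OF x_holo] D1 N)
  define Q where "Q = {r. snd r \<in> D \<and> Re (e * ((fst r)\<^sup>2 + m)) > 0 \<and> Re (fst r / \<xi>\<^sub>0) > 0}"
  have Q: "open Q"
  proof -
    have "Q = (snd -` D) \<inter> {r. Re (e * ((fst r)\<^sup>2 + m)) > 0} \<inter> {r. Re (fst r / \<xi>\<^sub>0) > 0}"
      by (auto simp: Q_def)
    then show ?thesis
      using \<open>\<xi>\<^sub>0 \<noteq> 0\<close>
      by (simp only:) (intro open_Int open_Collect_less open_vimage D continuous_intros; auto)
  qed
  show thesis
  proof (rule that)
    have x: "x holomorphic_on D"
      by (rule holomorphic_on_subset[OF x_holo]) (auto simp: D_def)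
    have curve: "(\<xi>, \<tau>) \<in> aff_curve k \<longleftrightarrow> (e * (\<xi>\<^sup>2 + m))\<^sup>2 = of_real (d\<^sup>2) + \<tau>\<^sup>2" for \<xi> \<tau>
    proof -
      have "(e * (\<xi>\<^sup>2 + m))\<^sup>2 = (\<xi>\<^sup>2 + m)\<^sup>2"
        using e(1) by (auto simp: power_mult_distrib)
      also have "\<dots> = of_real (d\<^sup>2) + ((1 + \<xi>\<^sup>2) * ((complex_of_real k)\<^sup>2 + \<xi>\<^sup>2))"
        by (simp add: m_def d_def field_simps power2_eq_square)
      finally show ?thesis
        by (auto simp: aff_curve_def)
    qed
    have to: "snd r \<in> D \<and> r = (x (snd r), snd r)" if r: "r \<in> Q \<inter> aff_curve k" for r
    proof -
      obtain \<xi> \<tau> where r_eq: "r = (\<xi>, \<tau>)"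
        by (cases r)
      have "s \<tau> = e * (\<xi>\<^sup>2 + m)"
        unfolding s_def using r curve[of \<xi> \<tau>] by (intro csqrt_unique) (auto simp: r_eq Q_def)
      then have "(\<xi> / \<xi>\<^sub>0)\<^sup>2 = q \<tau>"
        using e(1) by (auto simp: q_def power_divide)
      then have "csqrt (q \<tau>) = \<xi> / \<xi>\<^sub>0"
        using r by (intro csqrt_unique) (auto simp: r_eq Q_def)
      then show ?thesis
        using r \<open>\<xi>\<^sub>0 \<noteq> 0\<close> by (simp add: r_eq x_def Q_def)
    qed
    have fro: "(x z, z) \<in> Q \<inter> aff_curve k \<and> snd (x z, z) = z" if z: "z \<in> D" for z
    proof -
      have "(x z)\<^sup>2 = e * s z - m"
        using \<open>\<xi>\<^sub>0 \<noteq> 0\<close> by (simp add: x_def power_mult_distrib q_def)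
      then have es: "e * ((x z)\<^sup>2 + m) = s z"
        using e(1) by auto
      have s_pos: "Re (s z) > 0"
        unfolding s_def using z by (intro Re_csqrt_pos) (auto simp: D_def D1_def D0_def)
      have "Re (csqrt (q z)) > 0"
        using z by (intro Re_csqrt_pos) (auto simp: D_def D1_def)
      moreover have "x z / \<xi>\<^sub>0 = csqrt (q z)"
        unfolding x_def using \<open>\<xi>\<^sub>0 \<noteq> 0\<close> by (rule nonzero_mult_div_cancel_left)
      ultimately have x_pos: "Re (x z / \<xi>\<^sub>0) > 0"
        by (simp only:)
      have "(x z, z) \<in> aff_curve k"
        unfolding curve es by (simp add: s_def)
      moreover have "(x z, z) \<in> Q"
        unfolding Q_def mem_Collect_eq fst_conv snd_conv es using z s_pos x_pos by blast
      ultimately show ?thesis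
        by simp
    qed
    note chart = aff_chartI[OF Q D _ x holomorphic_on_ident to fro, where \<phi> = coord_tau]
    show "surf_chart k (glue_aff ` (Q \<inter> aff_curve k)) coord_tau"
      by (rule chart) auto
    have image: "coord_tau ` glue_aff ` (Q \<inter> aff_curve k) = D"
      by (rule chart) auto
    show "open (coord_tau ` glue_aff ` (Q \<inter> aff_curve k))"
      "x holomorphic_on coord_tau ` glue_aff ` (Q \<inter> aff_curve k)"
      "(\<lambda>\<tau>. \<tau>) holomorphic_on coord_tau ` glue_aff ` (Q \<inter> aff_curve k)"
      unfolding image by (auto intro: D x holomorphic_intros)
    show "\<forall>z\<in>coord_tau ` glue_aff ` (Q \<inter> aff_curve k). x z \<in> N \<and>
        inv_into (glue_aff ` (Q \<inter> aff_curve k)) coord_tau z = Aff (x z) z"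
      unfolding image using chart(3) by (auto simp: D_def)
    have "s 0 = of_real d"
      unfolding s_def using \<open>d > 0\<close> by (intro csqrt_unique) auto
    then have "q 0 = 1"
      using \<open>\<xi>\<^sub>0 \<noteq> 0\<close> by (simp add: q_def e(2)[symmetric])
    then have "0 \<in> D"
      using N \<open>d > 0\<close> by (auto simp: D_def D1_def D0_def x_def simp flip: of_real_power)
    moreover have "x 0 = \<xi>\<^sub>0"
      using \<open>q 0 = 1\<close> by (simp add: x_def)
    ultimately have "(\<xi>\<^sub>0, \<tau>\<^sub>0) \<in> Q \<inter> aff_curve k"
      using fro[of 0] True by simp
    then show "Aff \<xi>\<^sub>0 \<tau>\<^sub>0 \<in> glue_aff ` (Q \<inter> aff_curve k)"
      by (rule rev_image_eqI) simp
  qed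
qed

text \<open>
  The disc \<open>\<bar>\<zeta>\<bar> < 1\<close> excludes the points over \<open>\<xi> = \<plusminus> \<i>\<close>, which are the poles of the rational functions
  to be considered.
\<close>

lemma infinity_chart_exists:
  assumes \<sigma>\<^sub>0: "\<sigma>\<^sub>0 = 1 \<or> \<sigma>\<^sub>0 = -1"
  obtains U s where "surf_chart k U coord_zeta" "Infty \<sigma>\<^sub>0 \<in> U" "open (coord_zeta ` U)"
    "s holomorphic_on coord_zeta ` U"
    "\<forall>z\<in>coord_zeta ` U. norm z < 1 \<and> inv_into U coord_zeta z = glue_inf (z, s z)"
proof -
  define q where "q \<zeta> = (1 + \<zeta>\<^sup>2) * (1 + (complex_of_real k)\<^sup>2 * \<zeta>\<^sup>2)" for \<zeta> :: complex
  define s where "s \<zeta> = \<sigma>\<^sub>0 * csqrt (q \<zeta>)" for \<zeta>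
  define D where "D = ball 0 1 \<inter> q -` (- \<real>\<^sub>\<le>\<^sub>0)"
  have D: "open D"
    unfolding D_def q_def by (intro open_Int open_vimage continuous_intros; auto)
  define Q where "Q = D \<times> {\<sigma>. Re (\<sigma> / \<sigma>\<^sub>0) > 0}"
  have Q: "open Q"
    unfolding Q_def using \<sigma>\<^sub>0 by (intro open_Times D open_Collect_less continuous_intros) auto
  have \<sigma>\<^sub>0_sq: "\<sigma>\<^sub>0\<^sup>2 = 1" "\<sigma>\<^sub>0 \<noteq> 0"
    using \<sigma>\<^sub>0 by auto
  have s: "s holomorphic_on D"
    unfolding s_def q_def by (intro holomorphic_intros) (auto simp: D_def q_def)
  have to: "fst r \<in> D \<and> r = (fst r, s (fst r))" if r: "r \<in> Q \<inter> inf_curve k" for r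
  proof -
    obtain \<zeta> \<sigma> where r_eq: "r = (\<zeta>, \<sigma>)"
      by (cases r)
    have "(\<sigma> / \<sigma>\<^sub>0)\<^sup>2 = q \<zeta>" "Re (\<sigma> / \<sigma>\<^sub>0) > 0"
      using r \<sigma>\<^sub>0_sq by (auto simp: r_eq q_def inf_curve_def power_divide Q_def)
    then have "csqrt (q \<zeta>) = \<sigma> / \<sigma>\<^sub>0"
      by (intro csqrt_unique) auto
    then show ?thesis
      using r \<sigma>\<^sub>0_sq by (simp add: r_eq s_def Q_def)
  qed
  have fro: "(z, s z) \<in> Q \<inter> inf_curve k" if "z \<in> D" for z
  proof -
    have "Re (csqrt (q z)) > 0"
      using that by (intro Re_csqrt_pos) (auto simp: D_def)
    then show ?thesis
      using that \<sigma>\<^sub>0_sq by (simp add: Q_def s_def inf_curve_def power_mult_distrib) (simp add: q_def)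
  qed
  let ?U = "glue_inf ` (Q \<inter> inf_curve k)"
  have image: "(\<lambda>z. glue_inf (z, s z)) ` D = ?U"
  proof (intro equalityI subsetI)
    fix p assume "p \<in> (\<lambda>z. glue_inf (z, s z)) ` D"
    then show "p \<in> ?U"
      using fro by blast
  next
    fix p assume "p \<in> ?U"
    then obtain r where r: "r \<in> Q \<inter> inf_curve k" "p = glue_inf r"
      by blast
    have "glue_inf r = glue_inf (fst r, s (fst r))"
      using to[OF r(1)] by (intro arg_cong[of _ _ glue_inf]) (rule conjunct2)
    then have "p = glue_inf (fst r, s (fst r))"
      by (simp only: r(2))
    then show "p \<in> (\<lambda>z. glue_inf (z, s z)) ` D"
      using to[OF r(1)] by (rule image_eqI[OF _ conjunct1])
  qed
  have "continuous_map (top_of_set D) (top_of_set (inf_curve k)) (\<lambda>z. (z, s z))"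
    using fro s by (auto simp: continuous_map_in_subtopology
        intro!: continuous_on_Pair holomorphic_on_imp_continuous_on)
  from continuous_map_compose[OF this continuous_map_glue_inf]
  have cont: "continuous_map (top_of_set D) (surf_topology k) (\<lambda>z. glue_inf (z, s z))"
    by (simp only: o_def)
  have \<phi>: "coord_zeta \<in> {coord_xi, coord_tau} \<and> ?U \<subseteq> glue_aff ` aff_curve k \<or>
      coord_zeta = coord_zeta \<and> ?U \<subseteq> glue_inf ` inf_curve k"
    by auto
  note chart = surf_chartI[OF surf_open_glue_inf[OF Q, of k] D \<phi> image _ cont]
  have inverse: "coord_zeta (glue_inf (z, s z)) = z" for z
    by simp
  have image2: "coord_zeta ` ?U = D"
    by (rule chart(2)) (rule inverse)
  show thesis
  proof (rule that)
    show "surf_chart k ?U coord_zeta"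
      by (rule chart(1)) (rule inverse)
    show "open (coord_zeta ` ?U)" "s holomorphic_on coord_zeta ` ?U"
      unfolding image2 by (intro D s)+
    show "\<forall>z\<in>coord_zeta ` ?U. norm z < 1 \<and> inv_into ?U coord_zeta z = glue_inf (z, s z)"
      unfolding image2
    proof
      fix z assume "z \<in> D"
      moreover from this have "inv_into ?U coord_zeta z = glue_inf (z, s z)"
        by (rule chart(3)[rotated]) (rule inverse)
      ultimately show "norm z < 1 \<and> inv_into ?U coord_zeta z = glue_inf (z, s z)"
        by (simp add: D_def)
    qed
    have "(0, \<sigma>\<^sub>0) \<in> Q \<inter> inf_curve k"
      using \<sigma>\<^sub>0_sq by (auto simp: Q_def D_def q_def inf_curve_def)
    then show "Infty \<sigma>\<^sub>0 \<in> ?U"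
      by (rule rev_image_eqI) simp
  qed
qed

section \<open>Coordinates on the sides and on the contour\<close>

text \<open>
  For \<open>a = \<i>\<close> this is the Cayley transform of \<open>\<xi>\<close>, and for \<open>a = -\<i>\<close> its reciprocal.  The parameter makes it
  possible to treat the two sides of the contour together: the half-plane under
  \<open>side k a\<close> contains \<open>a\<close>, and \<open>moebius_coord a\<close> maps it to the unit disc.
\<close>

fun moebius_coord :: "complex \<Rightarrow> point \<Rightarrow> complex" where
  "moebius_coord a (Aff \<xi> \<tau>) = (\<xi> - a) / (\<xi> + a)"
| "moebius_coord a (Infty \<sigma>) = 1"

text \<open>
  An odd function with respect to the exchange of the two sheets, which has no zeros on the contour.
  It serves to separate the values of a function on the two curves.
\<close>

fun eta :: "point \<Rightarrow> complex" where
  "eta (Aff \<xi> \<tau>) = \<tau> / (1 + \<xi>\<^sup>2)"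
| "eta (Infty \<sigma>) = \<sigma>"

text \<open>
  This is the product of \<open>eta\<close> and \<open>moebius_coord a\<close>.  The poles of \<open>eta\<close> are simple and lie over
  \<open>\<xi> = \<plusminus> \<i>\<close>; the second factor, which has a double zero at the branch point over \<open>\<xi> = a\<close>, removes the
  pole on \<open>side k a\<close>.
\<close>

fun twist :: "complex \<Rightarrow> point \<Rightarrow> complex" where
  "twist a (Aff \<xi> \<tau>) = \<tau> / (\<xi> + a)\<^sup>2"
| "twist a (Infty \<sigma>) = \<sigma>"

definition side :: "real \<Rightarrow> complex \<Rightarrow> point set" where
  "side k a = {p \<in> surf k. proj p \<in> Some ` {z. Re (z / a) > 0}}"

lemma side_plus: "side k \<i> = surf_plus k"
  by (simp add: side_def surf_plus_def)

lemma side_minus: "side k (-\<i>) = surf_minus k"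
  by (simp add: side_def surf_minus_def)

lemma moebius_coord_side:
  assumes "p \<in> side k a" "a \<in> {\<i>, -\<i>}"
  shows "norm (moebius_coord a p) < 1"
proof -
  obtain \<xi> \<tau> where p: "p = Aff \<xi> \<tau>" "Re (\<xi> / a) > 0"
    using assms(1) by (cases p) (auto simp: side_def)
  have "(norm (\<xi> - a))\<^sup>2 < (norm (\<xi> + a))\<^sup>2"
    using p(2) assms(2) by (auto simp: cmod_power2 power2_sum power2_diff)
  then have "norm (\<xi> - a) < norm (\<xi> + a)"
    by (rule power2_less_imp_less) simp
  then show ?thesis
    by (simp add: p(1) norm_divide divide_less_eq_1)
qed

lemma contour_cases:
  assumes "p \<in> contour k"
  obtains (affine) x \<tau> where "p = Aff (complex_of_real x) \<tau>" | (infinity) \<sigma> where "p = Infty \<sigma>" "\<sigma> = 1 \<or> \<sigma> = -1"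
  using assms by (auto simp: contour_eq contour1_def contour2_def)

lemma contour_nonzero:
  assumes "a \<in> {\<i>, -\<i>}"
  shows "complex_of_real x + a \<noteq> 0" "complex_of_real x - a \<noteq> 0" "1 + (complex_of_real x)\<^sup>2 \<noteq> 0"
    "1 + (complex_of_real x)\<^sup>2 = (complex_of_real x - a) * (complex_of_real x + a)"
proof -
  show "complex_of_real x + a \<noteq> 0" "complex_of_real x - a \<noteq> 0"
    using assms by (auto simp: complex_eq_iff)
  moreover show "1 + (complex_of_real x)\<^sup>2 = (complex_of_real x - a) * (complex_of_real x + a)"
    using assms by (auto simp: power2_eq_square algebra_simps)
  ultimately show "1 + (complex_of_real x)\<^sup>2 \<noteq> 0"
    by simp
qed

lemma moebius_coord_contour:
  assumes "p \<in> contour k" "a \<in> {\<i>, -\<i>}"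
  shows "moebius_coord a p \<in> unit_circle"
  using assms(1)
proof (cases rule: contour_cases)
  case (affine x \<tau>)
  have "norm (complex_of_real x - a) = norm (complex_of_real x + a)"
    using assms(2) by (auto simp: cmod_def)
  then show ?thesis
    using contour_nonzero[OF assms(2), of x] by (simp add: affine norm_divide)
qed simp

lemma moebius_coord_minus:
  "moebius_coord (-\<i>) p = inverse (moebius_coord \<i> p)"
  by (cases p) auto

lemma twist_contour:
  assumes "p \<in> contour k" "a \<in> {\<i>, -\<i>}"
  shows "twist a p = eta p * moebius_coord a p"
  using assms(1)
proof (cases rule: contour_cases)
  case (affine x \<tau>)
  show ?thesis
    using contour_nonzero[OF assms(2), of x] by (simp add: affine power2_eq_square)
qed simp

lemma moebius_coord_cayley: "moebius_coord \<i> p = cayley (proj p)"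
  by (cases p) auto

lemma inj_on_cayley: "inj_on cayley dot_real"
proof (rule inj_onI)
  fix u v
  assume uv: "u \<in> dot_real" "v \<in> dot_real" "cayley u = cayley v"
  have ne: "complex_of_real x + \<i> \<noteq> 0" for x
    by (auto simp: complex_eq_iff)
  have ne1: "cayley (Some (complex_of_real x)) \<noteq> 1" for x
    using ne[of x] by (simp add: divide_eq_eq)
  have "x = y" if "cayley (Some (complex_of_real x)) = cayley (Some (complex_of_real y))" for x y
  proof -
    have "(complex_of_real x - \<i>) * (complex_of_real y + \<i>) = (complex_of_real y - \<i>) * (complex_of_real x + \<i>)"
      using that ne[of x] ne[of y] by (simp add: frac_eq_eq)
    then show ?thesis
      by (simp add: complex_eq_iff)
  qed
  then show "u = v"
    using uv ne1 unfolding dot_real_def by (auto simp del: cayley.simps(2) dest: ne1[symmetric, THEN notE])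
qed

lemma cayley_image: "cayley ` dot_real = unit_circle"
proof (intro equalityI subsetI)
  fix z assume "z \<in> cayley ` dot_real"
  then obtain x where x: "z = cayley None \<or> z = cayley (Some (complex_of_real x))"
    by (auto simp: dot_real_def)
  have "norm (complex_of_real x - \<i>) = norm (complex_of_real x + \<i>)"
    by (simp add: cmod_def)
  moreover have "complex_of_real x + \<i> \<noteq> 0"
    by (auto simp: complex_eq_iff)
  ultimately show "z \<in> unit_circle"
    using x by (auto simp: norm_divide)
next
  fix z :: complex
  assume z: "z \<in> unit_circle"
  show "z \<in> cayley ` dot_real"
  proof (cases "z = 1")
    case True
    then show ?thesis
      by (intro image_eqI[of _ _ None]) (auto simp: dot_real_def)
  next
    case False
    define \<xi> where "\<xi> = \<i> * (1 + z) / (1 - z)"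
    have "z \<noteq> 0" "1 - z \<noteq> 0"
      using z False by auto
    have "cnj z = 1 / z"
      using inverse_unit_circle[OF z] by (simp add: inverse_eq_divide)
    then have "cnj \<xi> = - \<i> * (1 + 1 / z) / (1 - 1 / z)"
      by (simp add: \<xi>_def)
    also have "\<dots> = \<xi>"
      using \<open>z \<noteq> 0\<close> \<open>1 - z \<noteq> 0\<close> False by (simp add: \<xi>_def divide_simps) (simp add: algebra_simps)
    finally have "\<xi> \<in> \<real>"
      by (simp add: Reals_cnj_iff)
    then obtain x where x: "\<xi> = complex_of_real x"
      by (auto elim: Reals_cases)
    have "\<xi> - \<i> = 2 * \<i> * z / (1 - z)" "\<xi> + \<i> = 2 * \<i> / (1 - z)"
      using \<open>1 - z \<noteq> 0\<close> by (simp_all add: \<xi>_def divide_simps) (simp_all add: algebra_simps)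
    then have "(\<xi> - \<i>) / (\<xi> + \<i>) = z"
      using \<open>1 - z \<noteq> 0\<close> by simp
    then show ?thesis
      by (intro image_eqI[of _ _ "Some \<xi>"]) (auto simp: dot_real_def x)
  qed
qed

lemma holder_dot_real_iff:
  assumes X: "bij_betw proj X dot_real"
  shows "f \<circ> inv_into X proj \<in> holder_dot_real \<mu> \<longleftrightarrow>
    (\<exists>u\<in>holder_circle \<mu>. \<forall>p\<in>X. f p = u (moebius_coord \<i> p))"
proof
  assume "f \<circ> inv_into X proj \<in> holder_dot_real \<mu>"
  then obtain C where C: "\<And>x y. x \<in> dot_real \<Longrightarrow> y \<in> dot_real \<Longrightarrow>
      norm (f (inv_into X proj x) - f (inv_into X proj y)) \<le> C * norm (cayley x - cayley y) powr \<mu>"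
    by (auto simp: holder_dot_real_def)
  define u where "u z = f (inv_into X proj (inv_into dot_real cayley z))" for z
  have inv: "inv_into dot_real cayley z \<in> dot_real" "cayley (inv_into dot_real cayley z) = z"
    if "z \<in> unit_circle" for z
    using that cayley_image by (simp_all add: inv_into_into f_inv_into_f)
  have "u \<in> holder_circle \<mu>"
    using C[OF inv(1) inv(1)] by (intro holder_circleI[where C = C]) (simp add: u_def inv)
  moreover have "f p = u (moebius_coord \<i> p)" if "p \<in> X" for p
  proof -
    have "proj p \<in> dot_real"
      using X that by (auto simp: bij_betw_def)
    then show ?thesis
      using X that by (simp add: u_def moebius_coord_cayley inv_into_f_f inj_on_cayley bij_betw_def)
  qed
  ultimately show "\<exists>u\<in>holder_circle \<mu>. \<forall>p\<in>X. f p = u (moebius_coord \<i> p)"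
    by blast
next
  assume "\<exists>u\<in>holder_circle \<mu>. \<forall>p\<in>X. f p = u (moebius_coord \<i> p)"
  then obtain u where u: "u \<in> holder_circle \<mu>" "\<forall>p\<in>X. f p = u (moebius_coord \<i> p)"
    by blast
  have inv: "f (inv_into X proj x) = u (cayley x)" "cayley x \<in> unit_circle" if "x \<in> dot_real" for x
  proof -
    have "inv_into X proj x \<in> X" "proj (inv_into X proj x) = x"
      using X that by (auto simp: bij_betw_def inv_into_into f_inv_into_f)
    then show "f (inv_into X proj x) = u (cayley x)"
      using u(2) by (simp add: moebius_coord_cayley)
    show "cayley x \<in> unit_circle"
      using that cayley_image by blast
  qed
  obtain C where "\<forall>z\<in>unit_circle. \<forall>w\<in>unit_circle. norm (u z - u w) \<le> C * norm (z - w) powr \<mu>"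
    using u(1) unfolding holder_circle_def by blast
  then show "f \<circ> inv_into X proj \<in> holder_dot_real \<mu>"
    unfolding holder_dot_real_def using inv by (intro CollectI exI[of _ C]) simp
qed

text \<open>
  Both curves are identified with the unit circle by the Cayley transform; a function on the contour
  thus becomes a pair of functions on the circle.
\<close>

lemma holder_contour_iff:
  "f \<in> holder_contour k \<mu> \<longleftrightarrow>
    (\<exists>u1\<in>holder_circle \<mu>. \<exists>u2\<in>holder_circle \<mu>.
       (\<forall>p\<in>contour1 k. f p = u1 (moebius_coord \<i> p)) \<and> (\<forall>p\<in>contour2 k. f p = u2 (moebius_coord \<i> p)))"
  by (auto simp: holder_contour_def holder_dot_real_iff[OF bij_betw_proj_contour1]
      holder_dot_real_iff[OF bij_betw_proj_contour2])

lemma moebius_coord_onto: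
  assumes "bij_betw proj X dot_real" "z \<in> unit_circle"
  obtains p where "p \<in> X" "moebius_coord \<i> p = z"
proof -
  have "z \<in> cayley ` dot_real"
    using assms(2) by (simp only: cayley_image)
  then obtain x where "x \<in> dot_real" "cayley x = z"
    by blast
  have "x \<in> proj ` X"
    using assms(1) \<open>x \<in> dot_real\<close> by (simp add: bij_betw_def)
  then obtain p where "p \<in> X" "proj p = x"
    by blast
  then show thesis
    using \<open>cayley x = z\<close> by (intro that[of p]) (simp_all add: moebius_coord_cayley)
qed

text \<open>
  The values of \<open>eta\<close> on \<open>contour1\<close> in terms of the Cayley transform.  Written as a norm, the function
  is Lipschitz continuous by the triangle inequality.
\<close>

definition circle_eta :: "real \<Rightarrow> complex \<Rightarrow> real" where
  "circle_eta k z = norm (1 + z, of_real k * (1 - z)) / 2"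

lemma circle_eta_sq: "(circle_eta k z)\<^sup>2 = ((norm (1 + z))\<^sup>2 + k\<^sup>2 * (norm (1 - z))\<^sup>2) / 4"
  by (simp add: circle_eta_def norm_Pair power_divide norm_mult power_mult_distrib)

lemma circle_eta_nonneg: "circle_eta k z \<ge> 0"
  by (simp add: circle_eta_def)

text \<open>
  On the circle \<open>\<bar>1 + z\<bar>\<^sup>2 + \<bar>1 - z\<bar>\<^sup>2 = 4\<close>.
\<close>

lemma circle_eta_bounds:
  assumes k: "k > 1" and z: "z \<in> unit_circle"
  shows "1 \<le> circle_eta k z" "circle_eta k z \<le> k"
proof -
  have sum: "(norm (1 + z))\<^sup>2 + (norm (1 - z))\<^sup>2 = 4"
  proof -
    have "(norm z)\<^sup>2 = 1"
      using z by simp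
    then show ?thesis
      unfolding cmod_power2 by (simp add: power2_eq_square algebra_simps)
  qed
  have k2: "1 \<le> k\<^sup>2"
    using k by (simp add: one_le_power)
  have "1 * (norm (1 - z))\<^sup>2 \<le> k\<^sup>2 * (norm (1 - z))\<^sup>2"
    using k2 by (intro mult_right_mono) auto
  then have "1\<^sup>2 \<le> (circle_eta k z)\<^sup>2"
    unfolding circle_eta_sq using sum by simp
  then show "1 \<le> circle_eta k z"
    by (rule power2_le_imp_le) (rule circle_eta_nonneg)
  have "1 * (norm (1 + z))\<^sup>2 \<le> k\<^sup>2 * (norm (1 + z))\<^sup>2"
    using k2 by (intro mult_right_mono) auto
  moreover have "k\<^sup>2 * (norm (1 + z))\<^sup>2 + k\<^sup>2 * (norm (1 - z))\<^sup>2 = k\<^sup>2 * 4"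
    by (simp only: sum flip: distrib_left)
  ultimately have "(circle_eta k z)\<^sup>2 \<le> k\<^sup>2"
    unfolding circle_eta_sq by simp
  then show "circle_eta k z \<le> k"
    by (rule power2_le_imp_le) (use k in simp)
qed

lemma holder_circle_eta:
  assumes "k > 1" "0 < \<mu>" "\<mu> < 1"
  shows "(\<lambda>z. complex_of_real (circle_eta k z)) \<in> holder_circle \<mu>"
proof (rule holder_circle_lipschitz[OF assms(2,3), where L = "(1 + k) / 2"])
  fix z w :: complex
  have "norm (complex_of_real (circle_eta k z) - complex_of_real (circle_eta k w)) =
      \<bar>norm (1 + z, of_real k * (1 - z)) - norm (1 + w, of_real k * (1 - w))\<bar> / 2"
    by (simp add: circle_eta_def flip: of_real_diff diff_divide_distrib)
  also have "\<dots> \<le> norm ((1 + z, of_real k * (1 - z)) - (1 + w, of_real k * (1 - w))) / 2"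
    by (intro divide_right_mono norm_triangle_ineq3) simp
  also have "(1 + z, of_real k * (1 - z)) - (1 + w, of_real k * (1 - w)) = (z - w, of_real k * (w - z))"
    by (simp add: algebra_simps)
  also have "norm (z - w, of_real k * (w - z)) \<le> norm (z - w) + norm (of_real k * (w - z))"
    by (rule norm_Pair_le)
  also have "norm (of_real k * (w - z)) = k * norm (z - w)"
    using assms(1) by (simp add: norm_mult norm_minus_commute)
  also have "norm (z - w) + k * norm (z - w) = (1 + k) * norm (z - w)"
    by (simp add: distrib_right)
  finally show "norm (complex_of_real (circle_eta k z) - complex_of_real (circle_eta k w)) \<le>
      (1 + k) / 2 * norm (z - w)"
    by simp
qed (use assms in simp)

lemma tau_real_circle_eta:
  "tau_real k x / (1 + x\<^sup>2) = circle_eta k ((complex_of_real x - \<i>) / (complex_of_real x + \<i>))"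
proof -
  let ?z = "(complex_of_real x - \<i>) / (complex_of_real x + \<i>)"
  have nz: "complex_of_real x + \<i> \<noteq> 0"
    by (auto simp: complex_eq_iff)
  have pos: "1 + x\<^sup>2 > 0"
    by (simp add: add_pos_nonneg)
  have "(norm (complex_of_real x + \<i>))\<^sup>2 = 1 + x\<^sup>2"
    by (simp add: cmod_power2)
  moreover have "1 + ?z = 2 * complex_of_real x / (complex_of_real x + \<i>)"
    "1 - ?z = 2 * \<i> / (complex_of_real x + \<i>)"
    using nz by (simp_all add: field_simps)
  ultimately have norms: "(norm (1 + ?z))\<^sup>2 = 4 * x\<^sup>2 / (1 + x\<^sup>2)" "(norm (1 - ?z))\<^sup>2 = 4 / (1 + x\<^sup>2)"
    by (simp_all add: norm_divide norm_mult power_divide power_mult_distrib)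
  have "(4 * y / s + c * (4 / s)) / 4 = (y + c) / s" if "s > 0" for y s c :: real
    using that by (simp add: field_simps)
  then have "(circle_eta k ?z)\<^sup>2 = (x\<^sup>2 + k\<^sup>2) / (1 + x\<^sup>2)"
    unfolding circle_eta_sq norms using pos by blast
  moreover have "(tau_real k x / (1 + x\<^sup>2))\<^sup>2 = (x\<^sup>2 + k\<^sup>2) / (1 + x\<^sup>2)"
  proof -
    have "(tau_real k x)\<^sup>2 = (1 + x\<^sup>2) * (x\<^sup>2 + k\<^sup>2)"
      by (simp add: tau_real_def add.commute)
    then show ?thesis
      using pos by (simp add: power_divide power2_eq_square[of "1 + x\<^sup>2"])
  qed
  ultimately have "(tau_real k x / (1 + x\<^sup>2))\<^sup>2 = (circle_eta k ?z)\<^sup>2"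
    by (simp only:)
  moreover have "0 \<le> tau_real k x"
    unfolding tau_real_def by (intro real_sqrt_ge_zero mult_nonneg_nonneg add_nonneg_nonneg zero_le_power2 zero_le_one)
  then have "0 \<le> tau_real k x / (1 + x\<^sup>2)"
    using pos by (intro divide_nonneg_pos)
  ultimately show ?thesis
    by (rule power2_eq_imp_eq[OF _ _ circle_eta_nonneg])
qed

lemma eta_contour:
  shows "p \<in> contour1 k \<Longrightarrow> eta p = of_real (circle_eta k (moebius_coord \<i> p))"
    and "p \<in> contour2 k \<Longrightarrow> eta p = - of_real (circle_eta k (moebius_coord \<i> p))"
proof -
  have *: "complex_of_real (tau_real k x) / (1 + (complex_of_real x)\<^sup>2) =
      of_real (circle_eta k ((complex_of_real x - \<i>) / (complex_of_real x + \<i>)))" for x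
    unfolding tau_real_circle_eta[symmetric] by simp
  have "circle_eta k 1 = 1"
    by (simp add: circle_eta_def norm_Pair)
  with * show "p \<in> contour1 k \<Longrightarrow> eta p = of_real (circle_eta k (moebius_coord \<i> p))"
    and "p \<in> contour2 k \<Longrightarrow> eta p = - of_real (circle_eta k (moebius_coord \<i> p))"
    by (auto simp: contour1_def contour2_def)
qed

lemma moebius_coord_glue_inf:
  "moebius_coord a (glue_inf x) = (1 - a * fst x) / (1 + a * fst x)"
proof (cases "fst x = 0")
  case False
  have "(1 / fst x - a) / (1 / fst x + a) = ((1 - a * fst x) / fst x) / ((1 + a * fst x) / fst x)"
    using False by (simp add: field_simps)
  then show ?thesis
    using False by (simp add: glue_inf_eq)
qed (simp add: glue_inf_eq)

lemma twist_glue_inf: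
  "twist a (glue_inf x) = snd x / (1 + a * fst x)\<^sup>2"
proof (cases "fst x = 0")
  case False
  have "(1 / fst x + a)\<^sup>2 = (1 + a * fst x)\<^sup>2 / (fst x)\<^sup>2"
    using False by (simp add: add_divide_distrib flip: power_divide)
  then show ?thesis
    using False by (simp add: glue_inf_eq)
qed (simp add: glue_inf_eq)

lemma eta_glue_inf:
  "eta (glue_inf x) = snd x / (1 + (fst x)\<^sup>2)"
proof (cases "fst x = 0")
  case False
  have "1 + (1 / fst x)\<^sup>2 = (1 + (fst x)\<^sup>2) / (fst x)\<^sup>2"
    using False by (simp add: power_divide add_divide_distrib)
  then show ?thesis
    using False by (simp add: glue_inf_eq)
qed (simp add: glue_inf_eq)

text \<open>
  Both functions are continuous on the surface away from the point over \<open>\<xi> = -a\<close>.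
\<close>

lemma side_coords_continuous:
  assumes a: "a \<in> {\<i>, -\<i>}"
  shows "continuous_map (subtopology (surf_topology k) (side k a \<union> contour k)) euclidean (moebius_coord a)"
    and "continuous_map (subtopology (surf_topology k) (side k a \<union> contour k)) euclidean (twist a)"
proof -
  define V where "V = {p \<in> surf k. proj p \<noteq> Some (- a)}"
  have aff: "{x \<in> aff_curve k. glue_aff x \<in> V} = aff_curve k \<inter> {x. fst x + a \<noteq> 0}"
    by (auto simp: V_def glue_aff_eq surf_eq eq_neg_iff_add_eq_0)
  have inf: "{x \<in> inf_curve k. glue_inf x \<in> V} = inf_curve k \<inter> {x. 1 + a * fst x \<noteq> 0}"
  proof -
    have "glue_inf x \<in> V \<longleftrightarrow> 1 + a * fst x \<noteq> 0" if "x \<in> inf_curve k" for x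
    proof (cases "fst x = 0")
      case True
      then show ?thesis
        using that by (auto simp: V_def surf_def glue_inf_eq)
    next
      case False
      then have "1 / fst x + a = (1 + a * fst x) / fst x"
        by (simp add: add_divide_distrib)
      then have "1 / fst x = - a \<longleftrightarrow> 1 + a * fst x = 0"
        using False by (simp add: eq_neg_iff_add_eq_0)
      then show ?thesis
        using that False by (auto simp: V_def surf_def glue_inf_eq)
    qed
    then show ?thesis
      by blast
  qed
  have V: "surf_open k V"
    unfolding surf_open_def aff inf
    by (auto simp: V_def intro!: openin_open_Int open_Collect_neq continuous_intros)
  have moebius: "continuous_map (subtopology (surf_topology k) V) euclidean (moebius_coord a)"
  proof (rule continuous_map_on_surf_open[OF V])
    show "continuous_on {x \<in> aff_curve k. glue_aff x \<in> V} (\<lambda>x. moebius_coord a (glue_aff x))"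
      unfolding aff unfolding glue_aff_eq moebius_coord.simps by (intro continuous_intros) auto
    show "continuous_on {x \<in> inf_curve k. glue_inf x \<in> V} (\<lambda>x. moebius_coord a (glue_inf x))"
      unfolding inf moebius_coord_glue_inf by (intro continuous_intros) auto
  qed
  have twist: "continuous_map (subtopology (surf_topology k) V) euclidean (twist a)"
  proof (rule continuous_map_on_surf_open[OF V])
    show "continuous_on {x \<in> aff_curve k. glue_aff x \<in> V} (\<lambda>x. twist a (glue_aff x))"
      unfolding aff unfolding glue_aff_eq twist.simps by (intro continuous_intros) auto
    show "continuous_on {x \<in> inf_curve k. glue_inf x \<in> V} (\<lambda>x. twist a (glue_inf x))"
      unfolding inf twist_glue_inf by (intro continuous_intros) auto
  qed
  have "\<not> Re (- a / a) > 0" "- a \<noteq> complex_of_real x" for x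
    using a by (auto simp: complex_eq_iff)
  then have "side k a \<union> contour k \<subseteq> V"
    by (auto simp: V_def side_def contour_def dot_real_def simp del: minus_divide_left)
  then show "continuous_map (subtopology (surf_topology k) (side k a \<union> contour k)) euclidean (moebius_coord a)"
    and "continuous_map (subtopology (surf_topology k) (side k a \<union> contour k)) euclidean (twist a)"
    using moebius twist by (auto intro: continuous_map_from_subtopology_mono)
qed

section \<open>Invertible functions that extend to one side\<close>

definition side_exp :: "complex \<Rightarrow> (complex \<Rightarrow> complex) \<Rightarrow> (complex \<Rightarrow> complex) \<Rightarrow> point \<Rightarrow> complex" where
  "side_exp a A B p = exp (A (moebius_coord a p) + twist a p * B (moebius_coord a p))"

lemma continuous_map_complex_mult:
  fixes f g :: "'a \<Rightarrow> complex"
  assumes "continuous_map X euclidean f" "continuous_map X euclidean g"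
  shows "continuous_map X euclidean (\<lambda>x. f x * g x)"
  using assms by (auto simp: continuous_map_atin intro: tendsto_mult)

text \<open>
  The functions \<open>A\<close> and \<open>B\<close> are holomorphic on the open disc only, so that the charts have to stay over
  the half-plane that \<open>moebius_coord a\<close> maps to the disc.
\<close>

lemma side_exp_extends_analytically:
  assumes k: "k > 1" and a: "a \<in> {\<i>, -\<i>}" and A: "A \<in> disc_algebra \<mu>" and B: "B \<in> disc_algebra \<mu>"
  shows "extends_analytically k (side k a) (side_exp a A B)"
proof -
  let ?W = "subtopology (surf_topology k) (side k a \<union> contour k)"
  have "continuous_map ?W (top_of_set (cball 0 1)) (moebius_coord a)"
    using side_coords_continuous(1)[OF a, of k] moebius_coord_side[OF _ a] moebius_coord_contour[OF _ a]
    by (force simp: continuous_map_in_subtopology less_imp_le)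
  then have "continuous_map ?W euclidean (\<lambda>p. f (moebius_coord a p))" if "f \<in> disc_algebra \<mu>" for f
    using continuous_map_compose[of ?W "top_of_set (cball 0 1)" "moebius_coord a" euclidean f] that
    by (simp add: disc_algebra_def o_def)
  then have "continuous_map ?W euclidean (\<lambda>p. A (moebius_coord a p) + twist a p * B (moebius_coord a p))"
    using A B side_coords_continuous(2)[OF a, of k]
    by (intro continuous_map_add continuous_map_complex_mult) auto
  from continuous_map_compose[OF this, of euclidean exp]
  have cont: "continuous_map ?W euclidean (side_exp a A B)"
    by (simp add: side_exp_def[abs_def] o_def continuous_on_exp)
  have "\<exists>U \<phi>. surf_chart k U \<phi> \<and> p \<in> U \<and> (side_exp a A B \<circ> inv_into U \<phi>) holomorphic_on \<phi> ` U"
    if p: "p \<in> side k a" for p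
  proof -
    obtain \<xi>\<^sub>0 \<tau>\<^sub>0 where p_eq: "p = Aff \<xi>\<^sub>0 \<tau>\<^sub>0" "(\<xi>\<^sub>0, \<tau>\<^sub>0) \<in> aff_curve k" "Re (\<xi>\<^sub>0 / a) > 0"
      using p by (auto simp: side_def surf_eq)
    define N where "N = {\<xi>. Re (\<xi> / a) > 0}"
    have "open N" "\<xi>\<^sub>0 \<in> N"
      using p_eq(3) a unfolding N_def by (auto intro!: open_Collect_less continuous_intros)
    then obtain U \<phi> x t where U: "surf_chart k U \<phi>" "Aff \<xi>\<^sub>0 \<tau>\<^sub>0 \<in> U" "open (\<phi> ` U)"
      "x holomorphic_on \<phi> ` U" "t holomorphic_on \<phi> ` U"
      "\<forall>z\<in>\<phi> ` U. x z \<in> N \<and> inv_into U \<phi> z = Aff (x z) (t z)"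
      by (rule affine_chart_exists[OF k p_eq(2)])
    have nz: "x z + a \<noteq> 0" if "z \<in> \<phi> ` U" for z
    proof
      assume "x z + a = 0"
      then have "x z = - a"
        by (simp add: eq_neg_iff_add_eq_0)
      then show False
        using U(6) that a by (auto simp: N_def)
    qed
    have w: "(\<lambda>z. (x z - a) / (x z + a)) holomorphic_on \<phi> ` U"
      using nz U by (intro holomorphic_intros) auto
    have in_ball: "(x z - a) / (x z + a) \<in> ball 0 1" if "z \<in> \<phi> ` U" for z
    proof -
      have "inv_into U \<phi> z \<in> surf k"
        using inv_into_into[OF that] U(1) by (auto simp: surf_chart_def openin_surf_topology surf_open_def)
      then have "Aff (x z) (t z) \<in> side k a"
        using U(6) that by (auto simp: side_def N_def)
      from moebius_coord_side[OF this a] show ?thesis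
        by simp
    qed
    have comp: "(\<lambda>z. f ((x z - a) / (x z + a))) holomorphic_on \<phi> ` U" if "f \<in> disc_algebra \<mu>" for f
    proof -
      have "(\<lambda>z. (x z - a) / (x z + a)) ` \<phi> ` U \<subseteq> ball 0 1"
        using in_ball by blast
      moreover have "f holomorphic_on ball 0 1"
        using that by (simp add: disc_algebra_def)
      ultimately show ?thesis
        using holomorphic_on_compose_gen[OF w, of f "ball 0 1"] by (simp add: o_def)
    qed
    have "(\<lambda>z. exp (A ((x z - a) / (x z + a)) + t z / (x z + a)\<^sup>2 * B ((x z - a) / (x z + a)))) holomorphic_on \<phi> ` U"
      using nz U by (intro holomorphic_intros comp A B) auto
    then have "(side_exp a A B \<circ> inv_into U \<phi>) holomorphic_on \<phi> ` U"
      by (rule holomorphic_transform) (simp add: side_exp_def U(6))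
    then show ?thesis
      using U p_eq by blast
  qed
  then show ?thesis
    using cont unfolding extends_analytically_def surf_holomorphic_on_def by blast
qed

lemma side_exp_holder:
  assumes k: "k > 1" and \<mu>: "0 < \<mu>" "\<mu> < 1" and a: "a \<in> {\<i>, -\<i>}"
    and A: "A \<in> disc_algebra \<mu>" and B: "B \<in> disc_algebra \<mu>"
  shows "side_exp a A B \<in> holder_contour k \<mu>"
proof -
  define m where "m z = (if a = \<i> then z else inverse z)" for z :: complex
  have m: "moebius_coord a p = m (moebius_coord \<i> p)" for p
    using a by (auto simp: m_def moebius_coord_minus)
  have m_holder: "(\<lambda>z. f (m z)) \<in> holder_circle \<mu>" if "f \<in> holder_circle \<mu>" for f
    using that holder_circle_reflect[OF that] by (cases "a = \<i>") (simp_all add: m_def)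
  define u where "u s z = exp (A (m z) + (s * of_real (circle_eta k z) * m z) * B (m z))" for s z
  have u: "u s \<in> holder_circle \<mu>" for s
  proof -
    have A': "(\<lambda>z. A (m z)) \<in> holder_circle \<mu>" and B': "(\<lambda>z. B (m z)) \<in> holder_circle \<mu>"
      using A B by (auto intro: m_holder simp: disc_algebra_def)
    have eta: "(\<lambda>z. s * of_real (circle_eta k z)) \<in> holder_circle \<mu>"
      by (rule holder_circle_mult[OF holder_circle_const holder_circle_eta[OF k \<mu>] \<mu>(1)])
    note m = m_holder[OF holder_circle_id[OF \<mu>]]
    note mult = holder_circle_mult[OF _ _ \<mu>(1)]
    show ?thesis
      unfolding u_def by (rule holder_circle_exp[OF holder_circle_add[OF A' mult[OF mult[OF eta m] B']] \<mu>(1)])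
  qed
  have "side_exp a A B p = u 1 (moebius_coord \<i> p)" if "p \<in> contour1 k" for p
    using that by (simp add: side_exp_def u_def twist_contour[OF _ a, of p k] contour_eq eta_contour(1) m)
  moreover have "side_exp a A B p = u (-1) (moebius_coord \<i> p)" if "p \<in> contour2 k" for p
    using that by (simp add: side_exp_def u_def twist_contour[OF _ a, of p k] contour_eq eta_contour(2) m)
  ultimately show ?thesis
    unfolding holder_contour_iff using u by blast
qed

lemma side_exp_unit:
  assumes "k > 1" "0 < \<mu>" "\<mu> < 1" "a \<in> {\<i>, -\<i>}" "A \<in> disc_algebra \<mu>" "B \<in> disc_algebra \<mu>"
  shows "side_exp a A B \<in> units_on (contour k)
    {f \<in> holder_contour k \<mu>. extends_analytically k (side k a) f}"
proof -
  have inverse: "side_exp a A B p * side_exp a (\<lambda>z. - A z) (\<lambda>z. - B z) p = 1" for p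
    by (simp add: side_exp_def flip: exp_add)
  show ?thesis
    unfolding units_on_def
    using assms side_exp_holder[OF assms(1-4)] side_exp_extends_analytically[OF assms(1,4)]
      disc_algebra_uminus[OF assms(5)] disc_algebra_uminus[OF assms(6)] inverse
    by blast
qed

section \<open>Rational functions with poles over two points\<close>

text \<open>
  The generators are holomorphic on the surface except at the points over \<open>\<xi> = \<plusminus> \<i>\<close>.  An inductive
  definition reduces the statements about poles to these generators.
\<close>

inductive_set rational_algebra :: "(point \<Rightarrow> complex) set" where
  const: "(\<lambda>_. c) \<in> rational_algebra"
| moebius: "a \<in> {\<i>, -\<i>} \<Longrightarrow> moebius_coord a \<in> rational_algebra"
| eta: "eta \<in> rational_algebra"
| add: "r \<in> rational_algebra \<Longrightarrow> q \<in> rational_algebra \<Longrightarrow> (\<lambda>p. r p + q p) \<in> rational_algebra"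
| mult: "r \<in> rational_algebra \<Longrightarrow> q \<in> rational_algebra \<Longrightarrow> (\<lambda>p. r p * q p) \<in> rational_algebra"

lemma rational_algebra_power: "r \<in> rational_algebra \<Longrightarrow> (\<lambda>p. r p ^ n) \<in> rational_algebra"
  by (induction n) (auto intro: rational_algebra.const rational_algebra.mult)

lemma rational_algebra_meromorphic_affine:
  assumes "r \<in> rational_algebra" and "open D" "x holomorphic_on D" "t holomorphic_on D"
  shows "(\<lambda>z. r (Aff (x z) (t z))) meromorphic_on D"
proof -
  have xt: "x meromorphic_on D" "t meromorphic_on D"
    using assms by (auto intro!: analytic_on_imp_meromorphic_on simp: analytic_on_open)
  show ?thesis
    using assms(1)
  proof induction
    case (moebius a)
    show ?case
      unfolding moebius_coord.simps by (intro meromorphic_intros xt)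
  next
    case eta
    show ?case
      unfolding eta.simps by (intro meromorphic_intros xt)
  qed (auto intro!: meromorphic_intros)
qed

lemma rational_algebra_holomorphic_affine:
  assumes "r \<in> rational_algebra" and "x holomorphic_on D" "t holomorphic_on D"
    and "\<And>z. z \<in> D \<Longrightarrow> \<bar>Im (x z)\<bar> < 1"
  shows "(\<lambda>z. r (Aff (x z) (t z))) holomorphic_on D"
proof -
  have nz: "x z + a \<noteq> 0" if "a \<in> {\<i>, -\<i>}" "z \<in> D" for a z
    using that assms(4)[of z] by (auto simp: complex_eq_iff)
  have "1 + (x z)\<^sup>2 = (x z + \<i>) * (x z + -\<i>)" for z
    by (simp add: power2_eq_square algebra_simps)
  then have nz2: "1 + (x z)\<^sup>2 \<noteq> 0" if "z \<in> D" for z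
    using nz[of "\<i>", OF _ that] nz[of "-\<i>", OF _ that] by simp
  show ?thesis
    using assms(1)
  proof induction
    case (moebius a)
    then show ?case
      using nz assms by (auto intro!: holomorphic_intros)
  next
    case eta
    show ?case
      using nz2 assms by (auto intro!: holomorphic_intros)
  qed (auto intro!: holomorphic_intros)
qed

lemma rational_algebra_holomorphic_infinity:
  assumes "r \<in> rational_algebra" and "s holomorphic_on D" and "\<And>z. z \<in> D \<Longrightarrow> norm z < 1"
  shows "(\<lambda>z. r (glue_inf (z, s z))) holomorphic_on D"
proof -
  have nz: "1 + a * z \<noteq> 0" if "a \<in> {\<i>, -\<i>}" "z \<in> D" for a z
  proof
    assume "1 + a * z = 0"
    then have "norm (a * z) = 1"
      by (metis add_eq_0_iff norm_minus_cancel norm_one)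
    then show False
      using that assms(3)[of z] by (auto simp: norm_mult)
  qed
  have "1 + z\<^sup>2 = (1 + \<i> * z) * (1 + (-\<i>) * z)" for z :: complex
    by (simp add: power2_eq_square algebra_simps)
  then have nz2: "1 + z\<^sup>2 \<noteq> 0" if "z \<in> D" for z
    using nz[of "\<i>", OF _ that] nz[of "-\<i>", OF _ that] by simp
  show ?thesis
    using assms(1)
  proof induction
    case (moebius a)
    then show ?case
      unfolding moebius_coord_glue_inf fst_conv using nz by (intro holomorphic_intros) auto
  next
    case eta
    show ?case
      unfolding eta_glue_inf fst_conv snd_conv using nz2 assms by (intro holomorphic_intros) auto
  qed (auto intro!: holomorphic_intros)
qed

lemma rational_algebra_no_poles:
  assumes k: "k > 1" and r: "r \<in> rational_algebra"
  shows "r \<in> rational_no_poles k"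
proof -
  have at_infinity: "\<exists>U \<phi>. surf_chart k U \<phi> \<and> Infty \<sigma> \<in> U \<and> open (\<phi> ` U) \<and>
      (r \<circ> inv_into U \<phi>) holomorphic_on \<phi> ` U" if \<sigma>: "\<sigma> = 1 \<or> \<sigma> = -1" for \<sigma>
  proof -
    obtain U s where U: "surf_chart k U coord_zeta" "Infty \<sigma> \<in> U" "open (coord_zeta ` U)"
      "s holomorphic_on coord_zeta ` U"
      "\<forall>z\<in>coord_zeta ` U. norm z < 1 \<and> inv_into U coord_zeta z = glue_inf (z, s z)"
      by (rule infinity_chart_exists[OF \<sigma>])
    have "(\<lambda>z. r (glue_inf (z, s z))) holomorphic_on coord_zeta ` U"
      using U by (intro rational_algebra_holomorphic_infinity[OF r]) auto
    then have "(r \<circ> inv_into U coord_zeta) holomorphic_on coord_zeta ` U"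
      by (rule holomorphic_transform) (simp add: U(5))
    then show ?thesis
      using U by blast
  qed
  have "\<exists>U \<phi>. surf_chart k U \<phi> \<and> p \<in> U \<and> (r \<circ> inv_into U \<phi>) meromorphic_on \<phi> ` U"
    if "p \<in> surf k" for p
  proof (cases p)
    case (Aff \<xi>\<^sub>0 \<tau>\<^sub>0)
    then have "(\<xi>\<^sub>0, \<tau>\<^sub>0) \<in> aff_curve k"
      using that by (auto simp: surf_eq)
    from affine_chart_exists[OF k this open_UNIV UNIV_I]
    obtain U \<phi> x t where U: "surf_chart k U \<phi>" "Aff \<xi>\<^sub>0 \<tau>\<^sub>0 \<in> U" "open (\<phi> ` U)"
      "x holomorphic_on \<phi> ` U" "t holomorphic_on \<phi> ` U"
      "\<forall>z\<in>\<phi> ` U. x z \<in> UNIV \<and> inv_into U \<phi> z = Aff (x z) (t z)"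
      by metis
    have "(\<lambda>z. r (Aff (x z) (t z))) meromorphic_on \<phi> ` U"
      using U by (intro rational_algebra_meromorphic_affine[OF r])
    moreover have "(r \<circ> inv_into U \<phi>) meromorphic_on \<phi> ` U \<longleftrightarrow> (\<lambda>z. r (Aff (x z) (t z))) meromorphic_on \<phi> ` U"
    proof (rule meromorphic_on_cong)
      fix z assume "z \<in> \<phi> ` U"
      then have "eventually (\<lambda>w. w \<in> \<phi> ` U) (at z)"
        using U(3) by (intro eventually_at_in_open') auto
      then show "eventually (\<lambda>w. (r \<circ> inv_into U \<phi>) w = r (Aff (x w) (t w))) (at z)"
        by eventually_elim (simp add: U(6))
    qed simp
    ultimately show ?thesis
      using U Aff by blast
  next
    case (Infty \<sigma>)
    then have "\<sigma> = 1 \<or> \<sigma> = -1"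
      using that by (auto simp: surf_eq)
    from at_infinity[OF this] show ?thesis
      unfolding Infty by (metis analytic_on_imp_meromorphic_on analytic_on_open)
  qed
  moreover have "\<exists>U \<phi>. surf_chart k U \<phi> \<and> p \<in> U \<and> (r \<circ> inv_into U \<phi>) holomorphic_on \<phi> ` U"
    if p: "p \<in> contour k" for p
    using p
  proof (cases rule: contour_cases)
    case (affine x\<^sub>0 \<tau>\<^sub>0)
    have *: "(complex_of_real x\<^sub>0, \<tau>\<^sub>0) \<in> aff_curve k"
      using p by (auto simp: contour_def surf_eq affine)
    define N where "N = {\<xi>. \<bar>Im \<xi>\<bar> < 1}"
    have "open N" "complex_of_real x\<^sub>0 \<in> N"
      unfolding N_def by (auto intro!: open_Collect_less continuous_intros)
    then obtain U \<phi> x t where U: "surf_chart k U \<phi>" "Aff x\<^sub>0 \<tau>\<^sub>0 \<in> U" "open (\<phi> ` U)"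
      "x holomorphic_on \<phi> ` U" "t holomorphic_on \<phi> ` U"
      "\<forall>z\<in>\<phi> ` U. x z \<in> N \<and> inv_into U \<phi> z = Aff (x z) (t z)"
      by (rule affine_chart_exists[OF k *])
    have "(\<lambda>z. r (Aff (x z) (t z))) holomorphic_on \<phi> ` U"
      using U by (intro rational_algebra_holomorphic_affine[OF r]) (auto simp: N_def)
    then have "(r \<circ> inv_into U \<phi>) holomorphic_on \<phi> ` U"
      by (rule holomorphic_transform) (simp add: U(6))
    then show ?thesis
      using U affine by blast
  next
    case (infinity \<sigma>)
    then show ?thesis
      using at_infinity[OF infinity(2)] by blast
  qed
  ultimately show ?thesis
    by (simp add: rational_no_poles_def surf_meromorphic_on_def surf_holomorphic_on_def)
qed

section \<open>Factorizations with exponential outer factors\<close>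

text \<open>
  A factorization in which the outer factors are exponentials of functions that extend to one side.
  Such factors are invertible, and products of factorizations of this form are again of this form.
\<close>

definition factorable :: "real \<Rightarrow> real \<Rightarrow> (point \<Rightarrow> complex) \<Rightarrow> bool" where
  "factorable k \<mu> f \<longleftrightarrow>
     (\<exists>A1\<in>disc_algebra \<mu>. \<exists>B1\<in>disc_algebra \<mu>. \<exists>A2\<in>disc_algebra \<mu>. \<exists>B2\<in>disc_algebra \<mu>.
      \<exists>r\<in>rational_algebra. \<forall>p\<in>contour k. f p = side_exp (-\<i>) A1 B1 p * r p * side_exp \<i> A2 B2 p)"

lemma factorable_imp_surf_factorization:
  assumes "k > 1" "0 < \<mu>" "\<mu> < 1" and "factorable k \<mu> f"
  shows "has_surf_factorization k \<mu> f"
proof -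
  obtain A1 B1 A2 B2 r where *: "A1 \<in> disc_algebra \<mu>" "B1 \<in> disc_algebra \<mu>" "A2 \<in> disc_algebra \<mu>"
    "B2 \<in> disc_algebra \<mu>" "r \<in> rational_algebra"
    "\<forall>p\<in>contour k. f p = side_exp (-\<i>) A1 B1 p * r p * side_exp \<i> A2 B2 p"
    using assms(4) unfolding factorable_def by blast
  have "side_exp (-\<i>) A1 B1 \<in> units_on (contour k) (holder_contour_minus k \<mu>)"
    using side_exp_unit[OF assms(1-3), of "-\<i>" A1 B1] * by (simp add: side_minus holder_contour_minus_def)
  moreover have "side_exp \<i> A2 B2 \<in> units_on (contour k) (holder_contour_plus k \<mu>)"
    using side_exp_unit[OF assms(1-3), of \<i> A2 B2] * by (simp add: side_plus holder_contour_plus_def)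
  moreover have "r \<in> rational_no_poles k"
    using rational_algebra_no_poles[OF assms(1)] * by blast
  ultimately show ?thesis
    using *(6) unfolding has_surf_factorization_def by blast
qed

lemma side_exp_add:
  "side_exp a A B p * side_exp a A' B' p = side_exp a (\<lambda>z. A z + A' z) (\<lambda>z. B z + B' z) p"
  by (simp add: side_exp_def algebra_simps flip: exp_add)

lemma factorable_mult:
  assumes "factorable k \<mu> f" "factorable k \<mu> g"
  shows "factorable k \<mu> (\<lambda>p. f p * g p)"
proof -
  obtain A1 B1 A2 B2 r where *: "A1 \<in> disc_algebra \<mu>" "B1 \<in> disc_algebra \<mu>" "A2 \<in> disc_algebra \<mu>"
    "B2 \<in> disc_algebra \<mu>" "r \<in> rational_algebra"
    "\<forall>p\<in>contour k. f p = side_exp (-\<i>) A1 B1 p * r p * side_exp \<i> A2 B2 p"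
    using assms(1) unfolding factorable_def by blast
  obtain A1' B1' A2' B2' r' where **: "A1' \<in> disc_algebra \<mu>" "B1' \<in> disc_algebra \<mu>" "A2' \<in> disc_algebra \<mu>"
    "B2' \<in> disc_algebra \<mu>" "r' \<in> rational_algebra"
    "\<forall>p\<in>contour k. g p = side_exp (-\<i>) A1' B1' p * r' p * side_exp \<i> A2' B2' p"
    using assms(2) unfolding factorable_def by blast
  have "f p * g p = side_exp (-\<i>) (\<lambda>z. A1 z + A1' z) (\<lambda>z. B1 z + B1' z) p * (r p * r' p) *
      side_exp \<i> (\<lambda>z. A2 z + A2' z) (\<lambda>z. B2 z + B2' z) p" if "p \<in> contour k" for p
    using that *(6) **(6) by (simp add: mult_ac flip: side_exp_add)
  moreover note disc_algebra_add[OF *(1) **(1)] disc_algebra_add[OF *(2) **(2)]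
    disc_algebra_add[OF *(3) **(3)] disc_algebra_add[OF *(4) **(4)] rational_algebra.mult[OF *(5) **(5)]
  ultimately show ?thesis
    unfolding factorable_def by (intro bexI ballI)
qed

lemma factorable_cong:
  assumes "factorable k \<mu> f" "\<And>p. p \<in> contour k \<Longrightarrow> f p = g p"
  shows "factorable k \<mu> g"
  using assms unfolding factorable_def by simp

lemma factorable_side_exp:
  assumes "A1 \<in> disc_algebra \<mu>" "B1 \<in> disc_algebra \<mu>" "A2 \<in> disc_algebra \<mu>" "B2 \<in> disc_algebra \<mu>"
  shows "factorable k \<mu> (\<lambda>p. side_exp (-\<i>) A1 B1 p * side_exp \<i> A2 B2 p)"
proof -
  have "\<forall>p\<in>contour k. side_exp (-\<i>) A1 B1 p * side_exp \<i> A2 B2 p =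
      side_exp (-\<i>) A1 B1 p * 1 * side_exp \<i> A2 B2 p"
    by simp
  then show ?thesis
    unfolding factorable_def using assms rational_algebra.const[of 1]
    by (intro bexI[of _ A1] bexI[of _ B1] bexI[of _ A2] bexI[of _ B2] bexI[of _ "\<lambda>_. 1"])
qed

lemma factorable_rational:
  assumes "r \<in> rational_algebra"
  shows "factorable k \<mu> r"
proof -
  have "\<forall>p\<in>contour k. r p = side_exp (-\<i>) (\<lambda>_. 0) (\<lambda>_. 0) p * r p * side_exp \<i> (\<lambda>_. 0) (\<lambda>_. 0) p"
    by (simp add: side_exp_def)
  then show ?thesis
    unfolding factorable_def using assms disc_algebra_const[of 0] by blast
qed

lemma factorable_power:
  assumes "factorable k \<mu> f"
  shows "factorable k \<mu> (\<lambda>p. f p ^ n)"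
proof (induction n)
  case 0
  then show ?case
    using factorable_rational[OF rational_algebra.const[of 1]] by simp
next
  case (Suc n)
  then show ?case
    using factorable_mult[OF assms Suc] by simp
qed

section \<open>The obstruction to the additive decomposition\<close>

text \<open>
  As \<open>d\<theta> / circle_eta = 2 dx / tau_real\<close> under the Cayley transform, this is the integral of \<open>g1 - g2\<close>
  against \<open>dx / (2 * pi * tau_real)\<close>, that is, the pairing of the function on the contour with the
  holomorphic differential \<open>d\<xi> / \<tau>\<close>, up to a constant factor.  A sum of functions that extend to one of
  the sides pairs to zero by Cauchy's theorem.
\<close>

definition obstruction :: "real \<Rightarrow> (complex \<Rightarrow> complex) \<Rightarrow> (complex \<Rightarrow> complex) \<Rightarrow> complex" where
  "obstruction k g1 g2 = circle_mean (\<lambda>z. (g1 z - g2 z) / (2 * of_real (circle_eta k z)))"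

text \<open>
  Write \<open>G = a + eta * b\<close> with functions \<open>a\<close> and \<open>b\<close> of \<open>w = moebius_coord \<i>\<close> and decompose both on
  the circle.  For \<open>a\<close> all three terms extend to a side.  For \<open>b\<close> the term \<open>eta * w * B w\<close> extends to the
  upper side and \<open>eta * (1 / w) * B' (1 / w)\<close> to the lower one, because the factors \<open>w\<close> and \<open>1 / w\<close> cancel
  the poles of \<open>eta\<close>.  Only \<open>circle_mean b * eta\<close> is left over, which has poles on both sides.
\<close>

lemma additive_decomposition_contour:
  assumes k: "k > 1" and \<mu>: "0 < \<mu>" "\<mu> < 1"
    and g: "g1 \<in> holder_circle \<mu>" "g2 \<in> holder_circle \<mu>"
    and G: "\<And>p. p \<in> contour1 k \<Longrightarrow> G p = g1 (moebius_coord \<i> p)"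
      "\<And>p. p \<in> contour2 k \<Longrightarrow> G p = g2 (moebius_coord \<i> p)"
  obtains A1 B1 A2 B2 where "A1 \<in> disc_algebra \<mu>" "B1 \<in> disc_algebra \<mu>"
    "A2 \<in> disc_algebra \<mu>" "B2 \<in> disc_algebra \<mu>"
    "\<forall>p\<in>contour k. exp (G p) =
       side_exp (-\<i>) A1 B1 p * side_exp \<i> A2 B2 p * exp (obstruction k g1 g2 * eta p)"
proof -
  note mult = holder_circle_mult[OF _ _ \<mu>(1)]
  define a where "a z = (1 / 2) * (g1 z + g2 z)" for z
  define b where "b z = (g1 z - g2 z) / (2 * of_real (circle_eta k z))" for z
  have a: "a \<in> holder_circle \<mu>"
    unfolding a_def by (intro mult holder_circle_const holder_circle_add g)
  have b: "b \<in> holder_circle \<mu>"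
  proof -
    have "(\<lambda>z. 2 * complex_of_real (circle_eta k z)) \<in> holder_circle \<mu>"
      by (rule mult[OF holder_circle_const holder_circle_eta[OF k \<mu>]])
    moreover have "2 \<le> norm (2 * complex_of_real (circle_eta k z))" if "z \<in> unit_circle" for z
      using circle_eta_bounds[OF k that] by (simp add: norm_mult)
    ultimately have "(\<lambda>z. inverse (2 * complex_of_real (circle_eta k z))) \<in> holder_circle \<mu>"
      by (intro holder_circle_inverse[where m = 2]) auto
    from mult[OF holder_circle_diff[OF g] this] show ?thesis
      by (simp only: b_def[abs_def] divide_inverse)
  qed
  obtain A A' where A: "A \<in> disc_algebra \<mu>" "A' \<in> disc_algebra \<mu>"
    "\<forall>z\<in>unit_circle. a z = circle_mean a + z * A z + inverse z * A' (inverse z)"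
    by (rule additive_decomposition_circle[OF a \<mu>])
  obtain B B' where B: "B \<in> disc_algebra \<mu>" "B' \<in> disc_algebra \<mu>"
    "\<forall>z\<in>unit_circle. b z = circle_mean b + z * B z + inverse z * B' (inverse z)"
    by (rule additive_decomposition_circle[OF b \<mu>])
  show thesis
  proof (rule that)
    show "(\<lambda>z. z * A' z) \<in> disc_algebra \<mu>" "B' \<in> disc_algebra \<mu>"
      "(\<lambda>z. circle_mean a + z * A z) \<in> disc_algebra \<mu>" "B \<in> disc_algebra \<mu>"
      using A B \<mu> by (auto intro: disc_algebra_mult_z disc_algebra_add disc_algebra_const)
    show "\<forall>p\<in>contour k. exp (G p) = side_exp (-\<i>) (\<lambda>z. z * A' z) B' p *
        side_exp \<i> (\<lambda>z. circle_mean a + z * A z) B p * exp (obstruction k g1 g2 * eta p)"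
    proof
      fix p assume p: "p \<in> contour k"
      define z where "z = moebius_coord \<i> p"
      have z: "z \<in> unit_circle"
        unfolding z_def by (rule moebius_coord_contour[OF p]) simp
      have "circle_eta k z \<noteq> 0"
        using circle_eta_bounds(1)[OF k z] by auto
      then have "G p = a z + eta p * b z"
        using p G[of p] eta_contour[of p k] unfolding contour_eq
        by (auto simp: a_def b_def simp flip: z_def) (simp_all add: field_simps)
      also have "\<dots> = (inverse z * A' (inverse z) + eta p * inverse z * B' (inverse z)) +
          ((circle_mean a + z * A z) + eta p * z * B z) + circle_mean b * eta p"
        using A(3)[rule_format, OF z] B(3)[rule_format, OF z] by (simp add: algebra_simps)
      finally have "exp (G p) = exp (inverse z * A' (inverse z) + eta p * inverse z * B' (inverse z)) *
          exp ((circle_mean a + z * A z) + eta p * z * B z) * exp (circle_mean b * eta p)"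
        by (simp only: exp_add)
      moreover have "obstruction k g1 g2 = circle_mean b"
        by (simp add: obstruction_def b_def[abs_def])
      ultimately show "exp (G p) = side_exp (-\<i>) (\<lambda>z. z * A' z) B' p *
          side_exp \<i> (\<lambda>z. circle_mean a + z * A z) B p * exp (obstruction k g1 g2 * eta p)"
        using p by (simp add: side_exp_def twist_contour moebius_coord_minus flip: z_def)
    qed
  qed
qed

text \<open>
  The rational function \<open>1 + t * eta\<close> is its own factorization.  The decomposition of its logarithm
  shows that \<open>exp (C t * eta)\<close> is factorable, where \<open>C t\<close> is the obstruction of the logarithm.
  As \<open>C\<close> is holomorphic with \<open>C 0 = 0\<close> and \<open>C' 0 = 1\<close>, its values cover a neighbourhood of \<open>0\<close>.
\<close>

lemma exp_small_eta_factorable: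
  assumes k: "k > 1" and \<mu>: "0 < \<mu>" "\<mu> < 1"
  obtains \<delta> where "\<delta> > 0" "\<forall>c. norm c < \<delta> \<longrightarrow> factorable k \<mu> (\<lambda>p. exp (c * eta p))"
proof -
  define E where "E z = complex_of_real (circle_eta k z)" for z
  \<comment> \<open>As \<open>\<bar>eta\<bar> \<le> k\<close> on the contour, this radius keeps \<open>1 + t *
    eta\<close> away from the cut of the logarithm.\<close>
  define \<rho> where "\<rho> = 1 / (2 * k)"
  have \<rho>: "\<rho> > 0"
    using k by (simp add: \<rho>_def)
  have E: "E \<in> holder_circle \<mu>"
    unfolding E_def by (rule holder_circle_eta[OF k \<mu>])
  have E_cont: "continuous_on unit_circle E"
    by (rule holder_circle_continuous[OF E \<mu>(1)])
  have E_nz: "E z \<noteq> 0" if "z \<in> unit_circle" for z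
    using circle_eta_bounds(1)[OF k that] by (auto simp: E_def)
  have small: "norm (t * E z) \<le> 1 / 2" if "t \<in> ball 0 \<rho>" "z \<in> unit_circle" for t z
  proof -
    have "norm (t * E z) \<le> \<rho> * k"
      using that circle_eta_bounds[OF k that(2)] unfolding norm_mult
      by (intro mult_mono) (auto simp: E_def \<rho>_def)
    then show ?thesis
      using k by (simp add: \<rho>_def)
  qed
  have away: "1 + x \<notin> \<real>\<^sub>\<le>\<^sub>0" "1 + x \<noteq> 0" if "norm x \<le> 1 / 2" for x :: complex
  proof -
    have "\<bar>Re x\<bar> \<le> 1 / 2"
      using that abs_Re_le_cmod[of x] by linarith
    then show "1 + x \<notin> \<real>\<^sub>\<le>\<^sub>0" "1 + x \<noteq> 0"
      by (auto simp: complex_nonpos_Reals_iff complex_eq_iff)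
  qed
  define g where "g t z = Ln (1 + t * E z)" for t z
  have g_holder: "g t \<in> holder_circle \<mu>" if "t \<in> ball 0 \<rho>" for t
    unfolding g_def
  proof (rule holder_circle_Ln[where \<rho> = "1 / 2"])
    show "(\<lambda>z. 1 + t * E z) \<in> holder_circle \<mu>"
      by (intro holder_circle_add holder_circle_const holder_circle_mult E \<mu>)
    show "norm (1 + t * E z - 1) \<le> 1 / 2" if "z \<in> unit_circle" for z
      using small[OF \<open>t \<in> ball 0 \<rho>\<close> that] by simp
  qed simp
  define C where "C t = obstruction k (g t) (g (- t))" for t
  have C_factorable: "factorable k \<mu> (\<lambda>p. exp (C t * eta p))" if t: "t \<in> ball 0 \<rho>" for t
  proof -
    have t': "- t \<in> ball 0 \<rho>"
      using t by simp
    define G where "G p = Ln (1 + t * eta p)" for p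
    have "G p = g t (moebius_coord \<i> p)" if "p \<in> contour1 k" for p
      using that by (simp add: G_def g_def E_def eta_contour)
    moreover have "G p = g (- t) (moebius_coord \<i> p)" if "p \<in> contour2 k" for p
      using that by (simp add: G_def g_def E_def eta_contour)
    ultimately obtain A1 B1 A2 B2 where *: "A1 \<in> disc_algebra \<mu>" "B1 \<in> disc_algebra \<mu>"
      "A2 \<in> disc_algebra \<mu>" "B2 \<in> disc_algebra \<mu>"
      "\<forall>p\<in>contour k. exp (G p) = side_exp (-\<i>) A1 B1 p * side_exp \<i> A2 B2 p * exp (C t * eta p)"
      unfolding C_def
      by (rule additive_decomposition_contour[OF k \<mu> g_holder[OF t] g_holder[OF t']])
    have "factorable k \<mu> (\<lambda>p. 1 + t * eta p)"
      by (intro factorable_rational rational_algebra.intros)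
    then have "factorable k \<mu> (\<lambda>p. (1 + t * eta p) * (side_exp (-\<i>) (\<lambda>z. - A1 z) (\<lambda>z. - B1 z) p *
        side_exp \<i> (\<lambda>z. - A2 z) (\<lambda>z. - B2 z) p))"
      by (intro factorable_mult factorable_side_exp disc_algebra_uminus *)
    then show ?thesis
    proof (rule factorable_cong)
      fix p assume p: "p \<in> contour k"
      have z: "moebius_coord \<i> p \<in> unit_circle"
        by (rule moebius_coord_contour[OF p]) simp
      have "eta p = E (moebius_coord \<i> p) \<or> eta p = - E (moebius_coord \<i> p)"
        using p eta_contour[of p k] by (auto simp: contour_eq E_def)
      then have "norm (t * eta p) \<le> 1 / 2"
        using small[OF t z] by auto
      then have "exp (G p) = 1 + t * eta p"
        using away(2) by (simp add: G_def)
      then have "1 + t * eta p = side_exp (-\<i>) A1 B1 p * side_exp \<i> A2 B2 p * exp (C t * eta p)"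
        using *(5) p by simp
      moreover have "side_exp a A B p * side_exp a (\<lambda>z. - A z) (\<lambda>z. - B z) p = 1" for a A B
        by (simp add: side_exp_def flip: exp_add)
      moreover have "(x * y * c) * (x' * y') = c" if "x * x' = 1" "y * y' = 1" for x y c x' y' :: complex
      proof -
        have "(x * y * c) * (x' * y') = (x * x') * (y * y') * c"
          by (simp only: mult_ac)
        then show ?thesis
          by (simp only: that mult_1)
      qed
      ultimately show "(1 + t * eta p) * (side_exp (-\<i>) (\<lambda>z. - A1 z) (\<lambda>z. - B1 z) p *
          side_exp \<i> (\<lambda>z. - A2 z) (\<lambda>z. - B2 z) p) = exp (C t * eta p)"
        by (simp only:)
    qed
  qed
  define F where "F t \<theta> = (g t (cis \<theta>) - g (- t) (cis \<theta>)) / (2 * E (cis \<theta>))" for t and \<theta> :: real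
  define F' where "F' t \<theta> = (1 / (1 + t * E (cis \<theta>)) + 1 / (1 - t * E (cis \<theta>))) / 2" for t and \<theta> :: real
  have E_cis: "continuous_on X (\<lambda>\<theta>. E (cis \<theta>))" for X
    using continuous_on_circle_param[OF E_cont, of 1] by simp
  have small_cis: "norm (t * E (cis \<theta>)) \<le> 1 / 2" "norm (- (t * E (cis \<theta>))) \<le> 1 / 2" if "t \<in> ball 0 \<rho>" for t \<theta>
    using small[OF that, of "cis \<theta>"] by auto
  have C_deriv: "(C has_field_derivative integral (cbox 0 (2*pi)) (F' t) / (2 * pi)) (at t)"
    if t: "t \<in> ball 0 \<rho>" for t
  proof -
    have "((\<lambda>t. integral (cbox 0 (2*pi)) (F t)) has_field_derivative integral (cbox 0 (2*pi)) (F' t)) (at t within ball 0 \<rho>)"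
    proof (rule leibniz_rule_field_derivative)
      fix t :: complex and \<theta> :: real
      assume t: "t \<in> ball 0 \<rho>"
      note s = away[OF small_cis(1)[OF t, of \<theta>]] away[OF small_cis(2)[OF t, of \<theta>]]
      have "((\<lambda>t. Ln (1 + t * E (cis \<theta>)) - Ln (1 + - t * E (cis \<theta>))) has_field_derivative
          inverse (1 + t * E (cis \<theta>)) * E (cis \<theta>) - inverse (1 + - t * E (cis \<theta>)) * (- E (cis \<theta>))) (at t within ball 0 \<rho>)"
        using s by (intro DERIV_diff DERIV_chain2[OF has_field_derivative_Ln]) (auto intro!: derivative_eq_intros)
      from DERIV_cdivide[OF this, of "2 * E (cis \<theta>)"]
      have "(((\<lambda>t. F t \<theta>)) has_field_derivative
          (inverse (1 + t * E (cis \<theta>)) * E (cis \<theta>) - inverse (1 + - t * E (cis \<theta>)) * (- E (cis \<theta>))) / (2 * E (cis \<theta>)))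
          (at t within ball 0 \<rho>)"
        by (simp only: F_def g_def)
      also have "(inverse (1 + t * E (cis \<theta>)) * E (cis \<theta>) - inverse (1 + - t * E (cis \<theta>)) * (- E (cis \<theta>))) / (2 * E (cis \<theta>))
          = E (cis \<theta>) * (inverse (1 + t * E (cis \<theta>)) + inverse (1 - t * E (cis \<theta>))) / (E (cis \<theta>) * 2)"
        by (simp add: algebra_simps)
      also have "\<dots> = F' t \<theta>"
        using E_nz[of "cis \<theta>"] by (simp add: F'_def inverse_eq_divide)
      finally show "((\<lambda>t. F t \<theta>) has_field_derivative F' t \<theta>) (at t within ball 0 \<rho>)" .
    next
      fix t :: complex
      assume t: "t \<in> ball 0 \<rho>"
      then have "- t \<in> ball 0 \<rho>"
        by simp
      have cont: "continuous_on X (\<lambda>\<theta>. g t (cis \<theta>))" if "t \<in> ball 0 \<rho>" for X t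
        using continuous_on_circle_param[OF holder_circle_continuous[OF g_holder[OF that] \<mu>(1)], of 1] by simp
      show "F t integrable_on cbox 0 (2*pi)"
        unfolding F_def using E_nz
        by (intro integrable_continuous continuous_intros cont E_cis t \<open>- t \<in> ball 0 \<rho>\<close>) auto
    next
      have "continuous_on (ball 0 \<rho> \<times> cbox 0 (2*pi)) (\<lambda>x. E (cis (snd x)))"
        by (intro continuous_on_compose2[OF E_cis[of UNIV]]) (auto intro!: continuous_intros)
      moreover have "1 + t * E (cis \<theta>) \<noteq> 0" "1 - t * E (cis \<theta>) \<noteq> 0" if "t \<in> ball 0 \<rho>" for t \<theta>
        using away(2)[OF small_cis(1)[OF that, of \<theta>]] away(2)[OF small_cis(2)[OF that, of \<theta>]] by auto
      ultimately show "continuous_on (ball 0 \<rho> \<times> cbox 0 (2*pi)) (\<lambda>(t, \<theta>). F' t \<theta>)"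
        unfolding F'_def split_beta by (intro continuous_intros) auto
    qed (use t in auto)
    moreover have "at t within ball 0 \<rho> = at t"
      using t by (intro at_within_open) auto
    ultimately have "((\<lambda>t. integral (cbox 0 (2*pi)) (F t)) has_field_derivative integral (cbox 0 (2*pi)) (F' t)) (at t)"
      by (simp only:)
    from DERIV_cdivide[OF this, of "2 * pi"] show ?thesis
      by (simp add: C_def[abs_def] obstruction_def circle_mean_def F_def[abs_def] E_def)
  qed
  have "C holomorphic_on ball 0 \<rho>"
    unfolding holomorphic_on_def field_differentiable_def
    by (intro ballI exI, rule has_field_derivative_at_within, rule C_deriv)
  moreover have "\<not> C constant_on ball 0 \<rho>"
  proof
    assume "C constant_on ball 0 \<rho>"
    then obtain c where c: "\<And>t. t \<in> ball 0 \<rho> \<Longrightarrow> C t = c"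
      unfolding constant_on_def by blast
    have "(C has_field_derivative 0) (at 0)"
      by (rule has_field_derivative_transform_within_open[where S = "ball 0 \<rho>" and f = "\<lambda>_. c"])
        (use \<rho> c in auto)
    moreover have "F' 0 = (\<lambda>_. 1)"
      by (simp add: F'_def fun_eq_iff)
    then have "(C has_field_derivative 1) (at 0)"
      using C_deriv[of 0] \<rho> by (simp add: scaleR_conv_of_real)
    ultimately show False
      using DERIV_unique by fastforce
  qed
  ultimately have "open (C ` ball 0 \<rho>)"
    by (intro open_mapping_thm[of C "ball 0 \<rho>" "ball 0 \<rho>"]) auto
  moreover have "0 \<in> C ` ball 0 \<rho>"
    by (rule image_eqI[of _ _ 0]) (use \<rho> in \<open>auto simp: C_def obstruction_def circle_mean_def\<close>)
  ultimately obtain \<delta> where \<delta>: "\<delta> > 0" "ball 0 \<delta> \<subseteq> C ` ball 0 \<rho>"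
    by (meson open_contains_ball)
  have "factorable k \<mu> (\<lambda>p. exp (c * eta p))" if "norm c < \<delta>" for c
  proof -
    have "c \<in> C ` ball 0 \<rho>"
      using \<delta> that by auto
    then show ?thesis
      using C_factorable by auto
  qed
  then show thesis
    using \<delta> by (intro that) auto
qed

text \<open>
  For an arbitrary obstruction \<open>c\<close>, the function \<open>exp (c * eta)\<close> is the \<open>n\<close>-th power of
  \<open>exp (c / n * eta)\<close>, which is factorable for large \<open>n\<close>.
\<close>

lemma exp_factorable:
  assumes k: "k > 1" and \<mu>: "0 < \<mu>" "\<mu> < 1"
    and g: "g1 \<in> holder_circle \<mu>" "g2 \<in> holder_circle \<mu>"
    and G: "\<And>p. p \<in> contour1 k \<Longrightarrow> G p = g1 (moebius_coord \<i> p)"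
      "\<And>p. p \<in> contour2 k \<Longrightarrow> G p = g2 (moebius_coord \<i> p)"
  shows "factorable k \<mu> (\<lambda>p. exp (G p))"
proof -
  obtain \<delta> where \<delta>: "\<delta> > 0" "\<forall>c. norm c < \<delta> \<longrightarrow> factorable k \<mu> (\<lambda>p. exp (c * eta p))"
    by (rule exp_small_eta_factorable[OF k \<mu>])
  define c where "c = obstruction k g1 g2"
  obtain n :: nat where n: "norm c / \<delta> < real n"
    using reals_Archimedean2 by blast
  then have "n > 0"
    using \<delta>(1) by (intro gr0I) (auto simp: divide_less_0_iff)
  then have "norm (c / of_nat n) < \<delta>"
    using n \<delta>(1) by (simp add: norm_divide field_simps)
  then have "factorable k \<mu> (\<lambda>p. exp (c / of_nat n * eta p) ^ n)"
    using \<delta>(2) by (intro factorable_power) auto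
  then have c: "factorable k \<mu> (\<lambda>p. exp (c * eta p))"
    by (rule factorable_cong) (use \<open>n > 0\<close> in \<open>simp flip: exp_of_nat_mult\<close>)
  obtain A1 B1 A2 B2 where *: "A1 \<in> disc_algebra \<mu>" "B1 \<in> disc_algebra \<mu>"
    "A2 \<in> disc_algebra \<mu>" "B2 \<in> disc_algebra \<mu>"
    "\<forall>p\<in>contour k. exp (G p) =
       side_exp (-\<i>) A1 B1 p * side_exp \<i> A2 B2 p * exp (obstruction k g1 g2 * eta p)"
    by (rule additive_decomposition_contour[OF k \<mu> g G])
  show ?thesis
    by (rule factorable_cong[OF factorable_mult[OF factorable_side_exp[OF *(1-4)] c]])
      (simp add: *(5) c_def)
qed

section \<open>Winding numbers\<close>

text \<open>
  A rational function that winds once around \<open>0\<close> along one of the two curves and not at all along the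
  other.  With \<open>w = moebius_coord \<i>\<close> it is \<open>(1 + q * w) / 2\<close>, where \<open>q > 1\<close> on the curve on which
  \<open>s * eta > 0\<close>, and \<open>0 \<le> q < 1\<close> on the other curve if \<open>\<bar>s\<bar> = 1\<close>, because \<open>1 \<le> \<bar>eta\<bar> \<le> k\<close> on the contour.
\<close>

definition loop_function :: "real \<Rightarrow> real \<Rightarrow> point \<Rightarrow> complex" where
  "loop_function k s p = (1 + (1 + of_real s * eta p / of_real k) * moebius_coord \<i> p) / 2"

lemma loop_function_rational: "loop_function k s \<in> rational_algebra"
proof -
  have "(\<lambda>p. (1 / 2) * (1 + (1 + of_real (s / k) * eta p) * moebius_coord \<i> p)) \<in> rational_algebra"
    by (intro rational_algebra.intros) simp
  moreover have "loop_function k s = (\<lambda>p. (1 / 2) * (1 + (1 + of_real (s / k) * eta p) * moebius_coord \<i> p))"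
    by (simp add: loop_function_def fun_eq_iff)
  ultimately show ?thesis
    by simp
qed

text \<open>
  The quotient by \<open>z\<close> on the first curve, and the function itself on the second one, take values in a disc
  about \<open>1\<close> of radius less than \<open>1\<close>.
\<close>

lemma loop_function_logarithms:
  assumes k: "k > 1" and \<mu>: "0 < \<mu>" "\<mu> < 1"
  obtains l1 l2 where "l1 \<in> holder_circle \<mu>" "l2 \<in> holder_circle \<mu>"
    "\<forall>z\<in>unit_circle. (1 + (1 + of_real (circle_eta k z) / of_real k) * z) / 2 = z * exp (l1 z)"
    "\<forall>z\<in>unit_circle. (1 + (1 - of_real (circle_eta k z) / of_real k) * z) / 2 = exp (l2 z)"
proof -
  define e where "e z = of_real (1 / k) * complex_of_real (circle_eta k z)" for z
  note mult = holder_circle_mult[OF _ _ \<mu>(1)]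
  have e: "e \<in> holder_circle \<mu>"
    unfolding e_def by (rule mult[OF holder_circle_const holder_circle_eta[OF k \<mu>]])
  have e_bound: "norm (e z - 1) \<le> 1 - 1 / k" if z: "z \<in> unit_circle" for z
  proof -
    have "e z - 1 = of_real (circle_eta k z / k - 1)"
      by (simp add: e_def)
    then have "norm (e z - 1) = \<bar>circle_eta k z / k - 1\<bar>"
      by (simp only: norm_of_real)
    then show ?thesis
      using circle_eta_bounds[OF k z] k by (simp add: abs_le_iff field_simps)
  qed
  define \<rho> where "\<rho> = (2 - 1 / k) / 2"
  have \<rho>: "\<rho> < 1"
    using k by (simp add: \<rho>_def field_simps)
  define q1 where "q1 z = (1 / 2) * ((1 + e z) + inverse z)" for z
  define q2 where "q2 z = (1 / 2) * (1 + (1 - e z) * z)" for z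
  have holder: "q1 \<in> holder_circle \<mu>" "q2 \<in> holder_circle \<mu>"
    unfolding q1_def q2_def
    by (intro mult holder_circle_const holder_circle_add holder_circle_diff e holder_circle_id[OF \<mu>]
        holder_circle_reflect[OF holder_circle_id[OF \<mu>]])+
  have near1: "norm (q1 z - 1) \<le> \<rho>" if z: "z \<in> unit_circle" for z
  proof -
    have "q1 z - 1 = ((e z - 1) + inverse z) / 2"
      by (simp add: q1_def algebra_simps add_divide_distrib)
    then have "norm (q1 z - 1) = norm ((e z - 1) + inverse z) / 2"
      by (simp only: norm_divide) simp
    also have "\<dots> \<le> (norm (e z - 1) + norm (inverse z)) / 2"
      by (intro divide_right_mono norm_triangle_ineq) simp
    finally show ?thesis
      using e_bound[OF z] z by (simp add: \<rho>_def norm_inverse)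
  qed
  have near2: "norm (q2 z - 1) \<le> \<rho>" if z: "z \<in> unit_circle" for z
  proof -
    have "q2 z - 1 = - (1 + (e z - 1) * z) / 2"
      by (simp add: q2_def algebra_simps add_divide_distrib)
    then have "norm (q2 z - 1) = norm (1 + (e z - 1) * z) / 2"
      by (simp only: norm_divide norm_minus_cancel) simp
    also have "\<dots> \<le> (1 + norm (e z - 1) * norm z) / 2"
      using norm_triangle_ineq[of 1 "(e z - 1) * z"] by (simp add: norm_mult)
    finally show ?thesis
      using e_bound[OF z] z by (simp add: \<rho>_def)
  qed
  have exp_Ln: "exp (Ln q) = q" if "norm (q - 1) \<le> \<rho>" for q :: complex
    using that \<rho> by (intro exp_Ln) auto
  show thesis
  proof (rule that)
    show "(\<lambda>z. Ln (q1 z)) \<in> holder_circle \<mu>" "(\<lambda>z. Ln (q2 z)) \<in> holder_circle \<mu>"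
      by (rule holder_circle_Ln[OF holder(1) \<rho> near1] holder_circle_Ln[OF holder(2) \<rho> near2], assumption)+
    show "\<forall>z\<in>unit_circle. (1 + (1 + of_real (circle_eta k z) / of_real k) * z) / 2 = z * exp (Ln (q1 z))"
    proof
      fix z :: complex assume z: "z \<in> unit_circle"
      then have "z \<noteq> 0"
        by auto
      then show "(1 + (1 + of_real (circle_eta k z) / of_real k) * z) / 2 = z * exp (Ln (q1 z))"
        by (simp only: exp_Ln[OF near1[OF z]]) (simp add: q1_def e_def algebra_simps)
    qed
    show "\<forall>z\<in>unit_circle. (1 + (1 - of_real (circle_eta k z) / of_real k) * z) / 2 = exp (Ln (q2 z))"
    proof
      fix z :: complex assume z: "z \<in> unit_circle"
      show "(1 + (1 - of_real (circle_eta k z) / of_real k) * z) / 2 = exp (Ln (q2 z))"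
        by (simp only: exp_Ln[OF near2[OF z]]) (simp add: q2_def e_def)
    qed
  qed
qed

theorem theorem4p4:
  fixes k\<^sub>0 \<mu> :: real and f :: "point \<Rightarrow> complex"
  assumes "k\<^sub>0 > 1" and "0 < \<mu>" and "\<mu> < 1"
    and "f \<in> units_on (contour k\<^sub>0) (holder_contour k\<^sub>0 \<mu>)"
  shows "has_surf_factorization k\<^sub>0 \<mu> f"
proof -
  note k = assms(1) and \<mu> = assms(2,3)
  let ?w = "moebius_coord \<i>"
  have f_nz: "f p \<noteq> 0" if "p \<in> contour k\<^sub>0" for p
    using assms(4) that by (force simp: units_on_def)
  obtain u1 u2 where u: "u1 \<in> holder_circle \<mu>" "u2 \<in> holder_circle \<mu>"
    "\<forall>p\<in>contour1 k\<^sub>0. f p = u1 (?w p)" "\<forall>p\<in>contour2 k\<^sub>0. f p = u2 (?w p)"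
    using assms(4) unfolding units_on_def holder_contour_iff by blast
  have "u1 z \<noteq> 0" if z: "z \<in> unit_circle" for z
  proof -
    obtain p where "p \<in> contour1 k\<^sub>0" "?w p = z"
      by (rule moebius_coord_onto[OF bij_betw_proj_contour1 z])
    then show ?thesis
      using f_nz[of p] u(3) by (auto simp: contour_eq)
  qed
  then obtain n1 v1 where v1: "v1 \<in> holder_circle \<mu>" "\<forall>z\<in>unit_circle. u1 z = z powi n1 * exp (v1 z)"
    by (rule holder_logarithm[OF u(1) \<mu>])
  have "u2 z \<noteq> 0" if z: "z \<in> unit_circle" for z
  proof -
    obtain p where "p \<in> contour2 k\<^sub>0" "?w p = z"
      by (rule moebius_coord_onto[OF bij_betw_proj_contour2 z])
    then show ?thesis
      using f_nz[of p] u(4) by (auto simp: contour_eq)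
  qed
  then obtain n2 v2 where v2: "v2 \<in> holder_circle \<mu>" "\<forall>z\<in>unit_circle. u2 z = z powi n2 * exp (v2 z)"
    by (rule holder_logarithm[OF u(2) \<mu>])
  obtain l1 l2 where l: "l1 \<in> holder_circle \<mu>" "l2 \<in> holder_circle \<mu>"
    "\<forall>z\<in>unit_circle. (1 + (1 + of_real (circle_eta k\<^sub>0 z) / of_real k\<^sub>0) * z) / 2 = z * exp (l1 z)"
    "\<forall>z\<in>unit_circle. (1 + (1 - of_real (circle_eta k\<^sub>0 z) / of_real k\<^sub>0) * z) / 2 = exp (l2 z)"
    by (rule loop_function_logarithms[OF k \<mu>])
  \<comment> \<open>The powers of the two loop functions have non-negative windings; \<open>m\<close> factors
    \<open>1 / w\<close>, with winding \<open>-1\<close> along both curves, make up for the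
    difference.\<close>
  define m where "m = nat (max 0 (max (- n1) (- n2)))"
  define a where "a = nat (n1 + int m)"
  define b where "b = nat (n2 + int m)"
  have n: "n1 = int a - int m" "n2 = int b - int m"
    by (auto simp: m_def a_def b_def)
  have power: "z powi (int c - int m) = inverse z ^ m * z ^ c" if "z \<in> unit_circle" for z :: complex and c
  proof -
    have "z \<noteq> 0"
      using that by auto
    then show ?thesis
      by (simp add: power_int_diff field_simps)
  qed
  define r where "r p = moebius_coord (-\<i>) p ^ m * (loop_function k\<^sub>0 1 p ^ a * loop_function k\<^sub>0 (-1) p ^ b)" for p
  have r: "r \<in> rational_algebra"
    unfolding r_def
    by (intro rational_algebra.mult rational_algebra_power loop_function_rational rational_algebra.moebius) simp
  define g1 where "g1 z = v1 z - (of_nat a * l1 z + of_nat b * l2 z)" for z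
  define g2 where "g2 z = v2 z - (of_nat a * l2 z + of_nat b * l1 z)" for z
  have g: "g1 \<in> holder_circle \<mu>" "g2 \<in> holder_circle \<mu>"
    unfolding g1_def g2_def
    by (intro holder_circle_diff holder_circle_add holder_circle_mult[OF holder_circle_const] v1 v2 l \<mu>)+
  define G where "G p = (if p \<in> contour1 k\<^sub>0 then g1 (?w p) else g2 (?w p))" for p
  have disjoint: "contour1 k\<^sub>0 \<inter> contour2 k\<^sub>0 = {}"
    using k by (intro contour_disjoint) auto
  have G: "G p = g1 (?w p)" if "p \<in> contour1 k\<^sub>0" for p
    using that by (simp add: G_def)
  have G': "G p = g2 (?w p)" if "p \<in> contour2 k\<^sub>0" for p
    using that disjoint by (auto simp: G_def)
  have "factorable k\<^sub>0 \<mu> (\<lambda>p. r p * exp (G p))"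
    by (intro factorable_mult factorable_rational r exp_factorable[OF k \<mu> g G G'])
  then have "factorable k\<^sub>0 \<mu> f"
  proof (rule factorable_cong)
    fix p assume p: "p \<in> contour k\<^sub>0"
    define z where "z = ?w p"
    have z: "z \<in> unit_circle"
      unfolding z_def by (rule moebius_coord_contour[OF p]) simp
    consider "p \<in> contour1 k\<^sub>0" | "p \<in> contour2 k\<^sub>0"
      using p by (auto simp: contour_eq)
    then show "r p * exp (G p) = f p"
    proof cases
      case 1
      have "loop_function k\<^sub>0 1 p = z * exp (l1 z)" "loop_function k\<^sub>0 (-1) p = exp (l2 z)"
        using l(3,4) z 1 by (simp_all add: loop_function_def eta_contour flip: z_def)
      then have "r p * exp (G p) = inverse z ^ m * z ^ a *
          (exp (l1 z) ^ a * exp (l2 z) ^ b * exp (g1 z))"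
        using 1 by (simp add: r_def moebius_coord_minus G power_mult_distrib flip: z_def)
      also have "exp (l1 z) ^ a * exp (l2 z) ^ b * exp (g1 z) = exp (v1 z)"
        by (simp add: g1_def flip: exp_of_nat_mult exp_add)
      also have "inverse z ^ m * z ^ a * exp (v1 z) = f p"
        using u(3) v1(2) z 1 by (simp add: n power flip: z_def)
      finally show ?thesis .
    next
      case 2
      have "loop_function k\<^sub>0 1 p = exp (l2 z)" "loop_function k\<^sub>0 (-1) p = z * exp (l1 z)"
        using l(3,4) z 2 by (simp_all add: loop_function_def eta_contour flip: z_def)
      then have "r p * exp (G p) = inverse z ^ m * z ^ b *
          (exp (l2 z) ^ a * exp (l1 z) ^ b * exp (g2 z))"
        using 2 by (simp add: r_def moebius_coord_minus G' power_mult_distrib flip: z_def)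
      also have "exp (l2 z) ^ a * exp (l1 z) ^ b * exp (g2 z) = exp (v2 z)"
        by (simp add: g2_def flip: exp_of_nat_mult exp_add)
      also have "inverse z ^ m * z ^ b * exp (v2 z) = f p"
        using u(4) v2(2) z 2 by (simp add: n power flip: z_def)
      finally show ?thesis .
    qed
  qed
  then show ?thesis
    by (rule factorable_imp_surf_factorization[OF k \<mu>])
qed

end
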